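(* Let $n\ge 3$ and let $\mathcal{B}_R$ be a geodesic ball of radius $R\in(0,\pi/2)$ in the elliptic space $\mathbb{S}^n$, i.e. the Riemannian model with metric $ds^2=dr^2+\sin(r)^2\,d\Theta^2$ in polar coordinates around the center. Consider the problem $$-\Delta_g u=\lambda f(u)\ \text{in }\mathcal{B}_R,\qquad u>0\ \text{in }\mathcal{B}_R,\qquad u=0\ \text{on }\partial\mathcal{B}_R,$$ with extremal parameter $\lambda^*$ and extremal solution $u^*$. Let $$R_0:=\sup\Big\{s\in(0,\pi/2):\frac{\sin^2 s}{(1-\cos s)^2}>n(n-2)\Big\},$$ and $N(m):=2+\frac{4m}{m-1}+4\sqrt{\frac{m}{m-1}}$ for $m>1$. (i) Let $f(u)=\frac{e^u}{\sin(R)^2}-\frac{n-1}{n-2}$ and $R_{\rm e}:=\arcsin\left(\sqrt{\frac{n-2}{n-1}}\right)$. If $n\ge 10$ and $R<\min\{R_0,R_{\rm e}\}$, then $\lambda^*=2(n-2)$ and $u^*(r)=-2\log\left(\frac{\sin r}{\sin R}\right)$. (ii) Let $m>1$, $f(u)=\left(u+\sin(R)^{-\frac{2}{m-1}}\right)\left(\left(u+\sin(R)^{-\frac{2}{m-1}}\right)^{m-1}-\frac{(m-1)n-(m+1)}{(m-1)n-2m}\right)$ and $R_{\rm p}:=\arcsin\left(\sqrt{\frac{n-2}{n}}\right)$. If $n\ge N(m)$ and $R<\min\{R_0,R_{\rm p}\}$, then $\lambda^*=\frac{2}{m-1}\left(n-\frac{2m}{m-1}\right)$ and $u^*(r)=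\sin(r)^{-\frac{2}{m-1}}-\sin(R)^{-\frac{2}{m-1}}$.
   Context: $\Delta_g$ is the Laplace–Beltrami operator and $r$ the geodesic distance to the center of the ball. For $f$ a $C^1$ positive increasing function with $\lim_{t\to\infty}f(t)/t=+\infty$, there is $\lambda^*\in(0,\infty)$ such that for $\lambda\in(0,\lambda^* )$ the problem has a minimal classical solution $u_\lambda$ (smaller than any supersolution), which is semistable and increasing in $\lambda$, and for $\lambda>\lambda^*$ there is no classical solution; $\lambda^*$ is the extremal parameter and $u^*:=\lim_{\lambda\uparrow\lambda^*}u_\lambda$ is the extremal solution, a weak solution for $\lambda=\lambda^*$ (i.e. $u^*\in L^1$, $f(u^* )(R-r)\in L^1$, and $-\int u^*\Delta_g\xi\,dv_g=\lambda^*\int f(u^* )\xi\,dv_g$ for all $\xi\in C^1_0(\mathcal{B}_R)$). *)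

theory Defs
  imports "HOL-Analysis.Analysis"
begin

text \<open>The elliptic space as a Riemannian model: points are written in geodesic normal
  coordinates x in real^'n around the centre, r = norm x is the geodesic distance to the
  centre, and the metric is dr^2 + sin(r)^2 dTheta^2.  In Cartesian normal coordinates
  g_ij = P_ij + (sin r / r)^2 (delta_ij - P_ij) with P_ij = x_i x_j / r^2, hence
  g^ij = delta_ij + (1/sin(r)^2 - 1/r^2) (r^2 delta_ij - x_i x_j) and
  sqrt(det g) = (sin r / r)^(n-1).  The geodesic ball B_R is ball 0 R.\<close>

definition sinc_r :: "real \<Rightarrow> real" where
  "sinc_r r = (if r = 0 then 1 else sin r / r)"

definition cg :: "real \<Rightarrow> real" where
  "cg r = (if r = 0 then 1/3 else 1 / (sin r)^2 - 1 / r^2)"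

definition sqrtdetg :: "real^'n \<Rightarrow> real" where
  "sqrtdetg x = (sinc_r (norm x)) ^ (CARD('n) - 1)"

definition ginv :: "real^'n \<Rightarrow> 'n \<Rightarrow> 'n \<Rightarrow> real" where
  "ginv x i j = (if i = j then 1 else 0)
      + cg (norm x) * ((norm x)^2 * (if i = j then 1 else 0) - x$i * x$j)"

definition pd :: "'n \<Rightarrow> (real^'n \<Rightarrow> real) \<Rightarrow> real^'n \<Rightarrow> real" where
  "pd i u x = deriv (\<lambda>t. u (x + t *\<^sub>R axis i 1)) 0"

definition LB :: "(real^'n \<Rightarrow> real) \<Rightarrow> real^'n \<Rightarrow> real" where
  "LB u x = (\<Sum>i\<in>UNIV. pd i (\<lambda>y. sqrtdetg y * (\<Sum>j\<in>UNIV. ginv y i j * pd j u y)) x)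
            / sqrtdetg x"

definition C2_on :: "(real^'n) set \<Rightarrow> (real^'n \<Rightarrow> real) \<Rightarrow> bool" where
  "C2_on S u \<longleftrightarrow> open S \<and> (\<forall>x\<in>S. u differentiable (at x)) \<and>
     (\<forall>j. continuous_on S (pd j u) \<and> (\<forall>x\<in>S. pd j u differentiable (at x)) \<and>
          (\<forall>i. continuous_on S (pd i (pd j u))))"

definition classical_sol :: "real \<Rightarrow> (real \<Rightarrow> real) \<Rightarrow> real \<Rightarrow> (real^'n \<Rightarrow> real) \<Rightarrow> bool" where
  "classical_sol lam f R u \<longleftrightarrow>
     C2_on (ball 0 R) u \<and> continuous_on (cball 0 R) u \<and>
     (\<forall>x\<in>ball 0 R. - LB u x = lam * f (u x)) \<and>
     (\<forall>x\<in>ball 0 R. u x > 0) \<and> (\<forall>x\<in>sphere 0 R. u x = 0)"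

definition classical_super :: "real \<Rightarrow> (real \<Rightarrow> real) \<Rightarrow> real \<Rightarrow> (real^'n \<Rightarrow> real) \<Rightarrow> bool" where
  "classical_super lam f R v \<longleftrightarrow>
     C2_on (ball 0 R) v \<and> continuous_on (cball 0 R) v \<and>
     (\<forall>x\<in>ball 0 R. - LB v x \<ge> lam * f (v x)) \<and>
     (\<forall>x\<in>cball 0 R. v x \<ge> 0)"

definition minimal_sol :: "real \<Rightarrow> (real \<Rightarrow> real) \<Rightarrow> real \<Rightarrow> (real^'n \<Rightarrow> real) \<Rightarrow> bool" where
  "minimal_sol lam f R u \<longleftrightarrow> classical_sol lam f R u \<and>
     (\<forall>v. classical_super lam f R v \<longrightarrow> (\<forall>x\<in>cball 0 R. u x \<le> v x))"

text \<open>The minimal solution u_lam (its value at x; determined on the closed ball).\<close>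
definition u_min :: "real \<Rightarrow> (real \<Rightarrow> real) \<Rightarrow> real \<Rightarrow> real^'n \<Rightarrow> real" where
  "u_min lam f R x = (THE t. \<exists>u::real^'n \<Rightarrow> real. minimal_sol lam f R u \<and> u x = t)"

definition lam_star :: "'n::finite itself \<Rightarrow> (real \<Rightarrow> real) \<Rightarrow> real \<Rightarrow> real" where
  "lam_star _ f R = Sup {lam. lam > 0 \<and> (\<exists>u::real^'n \<Rightarrow> real. classical_sol lam f R u)}"

definition R0 :: "nat \<Rightarrow> real" where
  "R0 n = Sup {s. 0 < s \<and> s < pi/2 \<and> (sin s)^2 / (1 - cos s)^2 > real n * (real n - 2)}"

definition Nm :: "real \<Rightarrow> real" where
  "Nm m = 2 + 4*m/(m-1) + 4 * sqrt (m/(m-1))"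

end

theory Submission
  imports Defs "HOL-Real_Asymp.Real_Asymp"
begin

text \<open>The function U in the claim is an explicit singular radial solution for the parameter claimed
  to be extremal, and the condition on n together with Hardy's inequality, improved on the ball by
  R < R0, makes it semistable.  Three facts then give the theorem.

  (1) The minimal solutions are limits of the iteration \<open>-\<Delta>u' = \<lambda> f(u)\<close> started at 0, which
  is radial and stays below every supersolution, radial or not, by the maximum principle.

  (2) For smaller \<open>\<lambda>\<close> a concave function of U is a bounded supersolution (Brezis, Cazenave, Martel,
  Ramiandrisoana), so a minimal classical solution exists, and it lies below U.

  (3) U is the only radial solution v with \<open>0 \<le> v \<le> U\<close>: convexity of f makes U - v a subsolution of
  the linearised equation, and comparison with a positive supersolution h of that equation forces
  U - v \<le> 0.  Applied to the limit of the minimal solutions this identifies the extremal solution;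
  applied to the iteration below a classical solution for a larger parameter it shows that U would
  be bounded.\<close>

section \<open>Radial functions in normal coordinates\<close>

text \<open>The obstacle is that \<open>U\<close> is unbounded at the centre, so neither it nor its
  linearised equation fits a theory for bounded data. Weak solutions and Sobolev spaces are avoided:
  all singular behaviour is radial, where the equation says that \<open>wt r * u' r\<close> has
  derivative \<open>- lam * wt r * f (u r)\<close>, and a limit of such fluxes at 0 plays the part
  of a boundary condition at the centre. Semistability enters as a positive \<open>h\<close> with
  \<open>-\<Delta>h \<ge> lamS * f'(U) * h\<close>, not as a quadratic form. The only genuinely
  non-radial step is the comparison with arbitrary supersolutions. Origin of the constants: in both
  cases f'(U) is, up to an additive constant, a multiple of 1/sin(r)^2, so stability compares a
  number with the Hardy constant ((n-2)/2)^2. This is what \<open>n \<ge> 10\<close> and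
  \<open>n \<ge> Nm m\<close> provide. The bounds R_e and R_p give f(0) > 0. Curvature costs a term
  n(n-2)/4 in Hardy's inequality, and \<open>R < R0\<close> allows a correcting factor to repay
  it.\<close>

lemma pd_eq:
  assumes "(u has_derivative D) (at x)"
  shows "pd i u x = D (axis i 1)"
proof -
  have "((\<lambda>t::real. x + t *\<^sub>R axis i 1) has_derivative (\<lambda>t. t *\<^sub>R axis i 1)) (at 0)"
    by (auto intro!: derivative_eq_intros)
  from diff_chain_at[OF this, of u D] assms
  have "((\<lambda>t. u (x + t *\<^sub>R axis i 1)) has_derivative (\<lambda>t. D (t *\<^sub>R axis i 1))) (at 0)"
    by (simp add: o_def)
  moreover have "(\<lambda>t. D (t *\<^sub>R axis i 1)) = (*) (D (axis i 1))"
    using has_derivative_linear[OF assms] by (simp add: fun_eq_iff linear_scale)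
  ultimately have "((\<lambda>t. u (x + t *\<^sub>R axis i 1)) has_real_derivative D (axis i 1)) (at 0)"
    by (simp add: has_field_derivative_def)
  then show ?thesis by (simp add: pd_def DERIV_imp_deriv)
qed

lemma has_derivative_pd:
  assumes "u differentiable (at x)"
  shows "(u has_derivative (\<lambda>h. \<Sum>j\<in>UNIV. h $ j * pd j u x)) (at x)"
proof -
  obtain D where D: "(u has_derivative D) (at x)"
    using assms by (auto simp: differentiable_def)
  interpret D: linear D by (rule has_derivative_linear[OF D])
  have "D h = (\<Sum>j\<in>UNIV. h $ j * pd j u x)" for h
  proof -
    have "D h = D (\<Sum>j\<in>UNIV. h $ j *\<^sub>R axis j 1)"
      by (subst basis_expansion[symmetric, of h]) (simp add: scalar_mult_eq_scaleR)
    also have "\<dots> = (\<Sum>j\<in>UNIV. h $ j * pd j u x)"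
      by (simp add: D.sum D.scale pd_eq[OF D])
    finally show ?thesis .
  qed
  then have "D = (\<lambda>h. \<Sum>j\<in>UNIV. h $ j * pd j u x)" by auto
  with D show ?thesis by simp
qed

text \<open>Formulas for first derivatives hold only on an open set; this is what allows a second
  \<open>pd\<close> to be taken of them.\<close>

lemma pd_cong_open:
  assumes "open S" "x \<in> S" "\<And>y. y \<in> S \<Longrightarrow> u y = v y"
  shows "pd i u x = pd i v x"
proof -
  have "((\<lambda>t::real. x + t *\<^sub>R axis i 1) \<longlongrightarrow> x + 0 *\<^sub>R axis i 1) (nhds 0)"
    by (intro tendsto_intros) (simp add: filterlim_ident)
  then have "\<forall>\<^sub>F t in nhds (0::real). x + t *\<^sub>R axis i 1 \<in> S"
    using assms(1,2) by (auto simp: tendsto_def)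
  then have "\<forall>\<^sub>F t in nhds (0::real). u (x + t *\<^sub>R axis i 1) = v (x + t *\<^sub>R axis i 1)"
    by (rule eventually_mono) (use assms(3) in auto)
  then show ?thesis unfolding pd_def by (rule deriv_cong_ev) simp
qed

lemma pd_diff:
  assumes "u differentiable (at x)" "v differentiable (at x)"
  shows "pd i (\<lambda>y. u y - v y) x = pd i u x - pd i v x"
  using has_derivative_diff[OF has_derivative_pd[OF assms(1)] has_derivative_pd[OF assms(2)]]
    pd_eq[OF has_derivative_pd[OF assms(1)], of i] pd_eq[OF has_derivative_pd[OF assms(2)], of i]
  by (simp add: pd_eq)

lemma differentiable_transform_open:
  fixes u :: "'a::real_normed_vector \<Rightarrow> real"
  assumes "u differentiable (at x)" "open S" "x \<in> S" "\<And>y. y \<in> S \<Longrightarrow> u y = v y"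
  shows "v differentiable (at x)"
  using assms has_derivative_transform_within_open unfolding differentiable_def by blast

lemma C2_on_diff:
  assumes "C2_on S u" "C2_on S v"
  shows "C2_on S (\<lambda>x. u x - v x)"
proof -
  have op: "open S" using assms by (simp add: C2_on_def)
  have 1: "pd j (\<lambda>x. u x - v x) x = pd j u x - pd j v x" if "x \<in> S" for j x
    using assms that by (intro pd_diff) (auto simp: C2_on_def)
  have 2: "pd i (pd j (\<lambda>x. u x - v x)) x = pd i (pd j u) x - pd i (pd j v) x" if "x \<in> S" for i j x
  proof -
    have "pd i (pd j (\<lambda>x. u x - v x)) x = pd i (\<lambda>x. pd j u x - pd j v x) x"
      by (rule pd_cong_open[OF op that 1])
    with assms that show ?thesis by (simp add: C2_on_def pd_diff)
  qed
  have 3: "pd j (\<lambda>x. u x - v x) differentiable (at x)" if "x \<in> S" for j x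
    by (rule differentiable_transform_open[OF _ op that 1[symmetric]])
      (use assms that in \<open>auto simp: C2_on_def intro!: differentiable_diff\<close>)
  have 4: "continuous_on S (pd j (\<lambda>x. u x - v x))" for j
    by (subst continuous_on_cong[OF refl 1], assumption)
      (use assms in \<open>auto simp: C2_on_def intro!: continuous_intros\<close>)
  have 5: "continuous_on S (pd i (pd j (\<lambda>x. u x - v x)))" for i j
    by (subst continuous_on_cong[OF refl 2], assumption)
      (use assms in \<open>auto simp: C2_on_def intro!: continuous_intros\<close>)
  show ?thesis using assms 3 4 5 by (auto simp: C2_on_def intro!: differentiable_diff)
qed

section \<open>Differentials of radial functions and radial fields, including at the centre\<close>

lemma radial_has_derivative:
  fixes x :: "real^'n"
  assumes "x \<noteq> 0" "(w has_real_derivative d) (at (norm x))"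
  shows "((\<lambda>y. w (norm y)) has_derivative (\<lambda>h. d / norm x * (x \<bullet> h))) (at x)"
proof -
  have "((\<lambda>y. w (norm y)) has_derivative (\<lambda>h. d * (h \<bullet> sgn x))) (at x)"
    using diff_chain_at[OF has_derivative_norm[OF assms(1)], of w "(*) d"] assms(2)
    by (simp add: o_def has_field_derivative_def)
  moreover have "d * (h \<bullet> sgn x) = d / norm x * (x \<bullet> h)" for h
    by (simp add: sgn_div_norm inner_commute divide_inverse)
  ultimately show ?thesis by simp
qed

lemma tendsto_norm_at_right: "filterlim norm (at_right 0) (at (0::'a::real_normed_vector))"
proof -
  have "filterlim norm (nhds 0) (at (0::'a))"
    using tendsto_norm[OF tendsto_ident_at, of "0::'a" UNIV] by simp
  then show ?thesis
    by (auto simp: filterlim_at eventually_at_filter)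
qed

text \<open>The norm has a kink at 0, but the difference quotient by \<open>norm y\<close> is the
  one-sided quotient of \<open>w\<close>, so a vanishing one-sided slope smooths it.\<close>

lemma radial_has_derivative_0:
  fixes w :: "real \<Rightarrow> real"
  assumes "(w has_real_derivative 0) (at_right 0)"
  shows "((\<lambda>y::real^'n. w (norm y)) has_derivative (\<lambda>h. 0)) (at 0)"
proof -
  have "((\<lambda>y. (w y - w 0) / (y - 0)) \<longlongrightarrow> 0) (at_right 0)"
    using assms by (simp add: has_field_derivative_iff)
  from filterlim_compose[OF this tendsto_norm_at_right[where 'a="real^'n"]]
  have "((\<lambda>y::real^'n. (w (norm y) - w 0) / norm y) \<longlongrightarrow> 0) (at 0)" by simp
  then have "((\<lambda>y::real^'n. norm ((w (norm y) - w 0) / norm y)) \<longlongrightarrow> 0) (at 0)"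
    by (rule tendsto_norm_zero)
  then show ?thesis by (simp add: has_derivative_at)
qed

lemma radial_field_has_derivative:
  fixes x :: "real^'n"
  assumes "x \<noteq> 0" "(B has_real_derivative b) (at (norm x))"
  shows "((\<lambda>y. B (norm y) * y $ i) has_derivative
    (\<lambda>h. B (norm x) * h $ i + b / norm x * (x \<bullet> h) * x $ i)) (at x)"
  by (rule has_derivative_mult[OF radial_has_derivative[OF assms]
        bounded_linear.has_derivative[OF bounded_linear_vec_nth has_derivative_ident], THEN has_derivative_eq_rhs]) simp

text \<open>Continuity of \<open>B\<close> at 0 suffices, because the error
  \<open>(B (norm y) - B 0) * y $ i\<close> is o(norm y).\<close>

lemma radial_field_has_derivative_0:
  fixes B :: "real \<Rightarrow> real"
  assumes "(B \<longlongrightarrow> B 0) (at_right 0)"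
  shows "((\<lambda>y::real^'n. B (norm y) * y $ i) has_derivative (\<lambda>h. B 0 * h $ i)) (at 0)"
proof -
  have "((\<lambda>y::real^'n. B (norm y) - B 0) \<longlongrightarrow> 0) (at 0)"
    using filterlim_compose[OF assms tendsto_norm_at_right[where 'a="real^'n"]]
    by (simp add: LIM_zero)
  then have "((\<lambda>y::real^'n. norm ((B (norm y) - B 0) * y $ i) / norm y) \<longlongrightarrow> 0) (at 0)"
  proof (rule Lim_null_comparison[rotated, OF tendsto_norm_zero])
    show "\<forall>\<^sub>F y::real^'n in at 0. norm (norm ((B (norm y) - B 0) * y $ i) / norm y) \<le> norm (B (norm y) - B 0)"
    proof (rule eventuallyI)
      fix y :: "real^'n"
      have "\<bar>y $ i\<bar> \<le> norm y" by (rule component_le_norm_cart)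
      then show "norm (norm ((B (norm y) - B 0) * y $ i) / norm y) \<le> norm (B (norm y) - B 0)"
        by (cases "y = 0") (auto simp: abs_mult divide_le_eq mult_left_mono)
    qed
  qed
  moreover have "bounded_linear (\<lambda>h::real^'n. B 0 * h $ i)"
    by (intro bounded_linear_const_mult bounded_linear_vec_nth)
  ultimately show ?thesis
    by (simp add: has_derivative_at algebra_simps)
qed

lemma pd_radial_field:
  fixes x :: "real^'n"
  assumes "x \<noteq> 0" "(B has_real_derivative b) (at (norm x))"
  shows "pd j (\<lambda>y. B (norm y) * y $ i) x =
     B (norm x) * (if i = j then 1 else 0) + b / norm x * x $ j * x $ i"
  by (subst pd_eq[OF radial_field_has_derivative[OF assms]])
    (simp add: inner_axis, auto simp: axis_def)

lemma pd_radial_field_0: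
  assumes "(B \<longlongrightarrow> B 0) (at_right 0)"
  shows "pd j (\<lambda>y::real^'n. B (norm y) * y $ i) 0 = B 0 * (if i = j then 1 else 0)"
  by (subst pd_eq[OF radial_field_has_derivative_0[OF assms]]) (auto simp: axis_def)

text \<open>The Gauss lemma: the radial direction is an eigenvector of the metric with eigenvalue 1,
  so the gradient of a radial function is the Euclidean one.\<close>

lemma sum_ginv_mult:
  fixes x :: "real^'n"
  shows "(\<Sum>j\<in>UNIV. ginv x i j * x $ j) = x $ i"
proof -
  let ?d = "\<lambda>j. (if i = j then 1 else 0) * x $ j"
  have "ginv x i j * x $ j = ?d j + cg (norm x) * ((norm x)\<^sup>2 * ?d j - x $ i * (x $ j * x $ j))" for j
    unfolding ginv_def by algebra
  then have "(\<Sum>j\<in>UNIV. ginv x i j * x $ j) =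
     sum ?d UNIV + cg (norm x) * ((norm x)\<^sup>2 * sum ?d UNIV - x $ i * (\<Sum>j\<in>UNIV. x $ j * x $ j))"
    by (simp only: sum.distrib sum_subtractf flip: sum_distrib_left)
  moreover have "sum ?d UNIV = x $ i"
    by (simp add: if_distrib[of "\<lambda>a. a * _"] cong: if_cong)
  moreover have "(norm x)\<^sup>2 = (\<Sum>j\<in>UNIV. x $ j * x $ j)"
    by (simp add: power2_norm_eq_inner inner_vec_def)
  ultimately show ?thesis by simp
qed

text \<open>The slope is written \<open>r * q r\<close> because then the gradient is the field
  \<open>q (norm x) * x\<close>, free of the singular unit vector. Its derivative contains
  \<open>q1 (norm x) / norm x * x $ i * x $ j\<close>, of size at most \<open>r * q1 r\<close>; the
  last limit makes the Hessian continuous at the centre.\<close>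

locale radial_C2 =
  fixes R :: real and w q q1 :: "real \<Rightarrow> real" and u :: "real^'n \<Rightarrow> real"
  assumes R_pos: "0 < R"
    and w_deriv: "\<And>r. 0 < r \<Longrightarrow> r < R \<Longrightarrow> (w has_real_derivative r * q r) (at r)"
    and w_deriv_0: "(w has_real_derivative 0) (at_right 0)"
    and q_deriv: "\<And>r. 0 < r \<Longrightarrow> r < R \<Longrightarrow> (q has_real_derivative q1 r) (at r)"
    and q_cont_0: "(q \<longlongrightarrow> q 0) (at_right 0)"
    and q1_cont: "continuous_on {0<..<R} q1"
    and q1_0: "((\<lambda>r. r * q1 r) \<longlongrightarrow> 0) (at_right 0)"
    and u_def: "u = (\<lambda>x. w (norm x))"
begin

lemma u_has_derivative:
  assumes "x \<in> ball 0 R"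
  shows "(u has_derivative (\<lambda>h. q (norm x) * (x \<bullet> h))) (at x)"
proof (cases "x = 0")
  case True
  then show ?thesis using radial_has_derivative_0[OF w_deriv_0] by (simp add: u_def)
next
  case False
  then show ?thesis using radial_has_derivative[OF False w_deriv[of "norm x"]] False assms by (simp add: u_def)
qed

lemma pd_u:
  assumes "x \<in> ball 0 R"
  shows "pd j u x = q (norm x) * x $ j"
  by (subst pd_eq[OF u_has_derivative[OF assms]]) (simp add: inner_axis)

lemma pd_pd_u:
  assumes "x \<in> ball 0 R" 
  shows "pd i (pd j u) x = q (norm x) * (if j = i then 1 else 0) + q1 (norm x) / norm x * x $ i * x $ j"
proof -
  have "pd i (pd j u) x = pd i (\<lambda>y. q (norm y) * y $ j) x"
    by (rule pd_cong_open[of "ball 0 R"]) (use assms pd_u in auto)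
  also have "\<dots> = q (norm x) * (if j = i then 1 else 0) + q1 (norm x) / norm x * x $ i * x $ j"
    using pd_radial_field[OF _ q_deriv[of "norm x"], of i j] pd_radial_field_0[OF q_cont_0, of i j] assms
    by (cases "x = 0") simp_all
  finally show ?thesis .
qed

lemma q_norm_cont: "continuous_on (ball 0 R) (\<lambda>x::real^'n. q (norm x))"
proof (rule continuous_at_imp_continuous_on, rule ballI)
  fix x :: "real^'n" assume x: "x \<in> ball 0 R"
  show "isCont (\<lambda>x. q (norm x)) x"
  proof (cases "x = 0")
    case True
    then show ?thesis
      using filterlim_compose[OF q_cont_0 tendsto_norm_at_right[where 'a="real^'n"]]
      by (simp add: isCont_def)
  next
    case False
    have "isCont q (norm x)" using q_deriv[of "norm x"] False x by (auto intro: DERIV_isCont)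
    then show ?thesis by (intro isCont_o2[where g=q, OF isCont_norm[OF continuous_ident]])
  qed
qed

lemma C2: "C2_on (ball 0 R) u"
  unfolding C2_on_def
proof (intro conjI ballI allI)
  show "u differentiable (at x)" if "x \<in> ball 0 R" for x
    using u_has_derivative[OF that] by (auto simp: differentiable_def)
  show "continuous_on (ball 0 R) (pd j u)" for j
    by (subst continuous_on_cong[OF refl pd_u], assumption) (intro continuous_intros q_norm_cont)
  show "pd j u differentiable (at x)" if x: "x \<in> ball 0 R" for j x
  proof (rule differentiable_transform_open[OF _ open_ball x pd_u[symmetric]])
    show "(\<lambda>x. q (norm x) * x $ j) differentiable (at x)"
      using radial_field_has_derivative[OF _ q_deriv] radial_field_has_derivative_0[OF q_cont_0] x
      by (cases "x = 0") (auto simp: differentiable_def)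
  qed
  have q1: "continuous_on (ball 0 R) (\<lambda>x::real^'n. q1 (norm x) / norm x * x $ i * x $ j)" for i j
  proof (rule continuous_at_imp_continuous_on, rule ballI)
    fix x :: "real^'n" assume x: "x \<in> ball 0 R"
    show "isCont (\<lambda>x. q1 (norm x) / norm x * x $ i * x $ j) x"
    proof (cases "x = 0")
      case True
      have lim: "((\<lambda>y::real^'n. norm (norm y * q1 (norm y))) \<longlongrightarrow> 0) (at 0)"
        using tendsto_norm_zero[OF filterlim_compose[OF q1_0 tendsto_norm_at_right[where 'a="real^'n"]]] .
      have "((\<lambda>y::real^'n. q1 (norm y) / norm y * y $ i * y $ j) \<longlongrightarrow> 0) (at 0)"
      proof (rule Lim_null_comparison[OF _ lim], rule eventuallyI)
        fix y :: "real^'n"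
        have "\<bar>y $ i\<bar> * \<bar>y $ j\<bar> \<le> norm y * norm y"
          by (intro mult_mono component_le_norm_cart) auto
        then have "\<bar>q1 (norm y)\<bar> / norm y * (\<bar>y $ i\<bar> * \<bar>y $ j\<bar>) \<le> \<bar>q1 (norm y)\<bar> / norm y * (norm y * norm y)"
          by (rule mult_left_mono) simp
        then show "norm (q1 (norm y) / norm y * y $ i * y $ j) \<le> norm (norm y * q1 (norm y))"
          by (cases "y = 0") (simp_all add: abs_mult mult_ac)
      qed
      then show ?thesis using True by (simp add: isCont_def)
    next
      case False
      have "isCont q1 (norm x)" using q1_cont False x
        by (intro continuous_on_interior[OF q1_cont]) auto
      then have "isCont (\<lambda>x. q1 (norm x)) x"
        by (intro isCont_o2[where g=q1, OF isCont_norm[OF continuous_ident]])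
      then show ?thesis using False by (intro continuous_intros) auto
    qed
  qed
  show "continuous_on (ball 0 R) (pd i (pd j u))" for i j
    by (subst continuous_on_cong[OF refl pd_pd_u], assumption)
      (intro continuous_on_add q1 continuous_on_mult q_norm_cont continuous_on_const)
qed simp

text \<open>By the Gauss lemma the density times the gradient is again a radial field, so
  \<open>LB\<close> is a Euclidean divergence divided by the density.\<close>

lemma LB_eq_pd:
  assumes "x \<in> ball 0 R" "\<And>r. 0 \<le> r \<Longrightarrow> r < R \<Longrightarrow> B r = sinc_r r ^ (CARD('n) - 1) * q r"
  shows "LB u x = (\<Sum>i\<in>UNIV. pd i (\<lambda>y::real^'n. B (norm y) * y $ i) x) / sqrtdetg x"
proof -
  have "pd i (\<lambda>y. sqrtdetg y * (\<Sum>j\<in>UNIV. ginv y i j * pd j u y)) x = pd i (\<lambda>y. B (norm y) * y $ i) x" for i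
  proof (rule pd_cong_open[of "ball 0 R"])
    fix y :: "real^'n" assume y: "y \<in> ball 0 R"
    have "(\<Sum>j\<in>UNIV. ginv y i j * pd j u y) = q (norm y) * (\<Sum>j\<in>UNIV. ginv y i j * y $ j)"
      by (simp add: pd_u[OF y] sum_distrib_left mult_ac)
    then show "sqrtdetg y * (\<Sum>j\<in>UNIV. ginv y i j * pd j u y) = B (norm y) * y $ i"
      using y by (simp add: sum_ginv_mult sqrtdetg_def assms(2))
  qed (use assms in auto)
  then show ?thesis by (simp add: LB_def)
qed

lemma LB_radial:
  assumes "x \<in> ball 0 R" "x \<noteq> 0" "\<And>r. 0 \<le> r \<Longrightarrow> r < R \<Longrightarrow> B r = sinc_r r ^ (CARD('n) - 1) * q r"
    and "(B has_real_derivative b) (at (norm x))"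
  shows "LB u x = (real CARD('n) * B (norm x) + norm x * b) / sqrtdetg x"
proof -
  have "(\<Sum>i\<in>UNIV. pd i (\<lambda>y::real^'n. B (norm y) * y $ i) x)
     = real CARD('n) * B (norm x) + b / norm x * (\<Sum>i\<in>UNIV. x $ i * x $ i)"
    by (simp add: pd_radial_field[OF assms(2,4)] sum.distrib sum_distrib_left mult_ac)
  also have "(\<Sum>i\<in>UNIV. x $ i * x $ i) = norm x * norm x"
    by (simp flip: dot_square_norm power2_eq_square) (simp add: inner_vec_def power2_eq_square)
  finally show ?thesis using assms(2) by (simp add: LB_eq_pd[OF assms(1,3)])
qed

text \<open>The divergence at 0 of a field \<open>B (norm y) * y\<close> with continuous
  \<open>B\<close> is n times \<open>B 0\<close>; the formula away from 0 would require a derivative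
  of \<open>B\<close>.\<close>

lemma LB_radial_0:
  "LB u (0::real^'n) = real CARD('n) * q 0"
proof -
  let ?B = "\<lambda>r. sinc_r r ^ (CARD('n) - 1) * q r"
  have "((\<lambda>r. sin r / r) \<longlongrightarrow> 1) (at_right (0::real))" by real_asymp
  then have "(sinc_r \<longlongrightarrow> 1) (at_right 0)"
    by (rule Lim_transform_eventually) (simp add: sinc_r_def eventually_at_filter)
  then have "(?B \<longlongrightarrow> 1 ^ (CARD('n) - 1) * q 0) (at_right 0)"
    by (intro tendsto_intros q_cont_0)
  then have "(?B \<longlongrightarrow> ?B 0) (at_right 0)" by (simp add: sinc_r_def)
  have "pd i (\<lambda>y::real^'n. ?B (norm y) * y $ i) 0 = q 0" for i
    by (subst pd_radial_field_0[OF \<open>(?B \<longlongrightarrow> ?B 0) (at_right 0)\<close>]) (simp add: sinc_r_def)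
  moreover have "LB u 0 = (\<Sum>i\<in>UNIV. pd i (\<lambda>y::real^'n. ?B (norm y) * y $ i) 0) / sqrtdetg (0::real^'n)"
    by (rule LB_eq_pd) (use R_pos in auto)
  ultimately show ?thesis by (simp add: sqrtdetg_def sinc_r_def)
qed

end

section \<open>The maximum principle\<close>

text \<open>An interior minimum may sit at the centre, so the coefficients of the operator have to
  be differentiable there too, although polar coordinates degenerate.\<close>

lemma sinc_r_differentiable_norm:
  fixes x :: "real^'n"
  shows "(\<lambda>y. sinc_r (norm y)) differentiable (at x)"
proof (cases "x = 0")
  case True
  have "((\<lambda>y. (sin y / y - 1) / y) \<longlongrightarrow> 0) (at_right (0::real))" by real_asymp
  then have "((\<lambda>y. (sinc_r y - sinc_r 0) / (y - 0)) \<longlongrightarrow> 0) (at_right 0)"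
    by (rule Lim_transform_eventually) (simp add: sinc_r_def eventually_at_filter)
  then show ?thesis using radial_has_derivative_0 True
    by (auto simp: has_field_derivative_iff differentiable_def)
next
  case False
  have "((\<lambda>r. sin r / r) has_real_derivative ((cos r * r - sin r) / (r * r))) (at r)" if "r \<noteq> 0" for r :: real
    using that by (auto intro!: derivative_eq_intros)
  then have "(sinc_r has_real_derivative ((cos r * r - sin r) / (r * r))) (at r)" if "r \<noteq> 0" for r :: real
    by (rule has_field_derivative_transform_within_open[where S="- {0}"])
      (use that in \<open>auto simp: sinc_r_def\<close>)
  from radial_has_derivative[OF False this[of "norm x"]] False show ?thesis
    by (auto simp: differentiable_def)
qed

lemma cg_field_differentiable:
  fixes x :: "real^'n"
  assumes "norm x < pi"
  shows "(\<lambda>y. cg (norm y) * y $ i) differentiable (at x)"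
proof (cases "x = 0")
  case True
  \<comment> \<open>The value 1/3 in \<open>cg\<close> is this limit, so \<open>cg\<close> is
    continuous at 0 and the rule for radial fields applies.\<close>
  have "((\<lambda>r. 1 / (sin r)\<^sup>2 - 1 / r\<^sup>2) \<longlongrightarrow> 1/3) (at_right (0::real))" by real_asymp
  then have "(cg \<longlongrightarrow> cg 0) (at_right 0)"
    by (rule Lim_transform_eventually[THEN tendsto_eq_rhs]) (simp_all add: cg_def eventually_at_filter)
  from radial_field_has_derivative_0[OF this] True show ?thesis by (auto simp: differentiable_def)
next
  case False
  let ?r = "norm x"
  have "sin ?r \<noteq> 0" using False assms sin_gt_zero[of ?r] by auto
  then have "((\<lambda>r. 1 / (sin r)\<^sup>2 - 1 / r\<^sup>2) has_real_derivative
      (- (2 * sin ?r * cos ?r) / (sin ?r)^4 + 2 * ?r / ?r ^ 4)) (at ?r)"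
    using False by (auto intro!: derivative_eq_intros simp: eval_nat_numeral)
  then have "(cg has_real_derivative (- (2 * sin ?r * cos ?r) / (sin ?r)^4 + 2 * ?r / ?r ^ 4)) (at ?r)"
    by (rule has_field_derivative_transform_within_open[where S="- {0}"])
      (use False in \<open>auto simp: cg_def\<close>)
  from radial_field_has_derivative[OF False this] show ?thesis by (auto simp: differentiable_def)
qed

lemma sqrtdetg_differentiable: "(sqrtdetg :: real^'n \<Rightarrow> real) differentiable (at x)"
  unfolding sqrtdetg_def by (intro differentiable_power sinc_r_differentiable_norm)

lemma vec_nth_differentiable: "(\<lambda>y::real^'n. y $ i) differentiable (at x)"
  using bounded_linear.has_derivative[OF bounded_linear_vec_nth has_derivative_ident]
  by (auto simp: differentiable_def)

lemma ginv_differentiable: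
  fixes x :: "real^'n"
  assumes "norm x < pi"
  shows "(\<lambda>y. ginv y i j) differentiable (at x)"
proof -
  \<comment> \<open>Expanding the squared norm attaches a coordinate to every \<open>cg\<close>;
    only the products \<open>cg (norm y) * y $ k\<close>, covered by the previous lemma,
    remain.\<close>
  have "ginv y i j = (if i = j then 1 else 0) + ((if i = j then 1 else 0) *
      (\<Sum>k\<in>UNIV. cg (norm y) * y $ k * y $ k) - cg (norm y) * y $ i * y $ j)" for y :: "real^'n"
  proof -
    have "(norm y)\<^sup>2 = (\<Sum>k\<in>UNIV. y $ k * y $ k)"
      by (simp add: power2_norm_eq_inner inner_vec_def)
    then show ?thesis by (simp add: ginv_def right_diff_distrib sum_distrib_left mult.assoc)
  qed
  then show ?thesis
    by (simp only:) (intro differentiable_add differentiable_diff differentiable_mult differentiable_sum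
        differentiable_const vec_nth_differentiable cg_field_differentiable[OF assms] ballI finite)
qed

lemma flux_differentiable:
  fixes x :: "real^'n"
  assumes "C2_on S u" "x \<in> S" "norm x < pi"
  shows "(\<lambda>y. sqrtdetg y * (\<Sum>j\<in>UNIV. ginv y i j * pd j u y)) differentiable (at x)"
  using assms
  by (intro differentiable_mult differentiable_sum sqrtdetg_differentiable ginv_differentiable ballI finite)
     (auto simp: C2_on_def)

lemma LB_diff:
  fixes x :: "real^'n"
  assumes "C2_on S u" "C2_on S v" "x \<in> S" "norm x < pi"
  shows "LB (\<lambda>y. u y - v y) x = LB u x - LB v x"
proof -
  have op: "open S" using assms by (simp add: C2_on_def)
  let ?F = "\<lambda>u i y. sqrtdetg y * (\<Sum>j\<in>UNIV. ginv y i j * pd j u y)"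
  have "pd i (?F (\<lambda>y. u y - v y) i) x = pd i (?F u i) x - pd i (?F v i) x" for i
  proof -
    have "pd i (?F (\<lambda>y. u y - v y) i) x = pd i (\<lambda>y. ?F u i y - ?F v i y) x"
    proof (rule pd_cong_open[OF op assms(3)])
      fix y assume "y \<in> S"
      then have "pd j (\<lambda>y. u y - v y) y = pd j u y - pd j v y" for j
        using assms by (intro pd_diff) (auto simp: C2_on_def)
      then show "?F (\<lambda>y. u y - v y) i y = ?F u i y - ?F v i y"
        by (simp add: right_diff_distrib sum_subtractf)
    qed
    then show ?thesis by (simp add: pd_diff flux_differentiable[OF assms(1,3,4)] flux_differentiable[OF assms(2,3,4)])
  qed
  then show ?thesis by (simp add: LB_def sum_subtractf diff_divide_distrib)
qed

text \<open>If D < 0, then \<open>g'\<close> is negative just to the right of 0, and the mean value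
  theorem puts \<open>g\<close> below its minimum.\<close>

lemma second_deriv_at_min_nonneg:
  fixes g :: "real \<Rightarrow> real"
  assumes "0 < d" and der: "\<And>t. \<bar>t\<bar> < d \<Longrightarrow> (g has_real_derivative g' t) (at t)"
    and "(g' has_real_derivative D) (at 0)" and "g' 0 = 0"
    and min: "\<And>t. \<bar>t\<bar> < d \<Longrightarrow> g 0 \<le> g t"
  shows "0 \<le> D"
proof (rule ccontr)
  assume "\<not> 0 \<le> D"
  with DERIV_neg_dec_right[OF assms(3)] obtain e
    where e: "e > 0" "\<And>h. 0 < h \<Longrightarrow> h < e \<Longrightarrow> g' h < 0" by (auto simp: assms(4))
  define t where "t = min d e / 2"
  have t: "0 < t" "t < d" "t < e" using \<open>0 < d\<close> e(1) by (auto simp: t_def)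
  obtain z where z: "0 < z" "z < t" "g t - g 0 = (t - 0) * g' z"
    using MVT2[of 0 t g g'] der t by auto
  moreover have "g' z < 0" using e(2)[of z] z t by simp
  ultimately have "g t < g 0" using mult_pos_neg[of t "g' z"] t by simp
  with min[of t] t show False by auto
qed

text \<open>The quadratic form is the second derivative of \<open>z\<close> along the line through
  \<open>x\<close> with direction \<open>v\<close>.\<close>

lemma hessian_at_min_nonneg:
  fixes z :: "real^'n \<Rightarrow> real"
  assumes C2: "C2_on S z" and x: "x \<in> S" and min: "\<And>y. y \<in> S \<Longrightarrow> z x \<le> z y"
  shows "pd j z x = 0" and "0 \<le> (\<Sum>i\<in>UNIV. \<Sum>j\<in>UNIV. v $ i * v $ j * pd i (pd j z) x)"
proof -
  have op: "open S" using C2 by (simp add: C2_on_def)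
  have dz: "(z has_derivative (\<lambda>h. \<Sum>j\<in>UNIV. h $ j * pd j z y)) (at y)" if "y \<in> S" for y
    using C2 that by (intro has_derivative_pd) (auto simp: C2_on_def)
  have grad: "pd j z x = 0" for j
  proof -
    have "(\<lambda>h. \<Sum>j\<in>UNIV. h $ j * pd j z x) = (\<lambda>h. 0)"
      using min by (intro differential_zero_maxmin[OF x op dz[OF x]]) auto
    then have "(\<Sum>k\<in>UNIV. axis j 1 $ k * pd k z x) = 0" by meson
    then show ?thesis by (simp add: axis_def if_distrib[of "\<lambda>a. a * _"] cong: if_cong)
  qed
  then show "pd j z x = 0" .
  have line: "((\<lambda>t. x + t *\<^sub>R v) has_derivative (\<lambda>t. t *\<^sub>R v)) (at t)" for t :: real
    by (auto intro!: derivative_eq_intros)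
  have chain: "((\<lambda>t. w (x + t *\<^sub>R v)) has_real_derivative (\<Sum>j\<in>UNIV. v $ j * pd j w (x + t *\<^sub>R v))) (at t)"
    if "w differentiable (at (x + t *\<^sub>R v))" for w t
    unfolding has_field_derivative_def
    using diff_chain_at[OF line has_derivative_pd[OF that]]
    unfolding o_def
    by (rule has_derivative_eq_rhs) (simp add: fun_eq_iff sum_distrib_left sum_distrib_right mult_ac)
  have "((\<lambda>t::real. x + t *\<^sub>R v) \<longlongrightarrow> x + 0 *\<^sub>R v) (nhds 0)"
    by (intro tendsto_intros) (simp add: filterlim_ident)
  then have "\<forall>\<^sub>F t in nhds (0::real). x + t *\<^sub>R v \<in> S"
    using op x by (auto simp: tendsto_def)
  then obtain d where d: "d > 0" "\<And>t::real. \<bar>t\<bar> < d \<Longrightarrow> x + t *\<^sub>R v \<in> S"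
    by (auto simp: eventually_nhds_metric dist_real_def)
  have "((\<lambda>t. \<Sum>j\<in>UNIV. v $ j * pd j z (x + t *\<^sub>R v)) has_real_derivative
      (\<Sum>j\<in>UNIV. v $ j * (\<Sum>i\<in>UNIV. v $ i * pd i (pd j z) (x + 0 *\<^sub>R v)))) (at 0)"
    by (intro DERIV_sum DERIV_cmult chain) (use C2 x in \<open>auto simp: C2_on_def\<close>)
  then have "0 \<le> (\<Sum>j\<in>UNIV. v $ j * (\<Sum>i\<in>UNIV. v $ i * pd i (pd j z) (x + 0 *\<^sub>R v)))"
  proof (rule second_deriv_at_min_nonneg[OF d(1), rotated])
    fix t :: real assume "\<bar>t\<bar> < d"
    then show "((\<lambda>t. z (x + t *\<^sub>R v)) has_real_derivative (\<Sum>j\<in>UNIV. v $ j * pd j z (x + t *\<^sub>R v))) (at t)"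
      using C2 d(2) by (intro chain) (auto simp: C2_on_def)
    show "z (x + 0 *\<^sub>R v) \<le> z (x + t *\<^sub>R v)" using min d(2) \<open>\<bar>t\<bar> < d\<close> by simp
  qed (simp add: grad)
  also have "\<dots> = (\<Sum>i\<in>UNIV. \<Sum>j\<in>UNIV. v $ i * v $ j * pd i (pd j z) x)"
    by (subst sum.swap) (simp add: sum_distrib_left mult_ac)
  finally show "0 \<le> (\<Sum>i\<in>UNIV. \<Sum>j\<in>UNIV. v $ i * v $ j * pd i (pd j z) x)" .
qed

text \<open>The inverse metric is written as a sum of squares: with P the orthogonal projection onto the
  line through x, it is P + (r / sin r)^2 (1 - P) and 1 - P = (1 - P) (1 - P)^T.\<close>

lemma ginv_contract_nonneg:
  fixes x :: "real^'n" and H :: "'n \<Rightarrow> 'n \<Rightarrow> real"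
  assumes H: "\<And>v::real^'n. 0 \<le> (\<Sum>i\<in>UNIV. \<Sum>j\<in>UNIV. v $ i * v $ j * H i j)"
    and x: "norm x < pi"
  shows "0 \<le> (\<Sum>i\<in>UNIV. \<Sum>j\<in>UNIV. ginv x i j * H i j)"
proof -
  define r where "r = norm x"
  have nx: "(\<Sum>k\<in>UNIV. x $ k * x $ k) = r\<^sup>2"
    by (simp add: r_def power2_norm_eq_inner inner_vec_def)
  \<comment> \<open>There is no radial direction at the centre: there \<open>p = 0\<close> makes the
    projection vanish and \<open>t = 1\<close> leaves the identity matrix.\<close>
  define p where "p = (if r = 0 then 0 else 1 / r\<^sup>2)"
  define t where "t = 1 + cg r * r\<^sup>2"
  have p: "p * r\<^sup>2 * p = p" "p \<ge> 0" by (auto simp: p_def)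
  have t0: "t \<ge> 0"
  proof (cases "r = 0")
    case False
    then have "t = (r / sin r)\<^sup>2" 
      by (simp add: t_def cg_def power_divide left_diff_distrib)
    then show ?thesis by simp
  qed (simp add: t_def)
  \<comment> \<open>These are the columns of 1 - P.\<close>
  define e where "e k = (\<chi> i. (if i = k then 1 else 0) - p * x $ k * x $ i)" for k
  have ee: "(\<Sum>k\<in>UNIV. e k $ i * e k $ j) = (if i = j then 1 else 0) - p * x $ i * x $ j" for i j
  proof -
    have "(\<Sum>k\<in>UNIV. e k $ i * e k $ j) =
      (\<Sum>k\<in>UNIV. (if i = k then (if i = j then 1 else 0) else 0) - (if i = k then p * x $ i * x $ j else 0)
       - (if j = k then p * x $ i * x $ j else 0) + (p * p * x $ i * x $ j) * (x $ k * x $ k))"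
      by (intro sum.cong) (auto simp: e_def algebra_simps)
    also have "\<dots> = (if i = j then 1 else 0) - p * x $ i * x $ j - p * x $ i * x $ j + p * p * x $ i * x $ j * r\<^sup>2"
      by (simp only: sum.distrib sum_subtractf sum.delta' nx flip: sum_distrib_left) simp
    also have "\<dots> = (if i = j then 1 else 0) - p * x $ i * x $ j - p * x $ i * x $ j + (p * r\<^sup>2 * p) * x $ i * x $ j"
      by algebra
    also have "\<dots> = (if i = j then 1 else 0) - p * x $ i * x $ j" by (simp add: p(1))
    finally show ?thesis .
  qed
  have g: "ginv x i j = p * (x $ i * x $ j) + t * (\<Sum>k\<in>UNIV. e k $ i * e k $ j)" for i j
  proof (cases "r = 0")
    case True
    then show ?thesis unfolding ee by (simp add: ginv_def t_def r_def p_def)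
  next
    case False
    then have "p * (x $ i * x $ j) * (1 - t) = - cg r * x $ i * x $ j"
      by (simp add: p_def t_def field_simps)
    then show ?thesis unfolding ee ginv_def r_def[symmetric] t_def by (simp add: algebra_simps)
  qed
  have "(\<Sum>i\<in>UNIV. \<Sum>j\<in>UNIV. ginv x i j * H i j) =
     p * (\<Sum>i\<in>UNIV. \<Sum>j\<in>UNIV. x $ i * x $ j * H i j)
     + t * (\<Sum>i\<in>UNIV. \<Sum>j\<in>UNIV. \<Sum>k\<in>UNIV. e k $ i * e k $ j * H i j)"
    by (simp only: g distrib_right sum.distrib sum_distrib_left sum_distrib_right mult.assoc)
  also have "(\<Sum>i\<in>UNIV. \<Sum>j\<in>UNIV. \<Sum>k\<in>UNIV. e k $ i * e k $ j * H i j)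
      = (\<Sum>k\<in>UNIV. \<Sum>i\<in>UNIV. \<Sum>j\<in>UNIV. e k $ i * e k $ j * H i j)"
    unfolding sum.swap[of "\<lambda>j k. e k $ i * e k $ j * H i j" UNIV UNIV for i] by (rule sum.swap)
  finally show ?thesis using H p(2) t0 by (simp add: sum_nonneg)
qed

text \<open>At a critical point every term containing a derivative of the coefficients carries a
  factor \<open>pd j z x = 0\<close>, so only the contraction of the inverse metric with the Hessian
  survives.\<close>

lemma LB_at_min_nonneg:
  fixes z :: "real^'n \<Rightarrow> real"
  assumes C2: "C2_on S z" and x: "x \<in> S" "norm x < pi" and min: "\<And>y. y \<in> S \<Longrightarrow> z x \<le> z y"
  shows "0 \<le> LB z x"
proof -
  note h = hessian_at_min_nonneg[OF C2 x(1) min]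
  have "pd i (\<lambda>y. sqrtdetg y * (\<Sum>j\<in>UNIV. ginv y i j * pd j z y)) x
    = sqrtdetg x * (\<Sum>j\<in>UNIV. ginv x i j * pd i (pd j z) x)" for i
  proof -
    have 1: "((\<lambda>y. ginv y i j * pd j z y) has_derivative
        (\<lambda>h. ginv x i j * (\<Sum>k\<in>UNIV. h $ k * pd k (pd j z) x))) (at x)" for j
      by (rule has_derivative_mult[OF has_derivative_pd[OF ginv_differentiable[OF x(2)]]
          has_derivative_pd, THEN has_derivative_eq_rhs]) (use C2 x h(1) in \<open>auto simp: C2_on_def\<close>)
    have "((\<lambda>y. sqrtdetg y * (\<Sum>j\<in>UNIV. ginv y i j * pd j z y)) has_derivative
        (\<lambda>h. sqrtdetg x * (\<Sum>j\<in>UNIV. ginv x i j * (\<Sum>k\<in>UNIV. h $ k * pd k (pd j z) x)))) (at x)"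
      by (rule has_derivative_mult[OF has_derivative_pd[OF sqrtdetg_differentiable]
          has_derivative_sum[OF 1], THEN has_derivative_eq_rhs]) (simp add: h(1))
    from pd_eq[OF this, of i] show ?thesis
      by (simp add: axis_def if_distrib[of "\<lambda>a. a * _"] cong: if_cong)
  qed
  then have "LB z x = sqrtdetg x * (\<Sum>i\<in>UNIV. \<Sum>j\<in>UNIV. ginv x i j * pd i (pd j z) x) / sqrtdetg x"
    by (simp add: LB_def sum_distrib_left)
  moreover have "0 \<le> (\<Sum>i\<in>UNIV. \<Sum>j\<in>UNIV. ginv x i j * pd i (pd j z) x)"
    by (rule ginv_contract_nonneg[OF h(2) x(2)])
  ultimately show ?thesis by simp
qed

text \<open>The strict inequality excludes an interior minimum of \<open>w - p\<close> at once,
  without a barrier function. The non-strict case is recovered later by lowering the source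
  slightly.\<close>

lemma strict_comparison:
  fixes w p :: "real^'n \<Rightarrow> real"
  assumes "0 < R" "R < pi"
    and w: "C2_on (ball 0 R) w" "continuous_on (cball 0 R) w"
    and p: "C2_on (ball 0 R) p" "continuous_on (cball 0 R) p"
    and LB: "\<And>x. x \<in> ball 0 R \<Longrightarrow> LB w x < LB p x"
    and bd: "\<And>x. x \<in> sphere 0 R \<Longrightarrow> p x \<le> w x"
    and x: "x \<in> cball 0 R"
  shows "p x \<le> w x"
proof (rule ccontr)
  assume neg: "\<not> p x \<le> w x"
  obtain y where y: "y \<in> cball 0 R" "\<And>y'. y' \<in> cball 0 R \<Longrightarrow> w y - p y \<le> w y' - p y'"
    using continuous_attains_inf[OF compact_cball _ continuous_on_diff[OF w(2) p(2)]] assms(1)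
    by fastforce
  have "y \<notin> sphere 0 R" using bd[of y] y(2)[OF x] neg by auto
  then have yb: "y \<in> ball 0 R" using y(1) by auto
  have "0 \<le> LB (\<lambda>x. w x - p x) y"
    using yb assms(2) y(2) by (intro LB_at_min_nonneg[OF C2_on_diff[OF w(1) p(1)]]) auto
  also have "\<dots> = LB w y - LB p y"
    using yb assms(2) by (intro LB_diff[OF w(1) p(1)]) auto
  finally show False using LB[OF yb] by simp
qed

section \<open>The radial Poisson problem\<close>

text \<open>Fluxes and Wronskians are controlled only for r > 0; their limit at 0 serves as the
  initial value.\<close>

lemma nonpos_of_nonincreasing_from_0:
  fixes F :: "real \<Rightarrow> real"
  assumes der: "\<And>r. 0 < r \<Longrightarrow> r < R \<Longrightarrow> (F has_real_derivative D r) (at r)"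
    and neg: "\<And>r. 0 < r \<Longrightarrow> r < R \<Longrightarrow> D r \<le> 0"
    and lim: "(F \<longlongrightarrow> 0) (at_right 0)"
    and r: "0 < r" "r < R"
  shows "F r \<le> 0"
proof (rule tendsto_lowerbound[OF lim])
  have "F r \<le> F e" if "0 < e" "e < r" for e
    by (rule DERIV_nonpos_imp_nonincreasing) (use that der neg r in force)+
  then show "\<forall>\<^sub>F e in at_right 0. F r \<le> F e"
    using r by (auto intro!: eventually_at_rightI[of 0 r])
qed simp

section \<open>Radial potentials on a cap: weight, mass and flux\<close>

locale sphere_cap =
  fixes n :: nat and R :: real
  assumes n2: "2 \<le> n" and R0: "0 < R" and Rpi: "R < pi / 2"
begin

text \<open>\<open>pot g\<close> is the radial solution of \<open>-\<Delta>u = g\<close> in the ball that vanishes at \<open>R\<close>.  Since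
  \<open>wt 0 = 0\<close> and \<open>x / 0 = 0\<close>, the flux has the correct value 0 at the centre.\<close>

definition wt :: "real \<Rightarrow> real" where "wt r = sin r ^ (n - 1)"
definition mass :: "(real \<Rightarrow> real) \<Rightarrow> real \<Rightarrow> real" where
  "mass g r = integral {0..r} (\<lambda>t. wt t * g t)"
definition flux :: "(real \<Rightarrow> real) \<Rightarrow> real \<Rightarrow> real" where "flux g r = mass g r / wt r"
definition pot :: "(real \<Rightarrow> real) \<Rightarrow> real \<Rightarrow> real" where "pot g r = integral {r..R} (flux g)"

lemma sin_pos: "0 < r \<Longrightarrow> r \<le> R \<Longrightarrow> 0 < sin r"
  using Rpi by (intro sin_gt_zero) auto

lemma wt_0: "wt 0 = 0" using n2 by (simp add: wt_def)

lemma wt_pos: "0 < r \<Longrightarrow> r \<le> R \<Longrightarrow> 0 < wt r"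
  by (simp add: wt_def sin_pos)

lemma wt_mono: "0 \<le> t \<Longrightarrow> t \<le> r \<Longrightarrow> r \<le> R \<Longrightarrow> wt t \<le> wt r"
  unfolding wt_def using Rpi R0
  by (intro power_mono sin_monotone_2pi_le sin_ge_zero) auto

lemma wt_nonneg: "0 \<le> r \<Longrightarrow> r \<le> R \<Longrightarrow> 0 \<le> wt r"
  using wt_mono[of 0 r] wt_0 by simp

lemma wt_cont: "continuous_on S wt"
  unfolding wt_def by (intro continuous_intros)

lemma wt_deriv:
  assumes "0 < r" "r \<le> R"
  shows "(wt has_real_derivative wt r * ((real n - 1) * (cos r / sin r))) (at r)"
proof -
  have "wt r = sin r * sin r ^ (n - 2)"
    using n2 by (simp add: wt_def flip: power_Suc) (simp add: Suc_diff_Suc numeral_2_eq_2)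
  then have "real (n - 1) * sin r ^ (n - 2) * cos r = wt r * ((real n - 1) * (cos r / sin r))"
    using sin_pos[OF assms] n2 by (simp add: of_nat_diff)
  moreover have "(wt has_real_derivative real (n - 1) * sin r ^ (n - 2) * cos r) (at r)"
    unfolding wt_def[abs_def] by (auto intro!: derivative_eq_intros simp: numeral_2_eq_2)
  ultimately show ?thesis by simp
qed

text \<open>Weighted integrability rather than continuity, in order to include sources such as
  \<open>f (U r)\<close> that blow up at the centre.\<close>

abbreviation admissible :: "(real \<Rightarrow> real) \<Rightarrow> bool" where
  "admissible g \<equiv> (\<lambda>t. wt t * g t) integrable_on {0..R}"

lemma admissible_cont: "continuous_on {0..R} g \<Longrightarrow> admissible g"
  by (intro integrable_continuous_real continuous_intros wt_cont)

lemma admissible_sub: "admissible g \<Longrightarrow> 0 \<le> r \<Longrightarrow> r \<le> R \<Longrightarrow> (\<lambda>t. wt t * g t) integrable_on {0..r}"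
  by (erule integrable_on_subinterval) auto

lemma mass_0: "mass g 0 = 0" by (simp add: mass_def)

lemma mass_cont: "admissible g \<Longrightarrow> continuous_on {0..R} (mass g)"
  unfolding mass_def[abs_def] by (rule indefinite_integral_continuous_1)

lemma mass_tendsto_0: "admissible g \<Longrightarrow> (mass g \<longlongrightarrow> 0) (at_right 0)"
  using mass_cont[of g] R0 mass_0[of g]
  by (auto simp: continuous_on_def at_within_Icc_at_right dest: bspec[of _ _ 0])

lemma mass_deriv:
  assumes g: "admissible g" "continuous_on {0<..R} g" and r: "0 < r" "r < R"
  shows "(mass g has_real_derivative wt r * g r) (at r)"
proof -
  \<comment> \<open>The source may be singular at 0, so the fundamental theorem is applied on an
    interval that starts at a > 0.\<close>
  define a where "a = r / 2"
  have a: "0 < a" "a < r" using r by (auto simp: a_def)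
  have "continuous_on {a..R} (\<lambda>t. wt t * g t)"
    by (intro continuous_intros wt_cont continuous_on_subset[OF g(2)]) (use a in auto)
  then have "((\<lambda>x. integral {a..x} (\<lambda>t. wt t * g t)) has_real_derivative wt r * g r) (at r within {a..R})"
    by (rule integral_has_real_derivative) (use a r in auto)
  then have "((\<lambda>x. mass g a + integral {a..x} (\<lambda>t. wt t * g t)) has_real_derivative 0 + wt r * g r) (at r)"
    using a r by (intro DERIV_add DERIV_const) (simp add: at_within_Icc_at)
  then have "((\<lambda>x. mass g a + integral {a..x} (\<lambda>t. wt t * g t)) has_real_derivative wt r * g r) (at r)"
    by simp
  then show ?thesis
  proof (rule has_field_derivative_transform_within_open[where S="{a<..<R}"])
    fix x assume "x \<in> {a<..<R}"
    then show "mass g a + integral {a..x} (\<lambda>t. wt t * g t) = mass g x"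
      unfolding mass_def using a
      by (intro Henstock_Kurzweil_Integration.integral_combine admissible_sub[OF g(1)]) auto
  qed (use a r in auto)
qed

lemma mass_mono:
  assumes "admissible g" "admissible h" "\<And>t. 0 < t \<Longrightarrow> t \<le> R \<Longrightarrow> g t \<le> h t" "0 \<le> r" "r \<le> R"
  shows "mass g r \<le> mass h r"
  unfolding mass_def
proof (rule integral_le)
  fix t assume "t \<in> {0..r}"
  then show "wt t * g t \<le> wt t * h t"
    using assms(3)[of t] wt_nonneg[of t] assms(5) by (cases "t = 0") (auto simp: wt_0 mult_left_mono)
qed (use admissible_sub assms in auto)

lemma mass_nonneg:
  assumes "admissible g" "\<And>t. 0 < t \<Longrightarrow> t \<le> R \<Longrightarrow> 0 \<le> g t" "0 \<le> r" "r \<le> R"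
  shows "0 \<le> mass g r"
  using mass_mono[of "\<lambda>t. 0" g r] assms by (simp add: mass_def integrable_0)

text \<open>As \<open>wt\<close> is increasing, \<open>wt t\<close> may be replaced by
  \<open>wt r\<close> under the integral; this factor then cancels in the flux and leaves the bound
  \<open>C * r\<close>.\<close>

lemma mass_bound:
  assumes g: "admissible g" "\<And>t. 0 \<le> t \<Longrightarrow> t \<le> R \<Longrightarrow> \<bar>g t\<bar> \<le> C" and r: "0 \<le> r" "r \<le> R"
  shows "\<bar>mass g r\<bar> \<le> C * r * wt r"
proof -
  have C: "0 \<le> C" using g(2)[of 0] R0 by auto
  have "norm (integral {0..r} (\<lambda>t. wt t * g t)) \<le> integral {0..r} (\<lambda>t. wt r * C)"
  proof (rule Henstock_Kurzweil_Integration.integral_norm_bound_integral)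
    fix t assume t: "t \<in> {0..r}"
    have "wt t * \<bar>g t\<bar> \<le> wt r * C"
      by (intro mult_mono wt_mono g(2) wt_nonneg) (use t r in auto)
    then show "norm (wt t * g t) \<le> wt r * C"
      using wt_nonneg[of t] t r by (simp add: abs_mult)
  qed (use admissible_sub[OF g(1)] r in auto)
  then show ?thesis using r by (simp add: mass_def mult_ac)
qed

lemma flux_bound:
  assumes "admissible g" "\<And>t. 0 \<le> t \<Longrightarrow> t \<le> R \<Longrightarrow> \<bar>g t\<bar> \<le> C" "0 \<le> r" "r \<le> R"
  shows "\<bar>flux g r\<bar> \<le> C * r"
proof (cases "r = 0")
  case False
  then show ?thesis using mass_bound[OF assms] wt_pos[of r] assms
    by (simp add: flux_def pos_divide_le_eq)
qed (simp add: flux_def mass_0)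

lemma flux_cont_pos:
  assumes "admissible g" "0 < a"
  shows "continuous_on {a..R} (flux g)"
proof -
  have "wt r \<noteq> 0" if "r \<in> {a..R}" for r using wt_pos[of r] that assms(2) by simp
  then show ?thesis unfolding flux_def[abs_def]
    by (intro continuous_intros wt_cont continuous_on_subset[OF mass_cont[OF assms(1)]])
      (use assms(2) in auto)
qed

lemma flux_cont:
  assumes "admissible g" "\<And>t. 0 \<le> t \<Longrightarrow> t \<le> R \<Longrightarrow> \<bar>g t\<bar> \<le> C"
  shows "continuous_on {0..R} (flux g)"
  unfolding continuous_on_eq_continuous_within
proof
  fix r assume r: "r \<in> {0..R}"
  show "continuous (at r within {0..R}) (flux g)"
  proof (cases "r = 0")
    case True
    have "((\<lambda>r. C * r) \<longlongrightarrow> C * 0) (at_right 0)" by (intro tendsto_intros)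
    then have "((\<lambda>r. C * r) \<longlongrightarrow> 0) (at_right 0)" by simp
    then have "(flux g \<longlongrightarrow> 0) (at_right 0)"
    proof (rule Lim_null_comparison[rotated])
      show "\<forall>\<^sub>F r in at_right 0. norm (flux g r) \<le> C * r"
        using flux_bound[OF assms] R0 by (auto intro!: eventually_at_rightI[of 0 R])
    qed
    then show ?thesis using True R0
      by (simp add: continuous_within at_within_Icc_at_right flux_def mass_0)
  next
    case False
    then have "continuous (at r within {r/2..R}) (flux g)"
      using flux_cont_pos[OF assms(1), of "r/2"] r by (auto simp: continuous_on_eq_continuous_within)
    moreover have "at r within {r/2..R} = at r within {0..R}"
      by (rule at_within_nhd[of _ "{r/2<..}"]) (use False r in auto)
    ultimately show ?thesis by (simp add: continuous_within)
  qed
qed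

lemma pot_R: "pot g R = 0" by (simp add: pot_def)

lemma pot_deriv:
  assumes "admissible g" "0 < r" "r < R"
  shows "(pot g has_real_derivative - flux g r) (at r)"
  using integral_has_real_derivative'[OF flux_cont_pos[OF assms(1), of "r/2"], of r] assms
  by (simp add: at_within_Icc_at pot_def[abs_def])

lemma pot_cont_pos:
  assumes "admissible g" "0 < a"
  shows "continuous_on {a..R} (pot g)"
  unfolding pot_def[abs_def]
  by (intro indefinite_integral_continuous_1' integrable_continuous_real flux_cont_pos assms)

lemma pot_cont:
  assumes "admissible g" "\<And>t. 0 \<le> t \<Longrightarrow> t \<le> R \<Longrightarrow> \<bar>g t\<bar> \<le> C"
  shows "continuous_on {0..R} (pot g)"
  unfolding pot_def[abs_def]
  by (rule indefinite_integral_continuous_1'[OF integrable_continuous_real[OF flux_cont[OF assms]]])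

lemma pot_deriv_0:
  assumes "admissible g" "\<And>t. 0 \<le> t \<Longrightarrow> t \<le> R \<Longrightarrow> \<bar>g t\<bar> \<le> C"
  shows "(pot g has_real_derivative 0) (at_right 0)"
  using integral_has_real_derivative'[OF flux_cont[OF assms], of 0] R0
  by (simp add: at_within_Icc_at_right pot_def[abs_def] flux_def mass_0)

lemma pot_mono:
  assumes "admissible g" "admissible h" "\<And>t. 0 < t \<Longrightarrow> t \<le> R \<Longrightarrow> g t \<le> h t" "0 \<le> r" "r \<le> R"
    "flux g integrable_on {r..R}" "flux h integrable_on {r..R}"
  shows "pot g r \<le> pot h r"
  unfolding pot_def
proof (rule integral_le[OF assms(6,7)])
  fix t assume "t \<in> {r..R}"
  then show "flux g t \<le> flux h t"
    using mass_mono[OF assms(1-3), of t] wt_nonneg[of t] assms(4)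
    by (auto simp: flux_def divide_right_mono)
qed

lemma bounded_of_cont:
  assumes "continuous_on {0..R} g"
  obtains C :: real where "\<And>t. 0 \<le> t \<Longrightarrow> t \<le> R \<Longrightarrow> \<bar>g t\<bar> \<le> C"
proof -
  have "bounded (g ` {0..R})" by (intro compact_imp_bounded compact_continuous_image assms compact_Icc)
  then show ?thesis using that by (force simp: bounded_iff)
qed

text \<open>Taking a = 0 needs a bounded majorant, taking a > 0 allows a majorant that is singular at 0.\<close>

lemma pot_tendsto:
  fixes g :: "nat \<Rightarrow> real \<Rightarrow> real"
  assumes a: "0 \<le> a" "a \<le> R"
    and G: "admissible G" "flux G integrable_on {a..R}"
    and g: "\<And>k. admissible (g k)" "\<And>k. flux (g k) integrable_on {a..R}"
    and dom: "\<And>k t. 0 < t \<Longrightarrow> t \<le> R \<Longrightarrow> \<bar>g k t\<bar> \<le> G t"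
    and lim: "\<And>t. 0 < t \<Longrightarrow> t \<le> R \<Longrightarrow> (\<lambda>k. g k t) \<longlonglongrightarrow> h t"
  shows "admissible h" and "(\<lambda>k. pot (g k) a) \<longlonglongrightarrow> pot h a"
proof -
  have dom': "norm (wt t * g k t) \<le> wt t * G t" if "t \<in> {0..R}" for k t
    using dom[of t k] wt_nonneg[of t] that by (cases "t = 0") (auto simp: wt_0 abs_mult mult_left_mono)
  have lim': "(\<lambda>k. wt t * g k t) \<longlonglongrightarrow> wt t * h t" if "t \<in> {0..R}" for t
    using lim[of t] that by (cases "t = 0") (auto simp: wt_0 intro!: tendsto_intros)
  show "admissible h"
    by (rule dominated_convergence(1)[OF g(1) G(1) dom' lim'])
  have m: "(\<lambda>k. mass (g k) r) \<longlonglongrightarrow> mass h r" if "0 \<le> r" "r \<le> R" for r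
    unfolding mass_def
    by (rule dominated_convergence(2)[OF admissible_sub[OF g(1)] admissible_sub[OF G(1)]])
      (use that dom' lim' in auto)
  have mb: "\<bar>mass (g k) r\<bar> \<le> mass G r" if "0 \<le> r" "r \<le> R" for r k
    unfolding mass_def real_norm_def[symmetric]
    by (rule Henstock_Kurzweil_Integration.integral_norm_bound_integral
        [OF admissible_sub[OF g(1)] admissible_sub[OF G(1)]]) (use that dom' in auto)
  show "(\<lambda>k. pot (g k) a) \<longlonglongrightarrow> pot h a"
    unfolding pot_def
  proof (rule dominated_convergence(2)[OF g(2) G(2)])
    fix k t assume "t \<in> {a..R}"
    then show "norm (flux (g k) t) \<le> flux G t"
      using mb[of t k] wt_nonneg[of t] a by (simp add: flux_def abs_divide divide_right_mono)
  next
    fix t assume t: "t \<in> {a..R}"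
    show "(\<lambda>k. flux (g k) t) \<longlonglongrightarrow> flux h t"
    proof (cases "t = 0")
      case False
      then show ?thesis unfolding flux_def using m[of t] wt_pos[of t] t a by (intro tendsto_intros) auto
    qed (simp add: flux_def mass_0)
  qed
qed

text \<open>Supersolutions of \<open>-\<Delta>V = G\<close> that may be unbounded at the centre. The
  flux tending to 0 excludes a point mass there, so that comparison remains valid.\<close>

definition radial_super :: "(real \<Rightarrow> real) \<Rightarrow> (real \<Rightarrow> real) \<Rightarrow> bool" where
  "radial_super G V \<longleftrightarrow> (\<exists>V' D. (\<forall>r. 0 < r \<and> r < R \<longrightarrow>
      (V has_real_derivative V' r) (at r) \<and>
      ((\<lambda>r. wt r * V' r) has_real_derivative D r) (at r) \<and> D r \<le> - (wt r * G r)) \<and>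
    continuous_on {0<..R} V \<and> 0 \<le> V R \<and> ((\<lambda>r. wt r * V' r) \<longlongrightarrow> 0) (at_right 0))"

text \<open>The flux of \<open>V - pot g\<close> is nonincreasing and starts from 0, so
  \<open>V - pot g\<close> is itself nonincreasing, and its value at \<open>R\<close> is
  nonnegative.\<close>

lemma pot_le_radial_super:
  assumes V: "radial_super G V"
    and g: "admissible g" "continuous_on {0<..R} g" "\<And>r. 0 < r \<Longrightarrow> r < R \<Longrightarrow> g r \<le> G r"
    and r: "0 < r" "r \<le> R"
  shows "pot g r \<le> V r"
proof -
  obtain V' D where
    V': "\<And>r. 0 < r \<Longrightarrow> r < R \<Longrightarrow> (V has_real_derivative V' r) (at r)"
    and D: "\<And>r. 0 < r \<Longrightarrow> r < R \<Longrightarrow> ((\<lambda>r. wt r * V' r) has_real_derivative D r) (at r)"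
    and DG: "\<And>r. 0 < r \<Longrightarrow> r < R \<Longrightarrow> D r \<le> - (wt r * G r)"
    and c: "continuous_on {0<..R} V" and VR: "0 \<le> V R" and lim: "((\<lambda>r. wt r * V' r) \<longlongrightarrow> 0) (at_right 0)"
    using V unfolding radial_super_def by blast
  have neg: "wt t * V' t + mass g t \<le> 0" if t: "0 < t" "t < R" for t
  proof (rule nonpos_of_nonincreasing_from_0[where R=R and D="\<lambda>r. D r + wt r * g r" and F="\<lambda>t. wt t * V' t + mass g t"])
    show "((\<lambda>t. wt t * V' t + mass g t) \<longlongrightarrow> 0) (at_right 0)"
      using tendsto_add[OF lim mass_tendsto_0[OF g(1)]] by simp
    fix r assume r: "0 < r" "r < R"
    show "((\<lambda>t. wt t * V' t + mass g t) has_real_derivative D r + wt r * g r) (at r)"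
      by (intro DERIV_add D mass_deriv g r)
    have "wt r * g r \<le> wt r * G r" using g(3)[OF r] wt_nonneg[of r] r by (simp add: mult_left_mono)
    then show "D r + wt r * g r \<le> 0" using DG[OF r] by simp
  qed (use t in auto)
  have "V R - pot g R \<le> V r - pot g r"
  proof (rule DERIV_nonpos_imp_decreasing_open[of r R "\<lambda>r. V r - pot g r"])
    fix t assume "r < t" "t < R"
    then have t: "0 < t" "t < R" using r by auto
    have "((\<lambda>r. V r - pot g r) has_real_derivative V' t - - flux g t) (at t)"
      by (intro DERIV_diff V' pot_deriv g t)
    moreover have "V' t - - flux g t = (wt t * V' t + mass g t) / wt t"
      using wt_pos[of t] t by (simp add: flux_def add_divide_distrib)
    moreover have "\<dots> \<le> 0" using neg[OF t] wt_pos[of t] t by (simp add: divide_nonpos_pos)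
    ultimately show "\<exists>y. DERIV (\<lambda>r. V r - pot g r) t :> y \<and> y \<le> 0" by auto
  next
    show "continuous_on {r..R} (\<lambda>r. V r - pot g r)"
      by (intro continuous_on_diff pot_cont_pos g continuous_on_subset[OF c]) (use r in auto)
  qed (use r in auto)
  then show ?thesis using VR by (simp add: pot_R)
qed

text \<open>Gives the value at 0 of the factor \<open>q\<close> in \<open>radial_C2\<close>: u'(r)/r
  tends to -g(0)/n. Numerator and denominator vanish at 0, and l'Hopital replaces
  \<open>mass\<close> by \<open>wt r * g r\<close>.\<close>

lemma flux_ratio_tendsto:
  assumes g: "continuous_on {0..R} g"
  shows "((\<lambda>r. flux g r / r) \<longlongrightarrow> g 0 / real n) (at_right 0)"
proof -
  have adm: "admissible g" by (rule admissible_cont[OF g])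
  have gc: "continuous_on {0<..R} g" by (rule continuous_on_subset[OF g]) auto
  let ?d = "\<lambda>r. wt r * ((real n - 1) * (cos r / sin r)) * r + wt r"
  have cosp: "0 < cos r" if "0 < r" "r < R" for r using that Rpi by (intro cos_gt_zero_pi) auto
  have ev: "\<forall>\<^sub>F r in at_right 0. 0 < r \<and> r < R"
    using R0 by (auto intro!: eventually_at_rightI[of 0 R])
  have dpos: "0 < ?d r" if "0 < r" "r < R" for r
    using that n2 wt_pos[of r] sin_pos[of r] cosp[of r] by (intro add_nonneg_pos mult_nonneg_nonneg) auto
  have "((\<lambda>r. mass g r / (wt r * r)) \<longlongrightarrow> g 0 / real n) (at_right 0)"
  proof (rule lhopital_right[where f'="\<lambda>r. wt r * g r" and g'="?d"])
    show "(mass g \<longlongrightarrow> 0) (at_right 0)" by (rule mass_tendsto_0[OF adm])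
    have "((\<lambda>r. wt r * r) \<longlongrightarrow> wt 0 * 0) (at_right 0)"
      unfolding wt_def by (intro tendsto_intros)
    then show "((\<lambda>r. wt r * r) \<longlongrightarrow> 0) (at_right 0)" by simp
    show "\<forall>\<^sub>F r in at_right 0. wt r * r \<noteq> 0" using ev by eventually_elim (use wt_pos in force)
    show "\<forall>\<^sub>F r in at_right 0. ?d r \<noteq> 0" using ev by eventually_elim (metis dpos less_irrefl)
    show "\<forall>\<^sub>F r in at_right 0. DERIV (mass g) r :> wt r * g r"
      using ev by eventually_elim (intro mass_deriv adm gc, auto)
    show "\<forall>\<^sub>F r in at_right 0. DERIV (\<lambda>r. wt r * r) r :> ?d r"
      using ev by eventually_elim (auto intro!: derivative_eq_intros wt_deriv)
    have "((\<lambda>r. r * cos r / sin r) \<longlongrightarrow> 1) (at_right (0::real))" by real_asymp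
    moreover have "(g \<longlongrightarrow> g 0) (at_right 0)"
      using g R0 by (auto simp: continuous_on_def at_within_Icc_at_right dest: bspec[of _ _ 0])
    ultimately have "((\<lambda>r. g r / ((real n - 1) * (r * cos r / sin r) + 1)) \<longlongrightarrow> g 0 / ((real n - 1) * 1 + 1)) (at_right 0)"
      by (intro tendsto_intros) (use n2 in auto)
    moreover have "(real n - 1) * 1 + 1 = real n" by simp
    ultimately have "((\<lambda>r. g r / ((real n - 1) * (r * cos r / sin r) + 1)) \<longlongrightarrow> g 0 / real n) (at_right 0)"
      by simp
    then show "((\<lambda>r. wt r * g r / ?d r) \<longlongrightarrow> g 0 / real n) (at_right 0)"
    proof (rule Lim_transform_eventually)
      show "\<forall>\<^sub>F r in at_right 0. g r / ((real n - 1) * (r * cos r / sin r) + 1) = wt r * g r / ?d r"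
        using ev
      proof eventually_elim
        fix r assume r: "0 < r \<and> r < R"
        have "?d r = wt r * ((real n - 1) * (r * cos r / sin r) + 1)" by (simp add: algebra_simps)
        then show "g r / ((real n - 1) * (r * cos r / sin r) + 1) = wt r * g r / ?d r"
          using wt_pos[of r] r by simp
      qed
    qed
  qed
  then show ?thesis by (simp add: flux_def)
qed

text \<open>For a radial function the equation expresses u'' by u'/r and \<open>g\<close>, so
  continuity of \<open>g\<close> already makes the potential C^2.\<close>

lemma pot_radial:
  assumes card: "CARD('n) = n" and g: "continuous_on {0..R} g"
  shows pot_C2: "C2_on (ball 0 R) (\<lambda>x::real^'n. pot g (norm x))"
    and pot_cont_cball: "continuous_on (cball 0 R) (\<lambda>x::real^'n. pot g (norm x))"
    and LB_pot: "\<And>x::real^'n. x \<in> ball 0 R \<Longrightarrow> LB (\<lambda>x. pot g (norm x)) x = - g (norm x)"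
proof -
  have adm: "admissible g" by (rule admissible_cont[OF g])
  have gc: "continuous_on {0<..R} g" by (rule continuous_on_subset[OF g]) auto
  obtain C where C: "\<And>t. 0 \<le> t \<Longrightarrow> t \<le> R \<Longrightarrow> \<bar>g t\<bar> \<le> C" using bounded_of_cont[OF g] by blast
  define q where "q r = (if r = 0 then - g 0 / real n else - flux g r / r)" for r
  \<comment> \<open>The derivative of \<open>- flux g r / r\<close>, with the derivative of the flux
    eliminated by the equation.\<close>
  define q1 where "q1 r = (- g r - q r * ((real n - 1) * (r * cos r / sin r) + 1)) / r" for r
  have ev: "\<forall>\<^sub>F r in at_right 0. 0 < r \<and> r < R"
    using R0 by (auto intro!: eventually_at_rightI[of 0 R])
  have fd: "(flux g has_real_derivative g r - flux g r * ((real n - 1) * (cos r / sin r))) (at r)"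
    if r: "0 < r" "r < R" for r
  proof -
    have "(flux g has_real_derivative
        (wt r * g r * wt r - mass g r * (wt r * ((real n - 1) * (cos r / sin r)))) / (wt r * wt r)) (at r)"
      using DERIV_divide[OF mass_deriv[OF adm gc r] wt_deriv[of r]] wt_pos[of r] r
      by (simp add: flux_def[abs_def])
    moreover have "(wt r * g r * wt r - mass g r * (wt r * ((real n - 1) * (cos r / sin r)))) / (wt r * wt r)
       = g r - flux g r * ((real n - 1) * (cos r / sin r))"
      using wt_pos[of r] r by (simp add: flux_def diff_divide_distrib)
    ultimately show ?thesis by simp
  qed
  have qd: "(q has_real_derivative q1 r) (at r)" if r: "0 < r" "r < R" for r
  proof (rule has_field_derivative_transform_within_open[where S="{0<..}"])
    have "((\<lambda>r. - flux g r / r) has_real_derivative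
       (- (g r - flux g r * ((real n - 1) * (cos r / sin r))) * r - - flux g r * 1) / (r * r)) (at r)"
      by (intro DERIV_divide DERIV_minus fd r DERIV_ident) (use r in auto)
    moreover have "(- (g r - flux g r * ((real n - 1) * (cos r / sin r))) * r - - flux g r * 1) / (r * r) = q1 r"
      using r sin_pos[of r] by (simp add: q1_def q_def field_simps)
    ultimately show "((\<lambda>r. - flux g r / r) has_real_derivative q1 r) (at r)" by simp
  qed (use r in \<open>auto simp: q_def\<close>)
  have q0: "(q \<longlongrightarrow> q 0) (at_right 0)"
  proof (rule Lim_transform_eventually)
    show "((\<lambda>r. - (flux g r / r)) \<longlongrightarrow> q 0) (at_right 0)"
      using tendsto_minus[OF flux_ratio_tendsto[OF g]] by (simp add: q_def)
    show "\<forall>\<^sub>F r in at_right 0. - (flux g r / r) = q r" using ev by eventually_elim (simp add: q_def)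
  qed
  have g0: "(g \<longlongrightarrow> g 0) (at_right 0)"
    using g R0 by (auto simp: continuous_on_def at_within_Icc_at_right dest: bspec[of _ _ 0])
  interpret radial_C2 R "pot g" q q1 "\<lambda>x::real^'n. pot g (norm x)"
  proof
    show "(pot g has_real_derivative r * q r) (at r)" if "0 < r" "r < R" for r
      using pot_deriv[OF adm that] that by (simp add: q_def)
    show "(pot g has_real_derivative 0) (at_right 0)" by (rule pot_deriv_0[OF adm C])
    show "(q has_real_derivative q1 r) (at r)" if "0 < r" "r < R" for r using qd that .
    have "continuous_on {0<..<R} q"
      by (intro continuous_at_imp_continuous_on ballI DERIV_isCont[OF qd]) auto
    moreover have "sin r \<noteq> 0" if "r \<in> {0<..<R}" for r using sin_pos[of r] that by simp
    ultimately show "continuous_on {0<..<R} q1" unfolding q1_def[abs_def]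
      by (intro continuous_intros continuous_on_subset[OF g]) auto
    have "((\<lambda>r. r * cos r / sin r) \<longlongrightarrow> 1) (at_right (0::real))" by real_asymp
    then have "((\<lambda>r. - g r - q r * ((real n - 1) * (r * cos r / sin r) + 1)) \<longlongrightarrow>
        - g 0 - q 0 * ((real n - 1) * 1 + 1)) (at_right 0)"
      by (intro tendsto_intros g0 q0)
    \<comment> \<open>The choice \<open>q 0 = - g 0 / n\<close> is precisely what makes the Hessian
      continuous at the centre.\<close>
    moreover have "- g 0 - q 0 * ((real n - 1) * 1 + 1) = 0" using n2 by (simp add: q_def)
    ultimately have "((\<lambda>r. - g r - q r * ((real n - 1) * (r * cos r / sin r) + 1)) \<longlongrightarrow> 0) (at_right 0)" by simp
    then show "((\<lambda>r. r * q1 r) \<longlongrightarrow> 0) (at_right 0)"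
      by (rule Lim_transform_eventually) (use ev in eventually_elim, simp add: q1_def)
  qed (use R0 q0 in auto)
  show "C2_on (ball 0 R) (\<lambda>x::real^'n. pot g (norm x))" by (rule C2)
  show "continuous_on (cball 0 R) (\<lambda>x::real^'n. pot g (norm x))"
    by (rule continuous_on_compose2[OF pot_cont[OF adm C]]) (auto intro!: continuous_intros)
  show "LB (\<lambda>x. pot g (norm x)) x = - g (norm x)" if x: "x \<in> ball 0 R" for x :: "real^'n"
  proof (cases "x = 0")
    case True
    then show ?thesis using LB_radial_0 n2 by (simp add: card q_def)
  next
    case False
    let ?r = "norm x" and ?B = "\<lambda>r. sinc_r r ^ (CARD('n) - 1) * q r"
    have r: "0 < ?r" "?r < R" using False x by auto
    \<comment> \<open>The density \<open>sinc_r r ^ (n - 1)\<close> is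
      \<open>wt r / r ^ (n - 1)\<close> and cancels the weight in the flux, so the mass can be
      differentiated directly.\<close>
    have B: "- mass g r / r ^ n = ?B r" if "0 < r" "r < R" for r
    proof -
      have "r ^ n = r ^ (n - 1) * r" using n2 power_minus_mult[of n r] by simp
      then show ?thesis using sin_pos[of r] that
        by (simp add: q_def flux_def sinc_r_def card power_divide wt_def)
    qed
    have "((\<lambda>r. - mass g r / r ^ n) has_real_derivative
       (- (wt ?r * g ?r) * ?r ^ n - - mass g ?r * (real n * ?r ^ (n - 1))) / (?r ^ n * ?r ^ n)) (at ?r)"
      using r by (intro DERIV_divide DERIV_minus mass_deriv adm gc) (auto intro!: derivative_eq_intros)
    then have "(?B has_real_derivative
       (- (wt ?r * g ?r) * ?r ^ n - - mass g ?r * (real n * ?r ^ (n - 1))) / (?r ^ n * ?r ^ n)) (at ?r)"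
      by (rule has_field_derivative_transform_within_open[where S="{0<..<R}"]) (use r B in auto)
    from LB_radial[OF x False refl this]
    have "LB (\<lambda>x. pot g (norm x)) x = (real n * ?B ?r + ?r * ((- (wt ?r * g ?r) * ?r ^ n - - mass g ?r * (real n * ?r ^ (n - 1))) / (?r ^ n * ?r ^ n))) / sqrtdetg x"
      by (simp add: card)
    also have "?B ?r = - mass g ?r / ?r ^ n" using B[OF r] by simp
    also have "?r ^ n = ?r ^ (n - 1) * ?r" using n2 power_minus_mult[of n ?r] by simp
    also have "sqrtdetg x = wt ?r / ?r ^ (n - 1)" using False by (simp add: sqrtdetg_def sinc_r_def card wt_def power_divide)
    finally show ?thesis using r wt_pos[of ?r] by (simp add: field_simps)
  qed
qed

end

section \<open>Uniqueness below a semistable singular solution\<close>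

text \<open>\<open>H\<close> is a bounded primitive of 1/f, available because f grows superlinearly
  fast enough; it drives the concave change of unknown. \<open>h\<close> is the positive
  supersolution of the equation linearised at \<open>U\<close>. The last two limits are the boundary
  terms at 0 of the Wronskian of \<open>U\<close> and \<open>h\<close>.\<close>

locale singular_solution = sphere_cap +
  fixes f f' H U U' h h' h'' :: "real \<Rightarrow> real" and lamS HB :: real
  assumes f_deriv: "\<And>u. 0 \<le> u \<Longrightarrow> (f has_real_derivative f' u) (at u)"
    and f'_mono: "\<And>u v. 0 \<le> u \<Longrightarrow> u \<le> v \<Longrightarrow> f' u \<le> f' v"
    and f'_0: "0 \<le> f' 0" and f_0: "0 < f 0"
    and H_deriv: "\<And>u. 0 \<le> u \<Longrightarrow> (H has_real_derivative 1 / f u) (at u)"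
    and H_bound: "\<And>u. 0 \<le> u \<Longrightarrow> H u \<le> HB"
    and lamS_pos: "0 < lamS"
    and U_deriv: "\<And>r. 0 < r \<Longrightarrow> r < R \<Longrightarrow> (U has_real_derivative U' r) (at r)"
    and U_eq: "\<And>r. 0 < r \<Longrightarrow> r < R \<Longrightarrow>
        ((\<lambda>r. wt r * U' r) has_real_derivative - (lamS * (wt r * f (U r)))) (at r)"
    and U_cont: "continuous_on {0<..R} U" and U'_cont: "continuous_on {0<..R} U'"
    and U_R: "U R = 0" and U_pos: "\<And>r. 0 < r \<Longrightarrow> r < R \<Longrightarrow> 0 < U r"
    and U_flux_0: "((\<lambda>r. wt r * U' r) \<longlongrightarrow> 0) (at_right 0)"
    and U_top: "filterlim U at_top (at_right 0)"
    and h_deriv: "\<And>r. 0 < r \<Longrightarrow> r < R \<Longrightarrow> (h has_real_derivative h' r) (at r)"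
    and h_deriv2: "\<And>r. 0 < r \<Longrightarrow> r < R \<Longrightarrow> ((\<lambda>r. wt r * h' r) has_real_derivative h'' r) (at r)"
    and h_super: "\<And>r. 0 < r \<Longrightarrow> r < R \<Longrightarrow> h'' r \<le> - (lamS * (wt r * (f' (U r) * h r)))"
    and h_cont: "continuous_on {0<..R} h" and h_pos: "\<And>r. 0 < r \<Longrightarrow> r \<le> R \<Longrightarrow> 0 < h r"
    and hU'_0: "((\<lambda>r. wt r * U' r * h r) \<longlongrightarrow> 0) (at_right 0)"
    and h'U_0: "((\<lambda>r. U r * (wt r * h' r)) \<longlongrightarrow> 0) (at_right 0)"
begin

lemma f'_nonneg: "0 \<le> u \<Longrightarrow> 0 \<le> f' u"
  using f'_mono[of 0 u] f'_0 by simp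

lemma f_mono: "0 \<le> u \<Longrightarrow> u \<le> v \<Longrightarrow> f u \<le> f v"
  by (rule DERIV_nonneg_imp_nondecreasing[of u v f], simp, rule exI) (auto intro!: f_deriv f'_nonneg)

lemma f_pos: "0 \<le> u \<Longrightarrow> 0 < f u"
  using f_mono[of 0 u] f_0 by simp

lemma f_cont: "continuous_on {0..} f"
  by (intro continuous_at_imp_continuous_on ballI DERIV_isCont[OF f_deriv]) auto

lemma f_compose_cont: "continuous_on S v \<Longrightarrow> (\<And>x. x \<in> S \<Longrightarrow> 0 \<le> v x) \<Longrightarrow> continuous_on S (\<lambda>x. f (v x))"
  by (rule continuous_on_compose2[OF f_cont]) auto

lemma f_tangent:
  assumes "0 \<le> y" "y \<le> x"
  shows "f x - f y \<le> f' x * (x - y)"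
proof (cases "y = x")
  case False
  then obtain z where "y < z" "z < x" "f x - f y = (x - y) * f' z"
    using MVT2[of y x f f'] f_deriv assms by force
  moreover have "f' z * (x - y) \<le> f' x * (x - y)"
    using f'_mono[of z x] calculation assms by (intro mult_right_mono) auto
  ultimately show ?thesis by (simp add: mult.commute)
qed simp

lemma U_nonneg: "0 < r \<Longrightarrow> r \<le> R \<Longrightarrow> 0 \<le> U r"
  using U_pos[of r] U_R by (cases "r = R") auto

text \<open>Integrability of \<open>f (U r)\<close> comes for free: the flux of \<open>U\<close>
  extends continuously by 0 to the centre, and the fundamental theorem makes its derivative
  integrable.\<close>

lemma mass_fU:
  assumes r: "0 < r" "r \<le> R"
  shows "lamS * mass (\<lambda>r. f (U r)) r = - (wt r * U' r)"
    and "(\<lambda>t. wt t * f (U t)) integrable_on {0..r}"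
proof -
  define F where "F t = (if t = 0 then 0 else wt t * U' t)" for t
  have Fc: "continuous_on {0..r} F"
    unfolding continuous_on_eq_continuous_within
  proof
    fix t assume t: "t \<in> {0..r}"
    show "continuous (at t within {0..r}) F"
    proof (cases "t = 0")
      case True
      have "(F \<longlongrightarrow> 0) (at_right 0)"
        by (rule Lim_transform_eventually[OF U_flux_0]) (simp add: F_def eventually_at_filter)
      then show ?thesis using True r by (simp add: continuous_within at_within_Icc_at_right F_def)
    next
      case False
      have "continuous_on {0<..r} (\<lambda>t. wt t * U' t)"
        by (intro continuous_intros wt_cont continuous_on_subset[OF U'_cont]) (use r in auto)
      then have "continuous_on {0<..r} F"
        by (subst continuous_on_cong[OF refl]) (auto simp: F_def)
      then have "continuous (at t within {0<..r}) F"
        using t False by (auto simp: continuous_on_eq_continuous_within)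
      moreover have "at t within {0<..r} = at t within {0..r}"
        by (rule at_within_nhd[of _ "{0<..}"]) (use False t in auto)
      ultimately show ?thesis by (simp add: continuous_within)
    qed
  qed
  have "((\<lambda>t. - (lamS * (wt t * f (U t)))) has_integral F r - F 0) {0..r}"
  proof (rule fundamental_theorem_of_calculus_interior[OF _ Fc])
    fix t assume t: "t \<in> {0<..<r}"
    have "(F has_real_derivative - (lamS * (wt t * f (U t)))) (at t)"
      by (rule has_field_derivative_transform_within_open[OF U_eq, where S="{0<..}"])
        (use t r in \<open>auto simp: F_def\<close>)
    then show "(F has_vector_derivative - (lamS * (wt t * f (U t)))) (at t)"
      by (simp add: has_real_derivative_iff_has_vector_derivative)
  qed (use r in auto)
  then have I: "((\<lambda>t. - (lamS * (wt t * f (U t)))) has_integral wt r * U' r) {0..r}"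
    using r by (simp add: F_def)
  have "((\<lambda>t. (- 1 / lamS) * (- (lamS * (wt t * f (U t))))) has_integral (- 1 / lamS) * (wt r * U' r)) {0..r}"
    by (rule has_integral_mult_right[OF I])
  then have J: "((\<lambda>t. wt t * f (U t)) has_integral (- 1 / lamS) * (wt r * U' r)) {0..r}"
    using lamS_pos by simp
  then show "(\<lambda>t. wt t * f (U t)) integrable_on {0..r}" by blast
  show "lamS * mass (\<lambda>r. f (U r)) r = - (wt r * U' r)"
    using integral_unique[OF J] lamS_pos by (simp add: mass_def)
qed

lemma admissible_fU: "admissible (\<lambda>r. f (U r))"
  using mass_fU(2)[of R] R0 by simp

lemma mass_scale: "mass (\<lambda>r. c * g r) r = c * mass g r"
  by (simp add: mass_def mult.left_commute)

lemma admissible_scale: "admissible g \<Longrightarrow> admissible (\<lambda>r. c * g r)"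
  using integrable_on_cmult_left[of "\<lambda>t. wt t * g t" "{0..R}" c] by (simp add: mult.left_commute)

text \<open>The Wronskian of \<open>U - v\<close> and \<open>h\<close> is nondecreasing from 0, so \<open>(U - v) / h\<close> is nondecreasing;
  as it vanishes at R, \<open>U \<le> v\<close>.\<close>

lemma singular_solution_unique:
  assumes v: "\<And>r. 0 < r \<Longrightarrow> r \<le> R \<Longrightarrow> 0 \<le> v r" "\<And>r. 0 < r \<Longrightarrow> r \<le> R \<Longrightarrow> v r \<le> U r"
    and adm: "admissible (\<lambda>r. lamS * f (v r))"
    and eq: "\<And>r. 0 < r \<Longrightarrow> r \<le> R \<Longrightarrow> v r = pot (\<lambda>r. lamS * f (v r)) r"
    and r: "0 < r" "r \<le> R"
  shows "v r = U r"
proof -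
  let ?g = "\<lambda>r. lamS * f (v r)"
  have v_cont: "continuous_on {a..R} v" if "0 < a" for a
    using pot_cont_pos[OF adm that] by (rule continuous_on_eq) (use eq that in auto)
  have v_cont0: "continuous_on {0<..R} v"
    unfolding continuous_on_eq_continuous_within
  proof
    fix t assume t: "t \<in> {0<..R}"
    then have "continuous (at t within {t/2..R}) v"
      using v_cont[of "t/2"] by (auto simp: continuous_on_eq_continuous_within)
    moreover have "at t within {t/2..R} = at t within {0<..R}"
      by (rule at_within_nhd[of _ "{t/2<..}"]) (use t in auto)
    ultimately show "continuous (at t within {0<..R}) v" by (simp add: continuous_within)
  qed
  have g_cont: "continuous_on {0<..R} ?g"
    by (intro continuous_intros f_compose_cont v_cont0) (use v in auto)
  have v_deriv: "(v has_real_derivative - flux ?g t) (at t)" if "0 < t" "t < R" for t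
    by (rule has_field_derivative_transform_within_open[OF pot_deriv[OF adm that], where S="{0<..<R}"])
      (use that eq in auto)
  \<comment> \<open>\<open>p\<close> is \<open>wt * (U - v)'\<close>, since the flux of
    \<open>v\<close> is minus its mass; \<open>W\<close> is the weighted Wronskian.\<close>
  define p where "p t = wt t * U' t + mass ?g t" for t
  define W where "W t = p t * h t - (U t - v t) * (wt t * h' t)" for t
  \<comment> \<open>The bounds transfer the decay assumed for \<open>U\<close> to the difference
    \<open>U - v\<close>, about whose derivative nothing else is known near 0.\<close>
  have p: "wt t * U' t \<le> p t" "p t \<le> 0" if t: "0 < t" "t \<le> R" for t
  proof -
    have "0 \<le> mass ?g t"
      by (rule mass_nonneg[OF adm]) (use t v f_pos lamS_pos in \<open>auto intro: less_imp_le\<close>)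
    then show "wt t * U' t \<le> p t" by (simp add: p_def)
    have "mass ?g t \<le> mass (\<lambda>r. lamS * f (U r)) t"
      by (rule mass_mono[OF adm admissible_scale[OF admissible_fU]])
        (use t v f_mono lamS_pos in auto)
    then show "p t \<le> 0" using mass_fU(1)[OF t] by (simp add: p_def mass_scale)
  qed
  have W_0: "(W \<longlongrightarrow> 0) (at_right 0)"
  proof -
    have ev: "\<forall>\<^sub>F r in at_right 0. 0 < r \<and> r < R"
      using R0 by (auto intro!: eventually_at_rightI[of 0 R])
    have 1: "((\<lambda>t. p t * h t) \<longlongrightarrow> 0) (at_right 0)"
    proof (rule Lim_null_comparison[OF _ tendsto_norm_zero[OF hU'_0]])
      show "\<forall>\<^sub>F t in at_right 0. norm (p t * h t) \<le> norm (wt t * U' t * h t)"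
        using ev
      proof eventually_elim
        fix t assume t: "0 < t \<and> t < R"
        then have "\<bar>p t\<bar> \<le> \<bar>wt t * U' t\<bar>" using p[of t] by auto
        then show "norm (p t * h t) \<le> norm (wt t * U' t * h t)"
          by (simp add: abs_mult mult_right_mono)
      qed
    qed
    have 2: "((\<lambda>t. (U t - v t) * (wt t * h' t)) \<longlongrightarrow> 0) (at_right 0)"
    proof (rule Lim_null_comparison[OF _ tendsto_norm_zero[OF h'U_0]])
      show "\<forall>\<^sub>F t in at_right 0. norm ((U t - v t) * (wt t * h' t)) \<le> norm (U t * (wt t * h' t))"
        using ev
      proof eventually_elim
        fix t assume t: "0 < t \<and> t < R"
        then have "\<bar>U t - v t\<bar> \<le> \<bar>U t\<bar>" using v[of t] by auto
        then show "norm ((U t - v t) * (wt t * h' t)) \<le> norm (U t * (wt t * h' t))"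
          by (simp add: abs_mult mult_right_mono)
      qed
    qed
    show ?thesis using tendsto_diff[OF 1 2] by (simp add: W_def[abs_def])
  qed
  have W_nonneg: "0 \<le> W t" if t: "0 < t" "t < R" for t
  proof -
    have "- W t \<le> 0"
    proof (rule nonpos_of_nonincreasing_from_0[where F="\<lambda>t. - W t" and R=R])
      show "((\<lambda>t. - W t) \<longlongrightarrow> 0) (at_right 0)" using tendsto_minus[OF W_0] by simp
      fix t assume t: "0 < t" "t < R"
      let ?p' = "- (lamS * (wt t * f (U t))) + wt t * ?g t" and ?f' = "U' t - - flux ?g t"
      have "(p has_real_derivative ?p') (at t)"
        unfolding p_def[abs_def] by (intro DERIV_add U_eq mass_deriv adm g_cont t)
      then have "(W has_real_derivative (?p' * h t + h' t * p t) - (?f' * (wt t * h' t) + h'' t * (U t - v t))) (at t)"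
        unfolding W_def[abs_def]
        by (intro DERIV_diff DERIV_mult h_deriv h_deriv2 U_deriv v_deriv t)
      then show "((\<lambda>t. - W t) has_real_derivative
          - ((?p' * h t + h' t * p t) - (?f' * (wt t * h' t) + h'' t * (U t - v t)))) (at t)"
        by (rule DERIV_minus)
      have wf: "wt t * ?f' = p t" using wt_pos[of t] t by (simp add: p_def flux_def distrib_left)
      have vt: "0 \<le> v t" "v t \<le> U t" using v t by auto
      have "(U t - v t) * h'' t \<le> (U t - v t) * - (lamS * (wt t * (f' (U t) * h t)))"
        using h_super[OF t] vt by (intro mult_left_mono) auto
      moreover have "lamS * (wt t * h t) * (f (U t) - f (v t)) \<le> lamS * (wt t * h t) * (f' (U t) * (U t - v t))"
        using f_tangent[OF vt] lamS_pos wt_pos[of t] h_pos[of t] t by (intro mult_left_mono) auto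
      \<comment> \<open>The two products of first derivatives cancel; what remains is decided by the
        tangent inequality of the convex f and by \<open>h_super\<close>.\<close>
      moreover have "(?p' * h t + h' t * p t) - (?f' * (wt t * h' t) + h'' t * (U t - v t))
         = - (lamS * (wt t * h t) * (f (U t) - f (v t))) - (U t - v t) * h'' t"
        unfolding wf[symmetric] by (simp add: algebra_simps)
      ultimately show "- ((?p' * h t + h' t * p t) - (?f' * (wt t * h' t) + h'' t * (U t - v t))) \<le> 0"
        by (simp add: algebra_simps)
    qed (use t in auto)
    then show ?thesis by simp
  qed
  have "(U r - v r) / h r \<le> (U R - v R) / h R"
  proof (rule DERIV_nonneg_imp_increasing_open[of r R "\<lambda>r. (U r - v r) / h r"])
    fix t assume "r < t" "t < R"
    then have t: "0 < t" "t < R" using r by auto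
    have "((\<lambda>r. (U r - v r) / h r) has_real_derivative
       ((U' t - - flux ?g t) * h t - (U t - v t) * h' t) / (h t * h t)) (at t)"
      using h_pos[of t] t by (intro DERIV_divide DERIV_diff U_deriv v_deriv h_deriv) auto
    moreover have "(U' t - - flux ?g t) * h t - (U t - v t) * h' t = W t / wt t"
      using wt_pos[of t] t by (simp add: W_def p_def flux_def field_simps)
    ultimately have "((\<lambda>r. (U r - v r) / h r) has_real_derivative W t / wt t / (h t * h t)) (at t)"
      by simp
    moreover have "0 \<le> W t / wt t / (h t * h t)"
      using W_nonneg[OF t] wt_pos[of t] h_pos[of t] t by simp
    ultimately show "\<exists>y. ((\<lambda>r. (U r - v r) / h r) has_real_derivative y) (at t) \<and> 0 \<le> y" by blast
  next
    have "h t \<noteq> 0" if "t \<in> {r..R}" for t using h_pos[of t] that r by auto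
    then show "continuous_on {r..R} (\<lambda>r. (U r - v r) / h r)"
      by (intro continuous_on_divide continuous_on_diff continuous_on_subset[OF U_cont]
          continuous_on_subset[OF v_cont0] continuous_on_subset[OF h_cont]) (use r in auto)
  qed (use r in auto)
  also have "\<dots> \<le> 0" using U_R v(1)[of R] h_pos[of R] R0 by (simp add: divide_nonpos_pos)
  finally have "U r \<le> v r" using h_pos[OF r] by (simp add: divide_le_0_iff)
  with v(2)[OF r] show ?thesis by simp
qed

end

section \<open>The minimal solutions\<close>

context singular_solution
begin

lemma H_strict_mono: "0 \<le> u \<Longrightarrow> u < v \<Longrightarrow> H u < H v"
  by (rule DERIV_pos_imp_increasing[of u v H], simp, rule exI) (auto intro!: H_deriv f_pos)

lemma H_mono: "0 \<le> u \<Longrightarrow> u \<le> v \<Longrightarrow> H u \<le> H v"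
  using H_strict_mono[of u v] by (cases "u = v") auto

text \<open>A bounded \<open>H\<close> cannot reach its supremum after its increments have been
  shrunk by \<theta> < 1; any level \<open>H M\<close> between the shrunken supremum and the true
  one works.\<close>

lemma H_level:
  assumes "0 < \<theta>" "\<theta> < 1"
  obtains M where "0 < M" "\<And>u. 0 \<le> u \<Longrightarrow> H 0 + \<theta> * (H u - H 0) < H M"
proof -
  define L where "L = (SUP u\<in>{0..}. H u)"
  have bdd: "bdd_above (H ` {0..})" using H_bound by (auto intro!: bdd_aboveI)
  then have le: "H u \<le> L" if "0 \<le> u" for u unfolding L_def using that by (intro cSUP_upper) auto
  have L0: "H 0 < L" using le[of 1] H_strict_mono[of 0 1] by simp
  then have "\<theta> * (L - H 0) < L - H 0" using assms by simp
  then have "H 0 + \<theta> * (L - H 0) < L" by simp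
  then obtain M where M: "0 \<le> M" "H 0 + \<theta> * (L - H 0) < H M"
    unfolding L_def by (subst (asm) less_cSUP_iff[OF _ bdd]) auto
  have "0 < \<theta> * (L - H 0)" using L0 assms by simp
  then have "M \<noteq> 0" using M by auto
  moreover have "H 0 + \<theta> * (H u - H 0) < H M" if "0 \<le> u" for u
  proof -
    have "\<theta> * (H u - H 0) \<le> \<theta> * (L - H 0)" using le[OF that] assms by simp
    then show ?thesis using M by simp
  qed
  ultimately show ?thesis using M that[of M] by auto
qed

text \<open>The concave change of unknown \<open>V = \<Phi>(U)\<close> with \<open>H(V) - H(0) = \<theta> (H(U) - H(0))\<close>, that is
  \<open>\<Phi>' = \<theta> f(\<Phi>) / f\<close>, trades a factor \<open>\<theta>\<close> in the parameter for boundedness.\<close>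

lemma bounded_radial_super:
  assumes lam: "0 < lam" "lam < lamS"
  obtains V M where "radial_super (\<lambda>r. lam * f (V r)) V"
    "\<And>r. 0 < r \<Longrightarrow> r \<le> R \<Longrightarrow> 0 \<le> V r" "\<And>r. 0 < r \<Longrightarrow> r \<le> R \<Longrightarrow> V r \<le> M"
proof -
  define \<theta> where "\<theta> = lam / lamS"
  have th: "0 < \<theta>" "\<theta> < 1" "\<theta> * lamS = lam" using lam lamS_pos by (auto simp: \<theta>_def)
  obtain M where M: "0 < M" "\<And>u. 0 \<le> u \<Longrightarrow> H 0 + \<theta> * (H u - H 0) < H M"
    using H_level[OF th(1,2)] by blast
  define K where "K = inv_into {0..M} H"
  have inj: "inj_on H {0..M}"
    by (rule linorder_inj_onI) (use H_strict_mono in force)+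
  have Hc: "continuous_on {0..M} H"
    by (intro continuous_at_imp_continuous_on ballI DERIV_isCont[OF H_deriv]) auto
  have im: "H ` {0..M} = {H 0..H M}"
  proof
    show "H ` {0..M} \<subseteq> {H 0..H M}" using H_mono by auto
    show "{H 0..H M} \<subseteq> H ` {0..M}"
      using IVT'[of H 0 _ M] Hc M by fastforce
  qed
  have KH: "K (H y) = y" if "0 \<le> y" "y \<le> M" for y using inj that by (simp add: K_def)
  have HK: "H (K y) = y" "0 \<le> K y" "K y \<le> M" if "H 0 \<le> y" "y \<le> H M" for y
    using f_inv_into_f[of y H "{0..M}"] inv_into_into[of y H "{0..M}"] im that by (auto simp: K_def)
  have Kc: "continuous_on {H 0..H M} K"
    using continuous_on_inv[OF Hc compact_Icc, of K] KH im by auto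
  have Kd: "(K has_real_derivative f (K y)) (at y)" if y: "H 0 < y" "y < H M" for y
  proof -
    have "isCont K y" using continuous_on_interior[OF Kc, of y] y by simp
    then have "(K has_real_derivative inverse (1 / f (K y))) (at y)"
      using HK y f_pos[of "K y"] by (intro DERIV_inverse_function[where f=H and a="H 0" and b="H M"] H_deriv) auto
    then show ?thesis by (simp add: inverse_eq_divide)
  qed
  define Y where "Y r = H 0 + \<theta> * (H (U r) - H 0)" for r
  define V where "V r = K (Y r)" for r
  have Y: "H 0 \<le> Y r" "Y r \<le> H M" "Y r \<le> H (U r)" if "0 < r" "r \<le> R" for r
  proof -
    have "H 0 \<le> H (U r)" using H_mono[of 0 "U r"] U_nonneg that by simp
    then show "H 0 \<le> Y r" "Y r \<le> H (U r)"
      using th mult_right_mono[of \<theta> 1 "H (U r) - H 0"] by (auto simp: Y_def)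
    show "Y r \<le> H M" using M(2)[of "U r"] U_nonneg that by (simp add: Y_def)
  qed
  have Ys: "H 0 < Y r" "Y r < H M" if "0 < r" "r < R" for r
    using H_strict_mono[of 0 "U r"] U_pos[of r] M(2)[of "U r"] that th by (auto simp: Y_def)
  have V: "0 \<le> V r" "V r \<le> M" if "0 < r" "r \<le> R" for r
    using HK Y[OF that] by (auto simp: V_def)
  have VU: "V r \<le> U r" if "0 < r" "r \<le> R" for r
  proof (rule ccontr)
    assume "\<not> V r \<le> U r"
    then have "H (U r) < H (V r)" using H_strict_mono[of "U r" "V r"] U_nonneg that by auto
    then show False using HK(1)[of "Y r"] Y[OF that] by (simp add: V_def)
  qed
  define V' where "V' r = \<theta> * (f (V r) / f (U r) * U' r)" for r
  have Vd: "(V has_real_derivative V' r) (at r)" if r: "0 < r" "r < R" for r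
  proof -
    have "((\<lambda>r. H (U r)) has_real_derivative 1 / f (U r) * U' r) (at r)"
      using DERIV_chain2[OF H_deriv U_deriv] U_nonneg[of r] r by simp
    then have "(Y has_real_derivative 0 + \<theta> * (1 / f (U r) * U' r - 0)) (at r)"
      unfolding Y_def[abs_def] by (intro DERIV_add DERIV_const DERIV_cmult DERIV_diff)
    from DERIV_chain2[OF Kd this, OF Ys[OF r]] show ?thesis
      by (simp add: V_def[abs_def] V'_def mult_ac)
  qed
  have "radial_super (\<lambda>r. lam * f (V r)) V"
    unfolding radial_super_def
  proof (intro exI conjI allI impI)
    let ?Q = "\<lambda>r. (f' (V r) * V' r * f (U r) - f (V r) * (f' (U r) * U' r)) / (f (U r) * f (U r))"
    let ?D = "\<lambda>r. \<theta> * (?Q r * (wt r * U' r) + - (lamS * (wt r * f (U r))) * (f (V r) / f (U r)))"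
    fix r assume "0 < r \<and> r < R"
    then have r: "0 < r" "r < R" by auto
    have UV: "0 \<le> U r" "0 \<le> V r" "V r \<le> U r" using U_nonneg V VU r by auto
    show "(V has_real_derivative V' r) (at r)" by (rule Vd[OF r])
    have fU: "0 < f (U r)" and fV: "0 < f (V r)" using f_pos UV by auto
    have "((\<lambda>r. \<theta> * (f (V r) / f (U r) * (wt r * U' r))) has_real_derivative ?D r) (at r)"
      using fU UV
      by (intro DERIV_cmult DERIV_mult DERIV_divide U_eq r DERIV_chain2[OF f_deriv Vd] DERIV_chain2[OF f_deriv U_deriv]) auto
    then show "((\<lambda>r. wt r * V' r) has_real_derivative ?D r) (at r)"
      by (simp add: V'_def mult_ac)
    \<comment> \<open>The second derivative of the change of unknown has the sign of \<theta> f'(V)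
      - f'(U). This is its concavity, from convexity of f and V \<le> U.\<close>
    have "\<theta> * f' (V r) \<le> 1 * f' (U r)"
      using th f'_mono[of "V r" "U r"] f'_nonneg[of "V r"] UV by (intro mult_mono) auto
    then have "(f (V r) * wt r * (U' r * U' r) / (f (U r) * f (U r))) * (\<theta> * f' (V r) - f' (U r)) \<le> 0"
      using wt_pos[of r] r fU fV by (intro mult_nonneg_nonpos) auto
    moreover have "?Q r * (wt r * U' r) = (f (V r) * wt r * (U' r * U' r) / (f (U r) * f (U r))) * (\<theta> * f' (V r) - f' (U r))"
      using fU by (simp add: V'_def field_simps)
    ultimately have "?Q r * (wt r * U' r) \<le> 0" by (simp only:)
    then have "\<theta> * (?Q r * (wt r * U' r)) \<le> 0" 
      by (rule mult_nonneg_nonpos[OF less_imp_le[OF th(1)]])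
    moreover have "?D r = \<theta> * (?Q r * (wt r * U' r)) - (\<theta> * lamS) * (wt r * f (V r))"
      using fU by (simp add: right_diff_distrib)
    ultimately show "?D r \<le> - (wt r * (lam * f (V r)))"
      unfolding th(3) by (simp add: mult_ac)
  next
    have HUc: "continuous_on {0<..R} (\<lambda>r. H (U r))"
      by (rule continuous_on_compose2[where t="{0..}", OF continuous_at_imp_continuous_on U_cont])
        (use U_nonneg in \<open>auto intro: DERIV_isCont[OF H_deriv]\<close>)
    show "continuous_on {0<..R} V"
      unfolding V_def[abs_def]
      by (rule continuous_on_compose2[OF Kc]) (use Y HUc in \<open>auto simp: Y_def[abs_def] intro!: continuous_intros\<close>)
    show "0 \<le> V R" using V R0 by simp
    show "((\<lambda>r. wt r * V' r) \<longlongrightarrow> 0) (at_right 0)"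
    proof (rule Lim_null_comparison[OF _ tendsto_norm_zero[OF U_flux_0]])
      have "\<forall>\<^sub>F r in at_right 0. 0 < r \<and> r < R"
        using R0 by (auto intro!: eventually_at_rightI[of 0 R])
      then show "\<forall>\<^sub>F r in at_right 0. norm (wt r * V' r) \<le> norm (wt r * U' r)"
      proof eventually_elim
        fix r assume r: "0 < r \<and> r < R"
        have UV: "0 \<le> U r" "0 \<le> V r" "V r \<le> U r" using U_nonneg V VU r by auto
        \<comment> \<open>The change of unknown has slope at most 1, so the flux of \<open>V\<close>
          is dominated by that of \<open>U\<close>.\<close>
        have "0 \<le> f (V r) / f (U r)" "f (V r) / f (U r) \<le> 1"
          using f_mono[OF UV(2,3)] f_pos[OF UV(1)] f_pos[OF UV(2)] by auto
        then have "\<bar>\<theta> * (f (V r) / f (U r))\<bar> \<le> 1"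
          using th mult_mono[of \<theta> 1 "f (V r) / f (U r)" 1] f_pos[OF UV(1)] f_pos[OF UV(2)] by simp
        then have "\<bar>\<theta> * (f (V r) / f (U r))\<bar> * \<bar>wt r * U' r\<bar> \<le> 1 * \<bar>wt r * U' r\<bar>"
          by (rule mult_right_mono) simp
        then show "norm (wt r * V' r) \<le> norm (wt r * U' r)"
          by (simp add: V'_def abs_mult mult_ac)
      qed
    qed
  qed
  with V show ?thesis using that by blast
qed

section \<open>The monotone iteration and its limit\<close>

fun iter :: "real \<Rightarrow> nat \<Rightarrow> real \<Rightarrow> real" where
  "iter lam 0 = (\<lambda>r. 0)"
| "iter lam (Suc k) = pot (\<lambda>r. lam * f (iter lam k r))"

lemma flux_integrable_cont: "continuous_on {0..R} g \<Longrightarrow> 0 \<le> r \<Longrightarrow> flux g integrable_on {r..R}"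
  by (rule bounded_of_cont, assumption)
    (rule integrable_continuous_real, rule continuous_on_subset[OF flux_cont[OF admissible_cont]], auto)

lemma pot_nonneg:
  assumes "continuous_on {0..R} g" "\<And>t. 0 \<le> t \<Longrightarrow> t \<le> R \<Longrightarrow> 0 \<le> g t" "0 \<le> r" "r \<le> R"
  shows "0 \<le> pot g r"
  unfolding pot_def
proof (rule integral_nonneg[OF flux_integrable_cont[OF assms(1,3)]])
  fix t assume "t \<in> {r..R}"
  then show "0 \<le> flux g t"
    using mass_nonneg[OF admissible_cont[OF assms(1)], of t] wt_nonneg[of t] assms by (simp add: flux_def)
qed

lemma iter_cont_nonneg:
  assumes "0 \<le> lam"
  shows "continuous_on {0..R} (iter lam k) \<and> (\<forall>r\<in>{0..R}. 0 \<le> iter lam k r)"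
proof (induction k)
  case (Suc k)
  then have c: "continuous_on {0..R} (\<lambda>r. lam * f (iter lam k r))"
    by (intro continuous_intros f_compose_cont) auto
  obtain C where C: "\<And>t. 0 \<le> t \<Longrightarrow> t \<le> R \<Longrightarrow> \<bar>lam * f (iter lam k t)\<bar> \<le> C"
    using bounded_of_cont[OF c] by blast
  have "continuous_on {0..R} (iter lam (Suc k))"
    using pot_cont[OF admissible_cont[OF c] C] by simp
  moreover have "0 \<le> iter lam (Suc k) r" if "r \<in> {0..R}" for r
    using pot_nonneg[OF c, of r] that Suc assms f_pos by (simp add: less_imp_le)
  ultimately show ?case by blast
qed simp

lemmas iter_cont = iter_cont_nonneg[THEN conjunct1]
lemma iter_nonneg: "0 \<le> lam \<Longrightarrow> 0 \<le> r \<Longrightarrow> r \<le> R \<Longrightarrow> 0 \<le> iter lam k r"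
  using iter_cont_nonneg by auto

lemma source_cont: "0 \<le> lam \<Longrightarrow> continuous_on {0..R} (\<lambda>r. lam * f (iter lam k r))"
  by (intro continuous_intros f_compose_cont iter_cont) (auto intro: iter_nonneg)

lemma iter_mono:
  assumes "0 \<le> lam" "lam \<le> mu" "0 \<le> r" "r \<le> R"
  shows "iter lam k r \<le> iter mu k r"
  using assms(3,4)
proof (induction k arbitrary: r)
  case (Suc k)
  have "lam * f (iter lam k t) \<le> mu * f (iter mu k t)" if "0 < t" "t \<le> R" for t
    using Suc.IH[of t] that assms iter_nonneg[of lam t k] f_pos[OF iter_nonneg[of lam t k]]
    by (intro mult_mono f_mono) auto
  then show ?case using assms Suc.prems
    by (auto intro!: pot_mono admissible_cont source_cont flux_integrable_cont)
qed simp

lemma iter_Suc_mono: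
  assumes "0 \<le> lam" "0 \<le> r" "r \<le> R"
  shows "iter lam k r \<le> iter lam (Suc k) r"
  using assms(2,3)
proof (induction k arbitrary: r)
  case 0
  then show ?case using iter_nonneg[of lam r 1] assms by simp
next
  case (Suc k)
  have "lam * f (iter lam k t) \<le> lam * f (iter lam (Suc k) t)" if "0 < t" "t \<le> R" for t
    using Suc.IH[of t] that assms iter_nonneg[of lam t k] by (intro mult_left_mono f_mono) auto
  then have "pot (\<lambda>r. lam * f (iter lam k r)) r \<le> pot (\<lambda>r. lam * f (iter lam (Suc k) r)) r"
    using assms Suc.prems by (intro pot_mono admissible_cont source_cont flux_integrable_cont)
  then show ?case by simp
qed

text \<open>\<open>V\<close> may be singular: the statement applies to the bounded supersolution
  below \<open>lamS\<close> as well as to \<open>U\<close> itself up to and including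
  \<open>lamS\<close>.\<close>

lemma iter_le_radial_super:
  assumes "0 \<le> lam" "radial_super (\<lambda>r. lam * f (V r)) V" "\<And>r. 0 < r \<Longrightarrow> r \<le> R \<Longrightarrow> 0 \<le> V r"
    and "0 < r" "r \<le> R"
  shows "iter lam k r \<le> V r"
  using assms(4,5)
proof (induction k arbitrary: r)
  case (Suc k)
  have "pot (\<lambda>r. lam * f (iter lam k r)) r \<le> V r"
  proof (rule pot_le_radial_super[OF assms(2)])
    show "continuous_on {0<..R} (\<lambda>r. lam * f (iter lam k r))"
      by (rule continuous_on_subset[OF source_cont]) (use assms in auto)
    show "lam * f (iter lam k t) \<le> lam * f (V t)" if "0 < t" "t < R" for t
      using Suc.IH[of t] that assms iter_nonneg[of lam t k] by (intro mult_left_mono f_mono) auto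
  qed (use Suc.prems assms admissible_cont source_cont in auto)
  then show ?case by simp
qed (use assms in auto)

lemma radial_super_U:
  assumes "0 \<le> lam" "lam \<le> lamS"
  shows "radial_super (\<lambda>r. lam * f (U r)) U"
  unfolding radial_super_def
proof (intro exI conjI allI impI)
  fix r assume r: "0 < r \<and> r < R"
  show "(U has_real_derivative U' r) (at r)" using U_deriv r by simp
  show "((\<lambda>r. wt r * U' r) has_real_derivative - (lamS * (wt r * f (U r)))) (at r)" using U_eq r by simp
  have "lam * (wt r * f (U r)) \<le> lamS * (wt r * f (U r))"
    using assms wt_pos[of r] r f_pos[OF U_nonneg[of r]] by (intro mult_right_mono) auto
  then show "- (lamS * (wt r * f (U r))) \<le> - (wt r * (lam * f (U r)))" by (simp add: mult_ac)
qed (use U_cont U_R U_flux_0 in auto)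

lemma iter_le_U: "0 \<le> lam \<Longrightarrow> lam \<le> lamS \<Longrightarrow> 0 < r \<Longrightarrow> r \<le> R \<Longrightarrow> iter lam k r \<le> U r"
  by (rule iter_le_radial_super[OF _ radial_super_U]) (auto intro: U_nonneg)

lemma iter_bounded:
  assumes "0 < lam" "lam < lamS"
  obtains M where "\<And>k r. 0 \<le> r \<Longrightarrow> r \<le> R \<Longrightarrow> iter lam k r \<le> M"
proof -
  obtain V M where V: "radial_super (\<lambda>r. lam * f (V r)) V"
    "\<And>r. 0 < r \<Longrightarrow> r \<le> R \<Longrightarrow> 0 \<le> V r" "\<And>r. 0 < r \<Longrightarrow> r \<le> R \<Longrightarrow> V r \<le> M"
    using bounded_radial_super[OF assms] by blast
  have pos: "iter lam k r \<le> M" if "0 < r" "r \<le> R" for k r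
    using iter_le_radial_super[OF _ V(1,2), of r k] V(3)[of r] assms that by force
  \<comment> \<open>A radial supersolution controls only r > 0; continuity of the iterate carries
    the bound to the centre.\<close>
  have "iter lam k 0 \<le> M" for k
  proof (rule tendsto_upperbound)
    show "(iter lam k \<longlongrightarrow> iter lam k 0) (at_right 0)"
      using iter_cont[of lam k] assms R0
      by (auto simp: continuous_on_def at_within_Icc_at_right dest: bspec[of _ _ 0])
    show "\<forall>\<^sub>F r in at_right 0. iter lam k r \<le> M"
      using pos R0 by (auto intro!: eventually_at_rightI[of 0 R])
  qed simp
  with pos show ?thesis by (metis that less_eq_real_def)
qed

text \<open>A real supremum has this meaning only when the iterates are bounded at r. For
  \<open>lam = lamS\<close> the bound is \<open>U r\<close>, hence the facts that include
  \<open>lamS\<close> are stated for r > 0.\<close>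

definition sol :: "real \<Rightarrow> real \<Rightarrow> real" where "sol lam r = (SUP k. iter lam k r)"

lemma iter_tendsto_sol:
  assumes "0 \<le> lam" "0 \<le> r" "r \<le> R" "\<And>k. iter lam k r \<le> B"
  shows "(\<lambda>k. iter lam k r) \<longlonglongrightarrow> sol lam r"
  unfolding sol_def
  by (rule LIMSEQ_incseq_SUP)
    (use assms iter_Suc_mono in \<open>auto intro!: bdd_aboveI2 incseq_SucI simp del: iter.simps\<close>)

lemma f_tendsto: "(v \<longlongrightarrow> l) F \<Longrightarrow> 0 \<le> l \<Longrightarrow> ((\<lambda>x. f (v x)) \<longlongrightarrow> f l) F"
  by (rule isCont_tendsto_compose[OF DERIV_isCont[OF f_deriv]])

lemma sol_bounded:
  assumes lam: "0 < lam" "lam < lamS"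
  obtains M where "\<And>r. 0 \<le> r \<Longrightarrow> r \<le> R \<Longrightarrow> (\<lambda>k. iter lam k r) \<longlonglongrightarrow> sol lam r"
    "\<And>r. 0 \<le> r \<Longrightarrow> r \<le> R \<Longrightarrow> 0 \<le> sol lam r" "\<And>r. 0 \<le> r \<Longrightarrow> r \<le> R \<Longrightarrow> sol lam r \<le> M"
    "\<And>k r. 0 \<le> r \<Longrightarrow> r \<le> R \<Longrightarrow> iter lam k r \<le> M"
proof -
  obtain M where M: "\<And>k r. 0 \<le> r \<Longrightarrow> r \<le> R \<Longrightarrow> iter lam k r \<le> M"
    using iter_bounded[OF lam] by blast
  have lim: "(\<lambda>k. iter lam k r) \<longlonglongrightarrow> sol lam r" if "0 \<le> r" "r \<le> R" for r
    by (rule iter_tendsto_sol) (use that M lam in auto)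
  show ?thesis
  proof (rule that[OF lim _ _ M])
    fix r assume r: "0 \<le> r" "r \<le> R"
    show "0 \<le> sol lam r" by (rule LIMSEQ_le_const[OF lim[OF r]]) (use iter_nonneg r lam in auto)
    show "sol lam r \<le> M" by (rule LIMSEQ_le_const2[OF lim[OF r]]) (use M r in auto)
  qed
qed

lemma sol_eq_and_cont:
  assumes lam: "0 < lam" "lam < lamS"
  shows sol_cont: "continuous_on {0..R} (sol lam)"
    and sol_eq: "\<And>r. 0 \<le> r \<Longrightarrow> r \<le> R \<Longrightarrow> sol lam r = pot (\<lambda>r. lam * f (sol lam r)) r"
proof -
  obtain M where M: "\<And>r. 0 \<le> r \<Longrightarrow> r \<le> R \<Longrightarrow> (\<lambda>k. iter lam k r) \<longlonglongrightarrow> sol lam r"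
    "\<And>r. 0 \<le> r \<Longrightarrow> r \<le> R \<Longrightarrow> 0 \<le> sol lam r" "\<And>r. 0 \<le> r \<Longrightarrow> r \<le> R \<Longrightarrow> sol lam r \<le> M"
    "\<And>k r. 0 \<le> r \<Longrightarrow> r \<le> R \<Longrightarrow> iter lam k r \<le> M"
    using sol_bounded[OF lam] by blast
  have dom: "\<bar>lam * f (iter lam k t)\<bar> \<le> lam * f M" if "0 < t" "t \<le> R" for k t
    using f_mono[of "iter lam k t" M] f_pos[of "iter lam k t"] iter_nonneg[of lam t k] M(4)[of t k] that lam
    by (simp add: abs_mult)
  note lim = pot_tendsto[where G="\<lambda>_. lam * f M" and g="\<lambda>k r. lam * f (iter lam k r)" and h="\<lambda>r. lam * f (sol lam r)",
      OF _ _ admissible_cont flux_integrable_cont admissible_cont flux_integrable_cont dom]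
  have l: "(\<lambda>k. lam * f (iter lam k t)) \<longlonglongrightarrow> lam * f (sol lam t)" if "0 < t" "t \<le> R" for t
    using M(1,2)[of t] that by (intro tendsto_intros f_tendsto) auto
  have eq: "sol lam r = pot (\<lambda>r. lam * f (sol lam r)) r" if r: "0 \<le> r" "r \<le> R" for r
  proof (rule LIMSEQ_unique)
    show "(\<lambda>k. iter lam (Suc k) r) \<longlonglongrightarrow> sol lam r" by (rule LIMSEQ_Suc[OF M(1)[OF r]])
    show "(\<lambda>k. iter lam (Suc k) r) \<longlonglongrightarrow> pot (\<lambda>r. lam * f (sol lam r)) r"
      using lim(2)[OF r] lam r l source_cont[of lam] by simp
  qed
  then show "\<And>r. 0 \<le> r \<Longrightarrow> r \<le> R \<Longrightarrow> sol lam r = pot (\<lambda>r. lam * f (sol lam r)) r" .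
  have adm: "admissible (\<lambda>r. lam * f (sol lam r))"
    using lim(1)[of 0] R0 lam l source_cont[of lam] by simp
  have "continuous_on {0..R} (pot (\<lambda>r. lam * f (sol lam r)))"
  proof (rule pot_cont[OF adm])
    fix t assume "0 \<le> t" "t \<le> R"
    then show "\<bar>lam * f (sol lam t)\<bar> \<le> lam * f M"
      using f_mono[of "sol lam t" M] f_pos[of "sol lam t"] M(2,3)[of t] lam by (simp add: abs_mult)
  qed
  then show "continuous_on {0..R} (sol lam)"
    by (rule continuous_on_eq) (use eq in auto)
qed

lemma sol_le_U:
  assumes "0 < lam" "lam \<le> lamS" "0 < r" "r \<le> R"
  shows "(\<lambda>k. iter lam k r) \<longlonglongrightarrow> sol lam r" "0 \<le> sol lam r" "sol lam r \<le> U r"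
proof -
  show lim: "(\<lambda>k. iter lam k r) \<longlonglongrightarrow> sol lam r"
    using iter_le_U[of lam r] assms by (intro iter_tendsto_sol) auto
  show "0 \<le> sol lam r" by (rule LIMSEQ_le_const[OF lim]) (use iter_nonneg assms in auto)
  show "sol lam r \<le> U r" by (rule LIMSEQ_le_const2[OF lim]) (use iter_le_U assms in auto)
qed

lemma sol_mono: "0 < lam \<Longrightarrow> lam \<le> mu \<Longrightarrow> mu \<le> lamS \<Longrightarrow> 0 < r \<Longrightarrow> r \<le> R \<Longrightarrow> sol lam r \<le> sol mu r"
  by (rule LIMSEQ_le[OF sol_le_U(1) sol_le_U(1)]) (auto intro!: exI[of _ 0] iter_mono)

text \<open>Shared by two limits: iterates at the fixed parameter \<open>lamS\<close>, and solutions
  for parameters increasing to it. The majorant \<open>lamS * f (U r)\<close> has an integrable flux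
  only away from 0, so one passes to the limit at each r > 0; the result is a fixed point between 0
  and \<open>U\<close>, to which uniqueness applies.\<close>

lemma limit_eq_U:
  fixes g :: "nat \<Rightarrow> real \<Rightarrow> real"
  assumes g: "\<And>k. continuous_on {0..R} (g k)" "\<And>k r. 0 < r \<Longrightarrow> r \<le> R \<Longrightarrow> 0 \<le> g k r"
      "\<And>k r. 0 < r \<Longrightarrow> r \<le> R \<Longrightarrow> g k r \<le> lamS * f (U r)"
    and lim: "\<And>r. 0 < r \<Longrightarrow> r \<le> R \<Longrightarrow> (\<lambda>k. pot (g k) r) \<longlonglongrightarrow> v r"
      "\<And>r. 0 < r \<Longrightarrow> r \<le> R \<Longrightarrow> (\<lambda>k. g k r) \<longlonglongrightarrow> lamS * f (v r)"
    and v: "\<And>r. 0 < r \<Longrightarrow> r \<le> R \<Longrightarrow> 0 \<le> v r" "\<And>r. 0 < r \<Longrightarrow> r \<le> R \<Longrightarrow> v r \<le> U r"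
    and r: "0 < r" "r \<le> R"
  shows "v r = U r"
proof (rule singular_solution_unique[OF v _ _ r])
  have adm: "admissible (\<lambda>r. lamS * f (U r))" by (rule admissible_scale[OF admissible_fU])
  have dom: "\<bar>g k t\<bar> \<le> lamS * f (U t)" if "0 < t" "t \<le> R" for k t using g(2,3)[OF that, of k] by simp
  note P = pot_tendsto[OF _ _ adm integrable_continuous_real[OF flux_cont_pos[OF adm]] admissible_cont[OF g(1)]
      flux_integrable_cont[OF g(1)] dom lim(2)]
  show "admissible (\<lambda>r. lamS * f (v r))" by (rule P(1)[of R]) (use R0 in auto)
  fix t assume t: "0 < t" "t \<le> R"
  show "v t = pot (\<lambda>r. lamS * f (v r)) t"
    by (rule LIMSEQ_unique[OF lim(1)[OF t] P(2)]) (use t in auto)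
qed

lemma sol_lamS:
  assumes "0 < r" "r \<le> R"
  shows "sol lamS r = U r"
proof (rule limit_eq_U[where g="\<lambda>k r. lamS * f (iter lamS k r)", OF _ _ _ _ _ _ _ assms])
  fix k r assume r: "0 < r" "r \<le> R"
  show "0 \<le> lamS * f (iter lamS k r)"
    using f_pos[OF iter_nonneg[of lamS r k]] lamS_pos r by simp
  show "lamS * f (iter lamS k r) \<le> lamS * f (U r)"
    using f_mono[OF iter_nonneg[of lamS r k]] iter_le_U[of lamS r k] lamS_pos r by simp
  show "(\<lambda>k. pot (\<lambda>r. lamS * f (iter lamS k r)) r) \<longlonglongrightarrow> sol lamS r"
    using LIMSEQ_Suc[OF sol_le_U(1)[of lamS r]] lamS_pos r by simp
  show "(\<lambda>k. lamS * f (iter lamS k r)) \<longlonglongrightarrow> lamS * f (sol lamS r)"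
    using sol_le_U[of lamS r] lamS_pos r by (intro tendsto_intros f_tendsto) auto
qed (use sol_le_U[of lamS] lamS_pos source_cont[of lamS] in auto)

lemma sol_tendsto_U:
  assumes r: "0 < r" "r \<le> R"
  shows "((\<lambda>lam. sol lam r) \<longlongrightarrow> U r) (at_left lamS)"
proof -
  \<comment> \<open>The shift by 2 keeps \<open>l 0\<close> positive.\<close>
  define l where "l k = lamS * (1 - 1 / real (k + 2))" for k
  have l: "0 < l k" "l k < lamS" for k using lamS_pos by (auto simp: l_def)
  have l_mono: "l k \<le> l (Suc k)" for k using lamS_pos by (auto simp: l_def frac_le)
  have l_lim: "l \<longlonglongrightarrow> lamS" unfolding l_def by real_asymp
  define v where "v r = (SUP k. sol (l k) r)" for r
  have lim: "(\<lambda>k. sol (l k) r) \<longlonglongrightarrow> v r" if "0 < r" "r \<le> R" for r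
    unfolding v_def using sol_le_U(3)[OF l(1) _ that] l l_mono that
    by (intro LIMSEQ_incseq_SUP incseq_SucI sol_mono bdd_aboveI2) (auto intro: less_imp_le)
  have v: "0 \<le> v r" "v r \<le> U r" if "0 < r" "r \<le> R" for r
    using LIMSEQ_le_const[OF lim[OF that]] LIMSEQ_le_const2[OF lim[OF that]] sol_le_U[OF l(1) less_imp_le[OF l(2)] that] by blast+
  have vU: "v r = U r" if "0 < r" "r \<le> R" for r
  proof (rule limit_eq_U[where g="\<lambda>k r. l k * f (sol (l k) r)", OF _ _ _ _ _ v that])
    fix k
    obtain M where M: "\<And>r. 0 \<le> r \<Longrightarrow> r \<le> R \<Longrightarrow> 0 \<le> sol (l k) r" using sol_bounded[OF l] by metis
    show "continuous_on {0..R} (\<lambda>r. l k * f (sol (l k) r))"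
      by (intro continuous_intros f_compose_cont sol_cont l) (use M in auto)
    fix r assume r: "0 < r" "r \<le> R"
    note s = sol_le_U[OF l(1)[of k] less_imp_le[OF l(2)] r]
    show "0 \<le> l k * f (sol (l k) r)" using l(1)[of k] f_pos[OF s(2)] by simp
    show "l k * f (sol (l k) r) \<le> lamS * f (U r)"
      using l[of k] f_mono[OF s(2,3)] f_pos[OF s(2)] by (intro mult_mono) auto
  next
    fix r assume r: "0 < r" "r \<le> R"
    show "(\<lambda>k. pot (\<lambda>r. l k * f (sol (l k) r)) r) \<longlonglongrightarrow> v r"
      using lim[OF r] by (subst (asm) sol_eq[OF l]) (use r in auto)
    show "(\<lambda>k. l k * f (sol (l k) r)) \<longlonglongrightarrow> lamS * f (v r)"
      by (intro tendsto_mult l_lim f_tendsto lim v r)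
  qed
  show ?thesis
  proof (rule order_tendstoI)
    fix a assume "a < U r"
    then have "\<forall>\<^sub>F k in sequentially. a < sol (l k) r"
      using order_tendstoD(1)[OF lim[OF r]] vU[OF r] by simp
    then obtain k where k: "a < sol (l k) r" by (auto simp: eventually_sequentially)
    \<comment> \<open>Monotonicity in the parameter upgrades the limit along \<open>l\<close> to the
      full left limit.\<close>
    show "\<forall>\<^sub>F lam in at_left lamS. a < sol lam r"
    proof (rule eventually_at_leftI[of "l k"])
      fix lam assume "lam \<in> {l k<..<lamS}"
      then show "a < sol lam r" using k sol_mono[of "l k" lam r] l r by force
    qed (rule l)
  next
    fix a assume "U r < a"
    show "\<forall>\<^sub>F lam in at_left lamS. sol lam r < a"
    proof (rule eventually_at_leftI[of 0])
      fix lam assume "lam \<in> {0<..<lamS}"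
      then show "sol lam r < a" using \<open>U r < a\<close> sol_le_U(3)[of lam r] r by force
    qed (rule lamS_pos)
  qed
qed

text \<open>This comparison makes the radial limit minimal among all supersolutions, radial or
  not.\<close>

lemma iter_le_classical_super:
  fixes w :: "real^'n \<Rightarrow> real"
  assumes card: "CARD('n) = n" and lam: "0 \<le> lam" and w: "classical_super lam f R w"
    and x: "x \<in> cball 0 R"
  shows "iter lam k (norm x) \<le> w x"
  using x
proof (induction k arbitrary: x)
  case 0
  then show ?case using w by (auto simp: classical_super_def)
next
  case (Suc k)
  let ?g = "\<lambda>r. lam * f (iter lam k r)"
  \<comment> \<open>Lowering the source makes the differential inequality strict for each j; the
    potentials converge as j grows.\<close>
  define g where "g j r = ?g r - 1 / real (Suc j)" for j r
  have gc: "continuous_on {0..R} (g j)" for j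
    unfolding g_def[abs_def] by (intro continuous_intros source_cont lam)
  obtain C where C: "\<And>t. 0 \<le> t \<Longrightarrow> t \<le> R \<Longrightarrow> \<bar>?g t\<bar> \<le> C"
    using bounded_of_cont[OF source_cont[OF lam]] by blast
  have le: "pot (g j) (norm x) \<le> w x" for j
  proof (rule strict_comparison[where R=R and p="\<lambda>x. pot (g j) (norm x)"])
    show "C2_on (ball 0 R) (\<lambda>x::real^'n. pot (g j) (norm x))"
      "continuous_on (cball 0 R) (\<lambda>x::real^'n. pot (g j) (norm x))"
      by (rule pot_C2[OF card gc] pot_cont_cball[OF card gc])+
    fix y :: "real^'n" assume y: "y \<in> ball 0 R"
    have "?g (norm y) \<le> lam * f (w y)"
      using Suc.IH[of y] y lam iter_nonneg[of lam "norm y" k] by (intro mult_left_mono f_mono) auto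
    also have "\<dots> \<le> - LB w y" using w y by (auto simp: classical_super_def)
    finally have "LB w y < - g j (norm y)"
      using divide_pos_pos[of 1 "real (Suc j)"] unfolding g_def by linarith
    then show "LB w y < LB (\<lambda>x. pot (g j) (norm x)) y" using LB_pot[OF card gc y] by simp
  next
    fix y :: "real^'n" assume "y \<in> sphere 0 R"
    then show "pot (g j) (norm y) \<le> w y" using w by (auto simp: classical_super_def pot_R)
  qed (use R0 Rpi w Suc.prems in \<open>auto simp: classical_super_def\<close>)
  have "(\<lambda>j. pot (g j) (norm x)) \<longlonglongrightarrow> pot ?g (norm x)"
  proof (rule pot_tendsto(2)[where G="\<lambda>_. C + 1"])
    fix j t assume t: "0 < t" "t \<le> R"
    have "\<bar>g j t\<bar> \<le> \<bar>?g t\<bar> + \<bar>1 / real (Suc j)\<bar>" unfolding g_def by (rule abs_triangle_ineq4)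
    also have "\<bar>1 / real (Suc j)\<bar> \<le> 1" by simp
    finally show "\<bar>g j t\<bar> \<le> C + 1" using C[of t] t by simp
    have "(\<lambda>j. ?g t - 1 / real (Suc j)) \<longlonglongrightarrow> ?g t - 0"
      by (intro tendsto_intros LIMSEQ_Suc[OF lim_1_over_n])
    then show "(\<lambda>j. g j t) \<longlonglongrightarrow> ?g t" by (simp add: g_def)
  qed (use Suc.prems in \<open>auto intro!: admissible_cont flux_integrable_cont gc\<close>)
  then show ?case using le by (auto intro: LIMSEQ_le_const2)
qed

section \<open>Minimal classical solutions, nonexistence and the extremal values\<close>

lemma pot_pos:
  assumes g: "continuous_on {0..R} g" "\<And>t. 0 \<le> t \<Longrightarrow> t \<le> R \<Longrightarrow> 0 < g t" and r: "0 \<le> r" "r < R"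
  shows "0 < pot g r"
proof -
  have adm: "admissible g" by (rule admissible_cont[OF g(1)])
  have gc: "continuous_on {0<..R} g" by (rule continuous_on_subset[OF g(1)]) auto
  obtain C where C: "\<And>t. 0 \<le> t \<Longrightarrow> t \<le> R \<Longrightarrow> \<bar>g t\<bar> \<le> C" using bounded_of_cont[OF g(1)] by blast
  have m: "0 < mass g t" if t: "0 < t" "t < R" for t
  proof -
    have "mass g 0 < mass g t"
    proof (rule DERIV_pos_imp_increasing_open[OF t(1)])
      fix y assume y: "0 < y" "y < t"
      show "\<exists>z. (mass g has_real_derivative z) (at y) \<and> 0 < z"
        using mass_deriv[OF adm gc, of y] wt_pos[of y] g(2)[of y] y t
        by (intro exI[of _ "wt y * g y"]) auto
    qed (use t in \<open>auto intro: continuous_on_subset[OF mass_cont[OF adm]]\<close>)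
    then show ?thesis by (simp add: mass_0)
  qed
  have "pot g R < pot g r"
  proof (rule DERIV_neg_imp_decreasing_open[OF r(2)])
    fix y assume y: "r < y" "y < R"
    show "\<exists>z. (pot g has_real_derivative z) (at y) \<and> z < 0"
      using pot_deriv[OF adm, of y] wt_pos[of y] m[of y] y r
      by (intro exI[of _ "- flux g y"]) (auto simp: flux_def)
  qed (use r in \<open>auto intro: continuous_on_subset[OF pot_cont[OF adm C]]\<close>)
  then show ?thesis by (simp add: pot_R)
qed

lemma minimal_sol_exists:
  assumes card: "CARD('n) = n" and lam: "0 < lam" "lam < lamS"
  obtains u :: "real^'n \<Rightarrow> real" where "minimal_sol lam f R u" "\<And>x. x \<in> cball 0 R \<Longrightarrow> u x = sol lam (norm x)"
proof -
  let ?g = "\<lambda>r. lam * f (sol lam r)"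
  \<comment> \<open>Written as a potential, the candidate gets its regularity and its equation from
    \<open>pot_radial\<close>; it agrees with \<open>sol\<close> on the closed ball.\<close>
  let ?u = "\<lambda>x::real^'n. pot ?g (norm x)"
  obtain M where M: "\<And>r. 0 \<le> r \<Longrightarrow> r \<le> R \<Longrightarrow> (\<lambda>k. iter lam k r) \<longlonglongrightarrow> sol lam r"
    "\<And>r. 0 \<le> r \<Longrightarrow> r \<le> R \<Longrightarrow> 0 \<le> sol lam r" using sol_bounded[OF lam] by metis
  have gc: "continuous_on {0..R} ?g"
    by (intro continuous_intros f_compose_cont sol_cont lam) (use M in auto)
  have gp: "0 < ?g t" if "0 \<le> t" "t \<le> R" for t using f_pos[OF M(2)[OF that]] lam by simp
  have u: "?u x = sol lam (norm x)" if "x \<in> cball 0 R" for x using sol_eq[OF lam, of "norm x"] that by simp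
  have "classical_sol lam f R ?u"
    unfolding classical_sol_def
  proof (intro conjI ballI)
    fix x :: "real^'n" assume x: "x \<in> ball 0 R"
    show "- LB ?u x = lam * f (?u x)" using LB_pot[OF card gc x] u[of x] x by simp
    show "0 < ?u x" using pot_pos[OF gc gp, of "norm x"] x by simp
  qed (use pot_C2[OF card gc] pot_cont_cball[OF card gc] in \<open>auto simp: pot_R\<close>)
  moreover have "?u x \<le> w x" if w: "classical_super lam f R w" and x: "x \<in> cball 0 R" for w x
    unfolding u[OF x]
    by (rule LIMSEQ_le_const2[OF M(1)]) (use iter_le_classical_super[OF card _ w x] lam x in auto)
  ultimately have "minimal_sol lam f R ?u" by (auto simp: minimal_sol_def)
  then show ?thesis using u by (rule that)
qed

text \<open>A classical solution is also a supersolution, so two minimal solutions lie below each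
  other; this uniqueness makes the \<open>THE\<close> in \<open>u_min\<close> meaningful.\<close>

lemma u_min_eq_sol:
  fixes x :: "real^'n"
  assumes card: "CARD('n) = n" and lam: "0 < lam" "lam < lamS" and x: "x \<in> cball 0 R"
  shows "u_min lam f R x = sol lam (norm x)"
proof -
  have super: "classical_super lam f R v" if "classical_sol lam f R v" for v :: "real^'n \<Rightarrow> real"
    using that by (auto simp: classical_sol_def classical_super_def order_le_less)
  obtain u :: "real^'n \<Rightarrow> real" where u: "minimal_sol lam f R u" "\<And>x. x \<in> cball 0 R \<Longrightarrow> u x = sol lam (norm x)"
    using minimal_sol_exists[OF card lam] by blast
  have eq: "v x = u x" if "minimal_sol lam f R v" for v
  proof (rule order_antisym)
    show "v x \<le> u x" using that super[of u] u(1) x by (simp add: minimal_sol_def)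
    show "u x \<le> v x" using that super[of v] u(1) x by (simp add: minimal_sol_def)
  qed
  have "u_min lam f R x = u x"
    unfolding u_min_def
  proof (rule the_equality)
    show "\<exists>v. minimal_sol lam f R v \<and> v x = u x" using u(1) by blast
    show "t = u x" if "\<exists>v. minimal_sol lam f R v \<and> v x = t" for t using eq that by blast
  qed
  then show ?thesis by (simp add: u(2)[OF x])
qed

lemma no_classical_sol:
  fixes u :: "real^'n \<Rightarrow> real"
  assumes card: "CARD('n) = n" and lam: "lamS < lam"
  shows "\<not> classical_sol lam f R u"
proof
  assume u: "classical_sol lam f R u"
  have nn: "0 \<le> u x" if "x \<in> cball 0 R" for x
    using u that by (auto simp: classical_sol_def order_le_less)
  \<comment> \<open>Since f is positive, a solution for a larger parameter is a supersolution for
    \<open>lamS\<close>, and it is bounded because it is continuous on the closed ball.\<close>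
  have "lamS * f (u x) \<le> - LB u x" if x: "x \<in> ball 0 R" for x
  proof -
    have "lamS * f (u x) \<le> lam * f (u x)"
      using lam f_pos[OF nn[of x]] x by (intro mult_right_mono) auto
    then show ?thesis using u x by (simp add: classical_sol_def)
  qed
  then have super: "classical_super lamS f R u"
    using u nn by (auto simp: classical_super_def classical_sol_def)
  have "compact (u ` cball 0 R)"
    using u by (intro compact_continuous_image) (auto simp: classical_sol_def)
  then have "bdd_above (u ` cball 0 R)" by (intro bounded_imp_bdd_above compact_imp_bounded)
  then obtain M where M: "\<And>x. x \<in> cball 0 R \<Longrightarrow> u x \<le> M" unfolding bdd_above_def by blast
  have UM: "U r \<le> M" if r: "0 < r" "r \<le> R" for r
  proof -
    fix i :: 'n
    \<comment> \<open>A point at distance r from the centre: the bound on \<open>u\<close> becomes a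
      bound on the radial iterates there.\<close>
    let ?x = "r *\<^sub>R axis i 1 :: real^'n"
    have x: "norm ?x = r" "?x \<in> cball 0 R" using r by auto
    have "iter lamS k r \<le> M" for k
      using iter_le_classical_super[OF card less_imp_le[OF lamS_pos] super x(2), of k] M[OF x(2)] x(1) by simp
    then have "sol lamS r \<le> M"
      using LIMSEQ_le_const2[OF sol_le_U(1)[OF lamS_pos order_refl r]] by blast
    then show ?thesis using sol_lamS[OF r] by simp
  qed
  have "\<forall>\<^sub>F r in at_right 0. M < U r"
    using U_top by (simp add: filterlim_at_top_dense)
  moreover have "\<forall>\<^sub>F r in at_right 0. U r \<le> M"
    using UM R0 by (auto intro!: eventually_at_rightI[of 0 R])
  ultimately have "\<forall>\<^sub>F r in at_right (0::real). False" by eventually_elim simp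
  then show False by (simp add: trivial_limit_at_right_real)
qed

theorem extremal_parameter:
  assumes card: "CARD('n::finite) = n"
  shows "lam_star TYPE('n) f R = lamS"
  unfolding lam_star_def
proof (rule cSup_eq_non_empty)
  have ex: "\<exists>u::real^'n \<Rightarrow> real. classical_sol lam f R u" if "0 < lam" "lam < lamS" for lam
    using minimal_sol_exists[OF card that] by (metis minimal_sol_def)
  show "{lam. lam > 0 \<and> (\<exists>u::real^'n \<Rightarrow> real. classical_sol lam f R u)} \<noteq> {}"
    using ex[of "lamS/2"] lamS_pos by (auto intro!: exI[of _ "lamS/2"])
  show "x \<le> lamS" if "x \<in> {lam. lam > 0 \<and> (\<exists>u::real^'n \<Rightarrow> real. classical_sol lam f R u)}" for x
    using no_classical_sol[OF card, of x] that by force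
  show "lamS \<le> y" if "\<And>x. x \<in> {lam. lam > 0 \<and> (\<exists>u::real^'n \<Rightarrow> real. classical_sol lam f R u)} \<Longrightarrow> x \<le> y" for y
    by (rule dense_le_bounded[OF lamS_pos]) (use that ex in auto)
qed

theorem extremal_solution:
  fixes x :: "real^'n"
  assumes card: "CARD('n) = n" and x: "0 < norm x" "norm x < R"
  shows "((\<lambda>lam. u_min lam f R x) \<longlongrightarrow> U (norm x)) (at_left (lam_star TYPE('n) f R))"
  unfolding extremal_parameter[OF card]
proof (rule Lim_transform_eventually[OF sol_tendsto_U])
  show "\<forall>\<^sub>F lam in at_left lamS. sol lam (norm x) = u_min lam f R x"
    by (rule eventually_at_leftI[OF _ lamS_pos]) (use u_min_eq_sol[OF card] x in auto)
qed (use x in auto)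

end

section \<open>The Hardy supersolution\<close>

text \<open>The quotient defining \<open>R0\<close> equals (1 + cos s)/(1 - cos s), which decreases
  in s, so an admissible s beyond \<open>R\<close> gives the inequality at \<open>R\<close>.\<close>

lemma less_R0_bound:
  assumes n: "2 \<le> n" and R: "0 < R" "R < pi / 2" "R < R0 n"
  shows "real n * (real n - 2) < (1 + cos R) / (1 - cos R)"
proof -
  define S where "S = {s. 0 < s \<and> s < pi/2 \<and> (sin s)^2 / (1 - cos s)^2 > real n * (real n - 2)}"
  \<comment> \<open>The divergence at 0 shows that the set is nonempty; without this its supremum
    would carry no information.\<close>
  have "filterlim (\<lambda>s::real. (sin s)^2 / (1 - cos s)^2) at_top (at_right 0)" by real_asymp
  then have "\<forall>\<^sub>F s in at_right (0::real). real n * (real n - 2) < (sin s)^2 / (1 - cos s)^2"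
    by (simp add: filterlim_at_top_dense)
  moreover have "\<forall>\<^sub>F s in at_right (0::real). 0 < s \<and> s < pi/2"
    by (auto intro!: eventually_at_rightI[of 0 "pi/2"])
  ultimately have "\<forall>\<^sub>F s in at_right (0::real). s \<in> S"
    by eventually_elim (simp add: S_def)
  then have "\<exists>s. s \<in> S"
    by (rule eventually_happens'[rotated]) simp
  then have "S \<noteq> {}" by blast
  moreover have "bdd_above S" by (rule bdd_aboveI[of _ "pi/2"]) (simp add: S_def)
  ultimately obtain s where s: "s \<in> S" "R < s"
    using R(3) less_cSup_iff[of S R] unfolding R0_def S_def[symmetric] by blast
  have cs: "cos s < cos R" "0 < cos s" "cos R < 1" "0 < cos R"
    using s R cos_monotone_0_pi[of R s] cos_monotone_0_pi[of 0 R]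
    by (auto simp: S_def intro!: cos_gt_zero_pi)
  have "(sin s)^2 / (1 - cos s)^2 = (1 + cos s) / (1 - cos s)"
    using cs by (simp add: sin_squared_eq power2_eq_square divide_simps) (simp add: algebra_simps)
  also have "\<dots> < (1 + cos R) / (1 - cos R)" using cs by (intro frac_less) auto
  finally show ?thesis using s by (simp add: S_def)
qed

context sphere_cap
begin

lemma wt_powr: "0 < r \<Longrightarrow> r \<le> R \<Longrightarrow> wt r = sin r powr (real n - 1)"
  using powr_realpow[OF sin_pos, of r "n - 1"] n2 by (simp add: wt_def of_nat_diff)

text \<open>Writing \<open>h = sin(r)^(-(n-2)/2) k\<close> turns \<open>-\<Delta>h \<ge> ((n-2)/2)^2 h / sin(r)^2\<close> into
  \<open>-(sin k')' \<ge> n(n-2)/4 sin k\<close>.  The choice \<open>k' / k = - hc tan(r/2)\<close> reduces this to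
  \<open>hc - hc^2 tan(r/2)^2 \<ge> n(n-2)/4\<close>, and \<open>hc = cot(R/2)^2 / 2\<close> is optimal at \<open>r = R\<close>: this is
  exactly the condition that defines \<open>R0\<close>.\<close>

definition hc :: real where "hc = (1 + cos R) / (1 - cos R) / 2"
definition hardy :: "real \<Rightarrow> real" where
  "hardy r = exp (- ((real n - 2) / 2 * ln (sin r)) + 2 * hc * ln (cos (r / 2)))"
text \<open>The logarithmic derivative of \<open>hardy\<close>; unlike \<open>hardy\<close> it is
  elementary, and all second-order computations are done with it.\<close>

definition hardy_log' :: "real \<Rightarrow> real" where
  "hardy_log' r = - ((real n - 2) / 2 * (cos r / sin r)) - hc * tan (r / 2)"

lemma cos_half_pos: "0 \<le> r \<Longrightarrow> r \<le> R \<Longrightarrow> 0 < cos (r / 2)"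
  using Rpi by (intro cos_gt_zero_pi) auto

lemma cos_R: "0 < cos R" "cos R < 1"
  using R0 Rpi cos_monotone_0_pi[of 0 R] by (auto intro!: cos_gt_zero_pi)

lemma hc_pos: "0 < hc" using cos_R by (simp add: hc_def)

lemma tan_half_sq:
  assumes "0 \<le> r" "r \<le> R"
  shows "(tan (r / 2))\<^sup>2 = (1 - cos r) / (1 + cos r)"
proof -
  have "cos r = 2 * (cos (r / 2))\<^sup>2 - 1" using cos_double_cos[of "r / 2"] by simp
  then show ?thesis using cos_half_pos[OF assms]
    by (simp add: tan_def power_divide sin_squared_eq divide_simps)
qed

lemma hardy_deriv:
  assumes r: "0 < r" "r \<le> R"
  shows "(hardy has_real_derivative hardy r * hardy_log' r) (at r)"
  unfolding hardy_def[abs_def] hardy_log'_def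
  using sin_pos[OF r] cos_half_pos[of r] r
  by (auto intro!: derivative_eq_intros simp: tan_def field_simps)

lemma cot_deriv:
  assumes "0 < r" "r \<le> R"
  shows "((\<lambda>r. cos r / sin r) has_real_derivative - 1 / (sin r)\<^sup>2) (at r)"
proof -
  have "((\<lambda>r. cos r / sin r) has_real_derivative (- sin r * sin r - cos r * cos r) / (sin r * sin r)) (at r)"
    using sin_pos[OF assms] by (auto intro!: derivative_eq_intros)
  moreover have "- sin r * sin r - cos r * cos r = - 1"
    using sin_cos_squared_add[of r] unfolding power2_eq_square by linarith
  ultimately show ?thesis by (simp only: power2_eq_square)
qed

lemma hardy_log'_deriv:
  assumes r: "0 < r" "r \<le> R"
  shows "(hardy_log' has_real_derivative
    (real n - 2) / 2 / (sin r)\<^sup>2 - hc / 2 / (cos (r / 2))\<^sup>2) (at r)"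
proof -
  have tan: "((\<lambda>r. tan (r / 2)) has_real_derivative 1 / (cos (r / 2))\<^sup>2 * (1 / 2)) (at r)"
    by (rule DERIV_chain2[OF DERIV_tan[unfolded inverse_eq_divide]])
      (use cos_half_pos[of r] r in \<open>auto intro!: derivative_eq_intros\<close>)
  show ?thesis unfolding hardy_log'_def[abs_def]
    by (rule DERIV_cong[OF DERIV_diff[OF DERIV_minus[OF DERIV_cmult[OF cot_deriv[OF r]]] DERIV_cmult[OF tan]]]) simp
qed

text \<open>The derivative of the flux \<open>wt * h'\<close>, from h''/h = (h'/h)' +
  (h'/h)^2.\<close>

definition hardy'' :: "real \<Rightarrow> real" where
  "hardy'' r = wt r * hardy r * ((real n - 1) * (cos r / sin r) * hardy_log' r + (hardy_log' r)\<^sup>2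
     + ((real n - 2) / 2 / (sin r)\<^sup>2 - hc / 2 / (cos (r / 2))\<^sup>2))"

lemma hardy_deriv2:
  assumes r: "0 < r" "r \<le> R"
  shows "((\<lambda>r. wt r * (hardy r * hardy_log' r)) has_real_derivative hardy'' r) (at r)"
  using DERIV_mult[OF wt_deriv[OF r] DERIV_mult[OF hardy_deriv[OF r] hardy_log'_deriv[OF r]]]
  by (rule DERIV_cong) (simp add: hardy''_def power2_eq_square algebra_simps)

lemma hardy''_eq:
  assumes r: "0 < r" "r \<le> R"
  shows "hardy'' r = wt r * hardy r *
     (- ((real n - 2) / 2)\<^sup>2 / (sin r)\<^sup>2 + real n * (real n - 2) / 4 - hc + hc\<^sup>2 * (tan (r / 2))\<^sup>2)"
proof -
  define a where "a = (real n - 2) / 2"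
  define k where "k = cos r / sin r"
  define i where "i = 1 / (sin r)\<^sup>2"
  define t where "t = tan (r / 2)"
  define e where "e = 1 / (cos (r / 2))\<^sup>2"
  have sp: "sin r \<noteq> 0" and cp: "cos (r / 2) \<noteq> 0" using sin_pos[OF r] cos_half_pos[of r] r by auto
  have k2: "k\<^sup>2 = i - 1"
    using sp sin_cos_squared_add[of r] by (simp add: k_def i_def field_simps)
  have e: "e = 1 + t\<^sup>2"
    using cp sin_cos_squared_add[of "r / 2"] by (simp add: e_def t_def tan_def field_simps)
  have s2: "sin r = 2 * sin (r / 2) * cos (r / 2)" using sin_double[of "r / 2"] by simp
  have c2: "cos r = (cos (r / 2))\<^sup>2 - (sin (r / 2))\<^sup>2" using cos_double[of "r / 2"] by simp
  \<comment> \<open>By this half-angle identity the cross term is - hc/2 (1 - t^2); with the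
    derivative of the tangent, - hc/2 (1 + t^2), it adds up to the constant - hc.\<close>
  have kt: "2 * (k * t) = 1 - t\<^sup>2"
    using sp cp unfolding k_def t_def tan_def c2 s2 by (simp add: field_simps power2_eq_square)
  have n: "real n = 2 * a + 2" by (simp add: a_def field_simps)
  have "(real n - 1) * k * (- (a * k) - hc * t) + (- (a * k) - hc * t)\<^sup>2 + (a * i - hc / 2 * e)
      = - a\<^sup>2 * i + real n * (real n - 2) / 4 - hc + hc\<^sup>2 * t\<^sup>2"
  proof -
    have "(real n - 1) * k * (- (a * k) - hc * t) + (- (a * k) - hc * t)\<^sup>2 + (a * i - hc / 2 * e)
       = - (a\<^sup>2 + a) * k\<^sup>2 - hc / 2 * (2 * (k * t)) + hc\<^sup>2 * t\<^sup>2 + a * i - hc / 2 * e"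
      unfolding n by (simp add: power2_eq_square algebra_simps)
    also have "\<dots> = - a\<^sup>2 * i + real n * (real n - 2) / 4 - hc + hc\<^sup>2 * t\<^sup>2"
      unfolding k2 kt e n by (simp add: power2_eq_square field_simps)
    finally show ?thesis .
  qed
  then show ?thesis
    unfolding hardy''_def hardy_log'_def a_def[symmetric] k_def[symmetric] t_def[symmetric]
    by (simp add: i_def e_def)
qed

lemma hardy''_le:
  assumes r: "0 < r" "r \<le> R" and bd: "real n * (real n - 2) < (1 + cos R) / (1 - cos R)"
  shows "hardy'' r \<le> - (wt r * hardy r * (((real n - 2) / 2)\<^sup>2 / (sin r)\<^sup>2))"
proof -
  have "(tan (r / 2))\<^sup>2 \<le> (1 - cos R) / (1 + cos R)"
  proof -
    have "cos R \<le> cos r" using cos_monotone_0_pi_le[of r R] r Rpi by auto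
    then show ?thesis using tan_half_sq[of r] r cos_R by (auto intro!: frac_le)
  qed
  also have "\<dots> = 1 / (2 * hc)" using cos_R by (simp add: hc_def divide_simps) (simp add: algebra_simps)
  \<comment> \<open>Half of \<open>hc\<close> absorbs the tangent term; the other half covers
    n(n-2)/4, which is \<open>bd\<close>.\<close>
  finally have "hc\<^sup>2 * (tan (r / 2))\<^sup>2 \<le> hc\<^sup>2 * (1 / (2 * hc))" by (rule mult_left_mono) simp
  also have "\<dots> = hc / 2" using hc_pos by (simp add: power2_eq_square)
  finally have "hc\<^sup>2 * (tan (r / 2))\<^sup>2 \<le> hc / 2" .
  moreover have "2 * (x / 2) = x" for x :: real by simp
  then have "real n * (real n - 2) < 2 * hc" using bd by (simp only: hc_def)
  ultimately have "real n * (real n - 2) / 4 - hc + hc\<^sup>2 * (tan (r / 2))\<^sup>2 \<le> 0" by linarith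
  then have "- ((real n - 2) / 2)\<^sup>2 / (sin r)\<^sup>2 + real n * (real n - 2) / 4 - hc + hc\<^sup>2 * (tan (r / 2))\<^sup>2
     \<le> - (((real n - 2) / 2)\<^sup>2 / (sin r)\<^sup>2)" by simp
  then have "wt r * hardy r * (- ((real n - 2) / 2)\<^sup>2 / (sin r)\<^sup>2 + real n * (real n - 2) / 4 - hc + hc\<^sup>2 * (tan (r / 2))\<^sup>2)
     \<le> wt r * hardy r * - (((real n - 2) / 2)\<^sup>2 / (sin r)\<^sup>2)"
    using wt_pos[OF r] by (intro mult_left_mono) (auto simp: hardy_def)
  then show ?thesis unfolding hardy''_eq[OF r] by simp
qed

text \<open>The exponents add up as (n-1) - (n-2)/2 = n/2, and the cosine factor is at most 1. This
  fixes the decay required of \<open>U'\<close> in the Wronskian.\<close>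

lemma wt_hardy_le:
  assumes r: "0 < r" "r \<le> R"
  shows "wt r * hardy r \<le> sin r powr (real n / 2)"
proof -
  have "ln (cos (r / 2)) \<le> 0" using cos_half_pos[of r] r by simp
  then have "hardy r \<le> exp (- ((real n - 2) / 2 * ln (sin r)))"
    using hc_pos by (simp add: hardy_def mult_nonneg_nonpos)
  also have "\<dots> = sin r powr (- ((real n - 2) / 2))" using sin_pos[OF r] by (simp add: powr_def)
  finally have "wt r * hardy r \<le> sin r powr (real n - 1) * sin r powr (- ((real n - 2) / 2))"
    using wt_pos[OF r] wt_powr[OF r] by (simp add: mult_left_mono)
  also have "\<dots> = sin r powr (real n / 2)" by (simp flip: powr_add add: field_simps)
  finally show ?thesis .
qed

lemma hardy_log'_bound:
  assumes r: "0 < r" "r \<le> R"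
  shows "\<bar>hardy_log' r\<bar> \<le> ((real n - 2) / 2 + hc) / sin r"
proof -
  have s: "0 < sin r" "sin r \<le> 1" using sin_pos[OF r] by auto
  have c: "0 \<le> cos r" "cos r \<le> 1" using r Rpi by (auto intro!: cos_ge_zero)
  have "(tan (r / 2))\<^sup>2 \<le> 1\<^sup>2" using tan_half_sq[of r] r c by simp
  then have "tan (r / 2) \<le> 1" by (rule power2_le_imp_le) simp
  also have "1 \<le> 1 / sin r" using s by simp
  finally have t: "hc * tan (r / 2) \<le> hc * (1 / sin r)"
    using hc_pos by (intro mult_left_mono) auto
  have t0: "0 \<le> tan (r / 2)" using r Rpi by (intro less_imp_le[OF tan_gt_zero]) auto
  have "cos r / sin r \<le> 1 / sin r" using s c by (simp add: divide_right_mono)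
  then have k: "(real n - 2) / 2 * (cos r / sin r) \<le> (real n - 2) / 2 * (1 / sin r)"
    using n2 by (intro mult_left_mono) auto
  have "0 \<le> (real n - 2) / 2 * (cos r / sin r)" "0 \<le> hc * tan (r / 2)"
    using n2 s c t0 hc_pos by auto
  then have "\<bar>hardy_log' r\<bar> = (real n - 2) / 2 * (cos r / sin r) + hc * tan (r / 2)"
    by (simp add: hardy_log'_def)
  also have "\<dots> \<le> (real n - 2) / 2 * (1 / sin r) + hc * (1 / sin r)" using k t by (rule add_mono)
  finally show ?thesis by (simp add: add_divide_distrib)
qed

text \<open>With \<open>hardy\<close> as \<open>h\<close>, the locale reduces to pointwise facts
  about \<open>U\<close>: its equation in non-divergence form, stability against the Hardy
  potential, and two decay rates. The powers n/2 - 1 and n/2 are the sizes of \<open>wt * h'\<close>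
  and \<open>wt * h\<close> near 0.\<close>

lemma singular_solutionI:
  assumes f: "\<And>u. 0 \<le> u \<Longrightarrow> (f has_real_derivative f' u) (at u)"
      "\<And>u v. 0 \<le> u \<Longrightarrow> u \<le> v \<Longrightarrow> f' u \<le> f' v" "0 \<le> f' 0" "0 < f 0"
    and H: "\<And>u. 0 \<le> u \<Longrightarrow> (H has_real_derivative 1 / f u) (at u)" "\<And>u. 0 \<le> u \<Longrightarrow> H u \<le> HB"
    and lamS: "0 < lamS"
    and U: "\<And>r. 0 < r \<Longrightarrow> r \<le> R \<Longrightarrow> (U has_real_derivative U' r) (at r)"
      "\<And>r. 0 < r \<Longrightarrow> r \<le> R \<Longrightarrow> (U' has_real_derivative U'' r) (at r)"
      "\<And>r. 0 < r \<Longrightarrow> r < R \<Longrightarrow> U'' r + (real n - 1) * (cos r / sin r) * U' r = - (lamS * f (U r))"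
      "U R = 0" "\<And>r. 0 < r \<Longrightarrow> r < R \<Longrightarrow> 0 < U r" "filterlim U at_top (at_right 0)"
    and stable: "\<And>r. 0 < r \<Longrightarrow> r < R \<Longrightarrow> lamS * f' (U r) \<le> ((real n - 2) / 2)\<^sup>2 / (sin r)\<^sup>2"
    and lim: "((\<lambda>r. sin r powr (real n / 2 - 1) * U r) \<longlongrightarrow> 0) (at_right 0)"
      "((\<lambda>r. sin r powr (real n / 2) * U' r) \<longlongrightarrow> 0) (at_right 0)"
    and bd: "real n * (real n - 2) < (1 + cos R) / (1 - cos R)"
  shows "singular_solution n R f f' H U U' hardy (\<lambda>r. hardy r * hardy_log' r) hardy'' lamS HB"
proof
  have ev: "\<forall>\<^sub>F r in at_right 0. 0 < r \<and> r < R"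
    using R0 by (auto intro!: eventually_at_rightI[of 0 R])
  show "((\<lambda>r. wt r * U' r) has_real_derivative - (lamS * (wt r * f (U r)))) (at r)" if r: "0 < r" "r < R" for r
  proof -
    have "wt r * ((real n - 1) * (cos r / sin r)) * U' r + U'' r * wt r
        = wt r * (U'' r + (real n - 1) * (cos r / sin r) * U' r)" by (simp add: algebra_simps)
    also have "\<dots> = - (lamS * (wt r * f (U r)))" unfolding U(3)[OF r] by simp
    finally show ?thesis using DERIV_mult[OF wt_deriv U(2), of r] r by simp
  qed
  show "continuous_on {0<..R} U" "continuous_on {0<..R} U'" "continuous_on {0<..R} hardy"
    by (intro continuous_at_imp_continuous_on ballI DERIV_isCont[OF U(1)] DERIV_isCont[OF U(2)]
        DERIV_isCont[OF hardy_deriv]; simp)+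
  show "((\<lambda>r. wt r * U' r) \<longlongrightarrow> 0) (at_right 0)"
  proof (rule Lim_null_comparison[OF _ tendsto_norm_zero[OF lim(2)]])
    show "\<forall>\<^sub>F r in at_right 0. norm (wt r * U' r) \<le> norm (sin r powr (real n / 2) * U' r)"
      using ev
    proof eventually_elim
      fix r assume r: "0 < r \<and> r < R"
      then have "wt r \<le> sin r powr (real n / 2)"
        using wt_powr[of r] sin_pos[of r] n2 by (simp add: powr_mono')
      then show "norm (wt r * U' r) \<le> norm (sin r powr (real n / 2) * U' r)"
        using wt_pos[of r] r by (simp add: abs_mult mult_right_mono)
    qed
  qed
  show "hardy'' r \<le> - (lamS * (wt r * (f' (U r) * hardy r)))" if r: "0 < r" "r < R" for r
  proof -
    have "wt r * hardy r * (lamS * f' (U r)) \<le> wt r * hardy r * (((real n - 2) / 2)\<^sup>2 / (sin r)\<^sup>2)"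
      using stable[OF r] wt_pos[of r] r by (intro mult_left_mono) (auto simp: hardy_def)
    then show ?thesis using hardy''_le[of r, OF _ _ bd] r by (simp add: mult_ac)
  qed
  show "((\<lambda>r. wt r * U' r * hardy r) \<longlongrightarrow> 0) (at_right 0)"
  proof (rule Lim_null_comparison[OF _ tendsto_norm_zero[OF lim(2)]])
    show "\<forall>\<^sub>F r in at_right 0. norm (wt r * U' r * hardy r) \<le> norm (sin r powr (real n / 2) * U' r)"
      using ev
    proof eventually_elim
      fix r assume r: "0 < r \<and> r < R"
      then have "\<bar>wt r * hardy r\<bar> \<le> \<bar>sin r powr (real n / 2)\<bar>"
        using wt_hardy_le[of r] wt_pos[of r] by (simp add: hardy_def)
      then have "\<bar>wt r * hardy r\<bar> * \<bar>U' r\<bar> \<le> \<bar>sin r powr (real n / 2)\<bar> * \<bar>U' r\<bar>"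
        by (rule mult_right_mono) simp
      then show "norm (wt r * U' r * hardy r) \<le> norm (sin r powr (real n / 2) * U' r)"
        by (simp add: abs_mult mult_ac)
    qed
  qed
  let ?C = "(real n - 2) / 2 + hc"
  have "((\<lambda>r. ?C * (sin r powr (real n / 2 - 1) * U r)) \<longlongrightarrow> ?C * 0) (at_right 0)"
    by (intro tendsto_intros lim)
  then have lim': "((\<lambda>r. ?C * (sin r powr (real n / 2 - 1) * U r)) \<longlongrightarrow> 0) (at_right 0)" by simp
  show "((\<lambda>r. U r * (wt r * (hardy r * hardy_log' r))) \<longlongrightarrow> 0) (at_right 0)"
  proof (rule Lim_null_comparison[OF _ tendsto_norm_zero[OF lim']])
    show "\<forall>\<^sub>F r in at_right 0. norm (U r * (wt r * (hardy r * hardy_log' r)))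
        \<le> norm (?C * (sin r powr (real n / 2 - 1) * U r))"
      using ev
    proof eventually_elim
      fix r assume r: "0 < r \<and> r < R"
      then have s: "0 < sin r" using sin_pos by auto
      have C: "0 \<le> ?C" using n2 hc_pos by simp
      have "\<bar>wt r * hardy r\<bar> * \<bar>hardy_log' r\<bar> \<le> sin r powr (real n / 2) * (?C / sin r)"
        using wt_hardy_le[of r] wt_pos[of r] hardy_log'_bound[of r] r
        by (intro mult_mono) (auto simp: hardy_def)
      also have "\<dots> = ?C * sin r powr (real n / 2 - 1)" using s by (simp add: powr_diff)
      finally have "\<bar>wt r * hardy r\<bar> * \<bar>hardy_log' r\<bar> * \<bar>U r\<bar> \<le> ?C * sin r powr (real n / 2 - 1) * \<bar>U r\<bar>"
        by (rule mult_right_mono) simp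
      moreover have "norm (?C * (sin r powr (real n / 2 - 1) * U r)) = ?C * sin r powr (real n / 2 - 1) * \<bar>U r\<bar>"
        using C by (simp add: abs_mult)
      moreover have "norm (U r * (wt r * (hardy r * hardy_log' r))) = \<bar>wt r * hardy r\<bar> * \<bar>hardy_log' r\<bar> * \<bar>U r\<bar>"
        by (simp add: abs_mult mult_ac)
      ultimately show "norm (U r * (wt r * (hardy r * hardy_log' r)))
        \<le> norm (?C * (sin r powr (real n / 2 - 1) * U r))" by (simp only:)
    qed
  qed
qed (use f H lamS U hardy_deriv hardy_deriv2 in \<open>auto simp: hardy_def\<close>)

end

section \<open>The two nonlinearities\<close>

lemma sin_sq_less_of_less_arcsin:
  assumes "0 < R" "0 \<le> q" "q \<le> 1" "R < arcsin (sqrt q)"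
  shows "(sin R)\<^sup>2 < q"
proof -
  have q: "-1 \<le> sqrt q" "sqrt q \<le> 1" using assms by (auto intro: order_trans[of _ 0])
  have le: "arcsin (sqrt q) \<le> pi / 2" using arcsin_ubound[OF q] .
  have "sin R < sin (arcsin (sqrt q))"
    using assms le by (intro sin_monotone_2pi) auto
  then have "sin R < sqrt q" using q by simp
  moreover have "0 \<le> sin R" using assms le pi_gt_zero by (intro sin_ge_zero) auto
  ultimately have "(sin R)\<^sup>2 < (sqrt q)\<^sup>2" by (intro power_strict_mono) auto
  then show ?thesis using assms by simp
qed

lemma sin_powr_tendsto_0: "0 < d \<Longrightarrow> ((\<lambda>r::real. sin r powr d) \<longlongrightarrow> 0) (at_right 0)"
  by real_asymp

context sphere_cap
begin

lemma sin_less_sin_R: "0 < r \<Longrightarrow> r < R \<Longrightarrow> sin r < sin R"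
  using Rpi by (intro sin_monotone_2pi) auto

lemma cot_sq: "0 < r \<Longrightarrow> r \<le> R \<Longrightarrow> (cos r / sin r)\<^sup>2 = 1 / (sin r)\<^sup>2 - 1"
  using sin_pos[of r] sin_cos_squared_add[of r] by (simp add: field_simps)

text \<open>Here exp(U)/sin(R)^2 = 1/sin(r)^2, so the equation becomes an identity between powers of
  the cotangent. The bound on sin R is f(0) > 0. \<open>H\<close> comes from 1/(A e^u - b) =
  e^(-u)/(A - b e^(-u)) with A = 1/sin(R)^2.\<close>

lemma singular_solution_exp:
  assumes n: "10 \<le> n" and R: "R < R0 n" "(sin R)\<^sup>2 < (real n - 2) / (real n - 1)"
  defines "b \<equiv> (real n - 1) / (real n - 2)"
  shows "singular_solution n R (\<lambda>u. exp u / (sin R)\<^sup>2 - b) (\<lambda>u. exp u / (sin R)\<^sup>2)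
    (\<lambda>u. ln (1 / (sin R)\<^sup>2 - b * exp (- u)) / b) (\<lambda>r. - 2 * ln (sin r / sin R)) (\<lambda>r. - 2 * (cos r / sin r))
    hardy (\<lambda>r. hardy r * hardy_log' r) hardy'' (2 * (real n - 2)) (ln (1 / (sin R)\<^sup>2) / b)"
proof (rule singular_solutionI[where U''="\<lambda>r. 2 / (sin r)\<^sup>2"])
  let ?A = "1 / (sin R)\<^sup>2"
  have S: "0 < sin R" using sin_pos R0 by simp
  have b: "0 < b" using n by (simp add: b_def)
  have Ab: "b < ?A" using R(2) n S by (simp add: b_def field_simps)
  have pos: "0 < ?A - b * exp (- u)" if "0 \<le> u" for u
  proof -
    have "b * exp (- u) \<le> b * 1" using b that by (intro mult_left_mono) auto
    then show ?thesis using Ab by simp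
  qed
  have expU: "exp (- 2 * ln (sin r / sin R)) / (sin R)\<^sup>2 = 1 / (sin r)\<^sup>2" if "0 < r" "r \<le> R" for r
  proof -
    have "exp (- 2 * ln (sin r / sin R)) = inverse ((sin r / sin R)\<^sup>2)"
      using sin_pos[OF that] S by (simp add: exp_minus exp_double)
    then show ?thesis using S by (simp add: power_divide)
  qed
  show "((\<lambda>u. exp u / (sin R)\<^sup>2 - b) has_real_derivative exp u / (sin R)\<^sup>2) (at u)" for u
    using DERIV_diff[OF DERIV_cdivide[OF DERIV_exp] DERIV_const] by simp
  show "exp u / (sin R)\<^sup>2 \<le> exp v / (sin R)\<^sup>2" if "u \<le> v" for u v :: real
    using that by (simp add: divide_right_mono)
  show "0 \<le> exp 0 / (sin R)\<^sup>2" by simp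
  show "0 < exp 0 / (sin R)\<^sup>2 - b" using Ab by simp
  show "((\<lambda>u. ln (?A - b * exp (- u)) / b) has_real_derivative 1 / (exp u / (sin R)\<^sup>2 - b)) (at u)"
    if u: "0 \<le> u" for u
  proof -
    have "((\<lambda>u. ln (?A - b * exp (- u)) / b) has_real_derivative
        exp (- u) / (?A - b * exp (- u))) (at u)"
      using pos[OF u] b by (auto intro!: derivative_eq_intros)
    moreover have "exp u / (sin R)\<^sup>2 - b = exp u * (?A - b * exp (- u))"
      by (simp add: right_diff_distrib exp_minus)
    ultimately show ?thesis by (simp add: exp_minus divide_simps)
  qed
  show "ln (?A - b * exp (- u)) / b \<le> ln ?A / b" if "0 \<le> u" for u
    using pos[OF that] b by (intro divide_right_mono ln_mono) auto
  show "0 < 2 * (real n - 2)" using n by simp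
  fix r :: real assume r: "0 < r"
  show "((\<lambda>r. - 2 * ln (sin r / sin R)) has_real_derivative - 2 * (cos r / sin r)) (at r)" if "r \<le> R"
    using sin_pos[OF r that] S by (auto intro!: derivative_eq_intros simp: field_simps)
  show "((\<lambda>r. - 2 * (cos r / sin r)) has_real_derivative 2 / (sin r)\<^sup>2) (at r)" if "r \<le> R"
    using DERIV_cmult[OF cot_deriv[OF r that], of "- 2"] by simp
  assume rR: "r < R"
  have e: "exp (- 2 * ln (sin r / sin R)) / (sin R)\<^sup>2 = 1 / (sin r)\<^sup>2" using expU r rR by simp
  have "2 / (sin r)\<^sup>2 + (real n - 1) * (cos r / sin r) * (- 2 * (cos r / sin r))
     = 2 * (1 / (sin r)\<^sup>2) - 2 * (real n - 1) * (cos r / sin r)\<^sup>2" by (simp add: power2_eq_square)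
  also have "\<dots> = - (2 * (real n - 2) * (1 / (sin r)\<^sup>2)) + 2 * (real n - 1)"
    unfolding cot_sq[OF r less_imp_le[OF rR]] by (simp add: algebra_simps)
  also have "\<dots> = - (2 * (real n - 2) * (1 / (sin r)\<^sup>2 - b))"
  proof -
    have "(real n - 2) * b = real n - 1" using n by (simp add: b_def)
    then show ?thesis by algebra
  qed
  finally show "2 / (sin r)\<^sup>2 + (real n - 1) * (cos r / sin r) * (- 2 * (cos r / sin r))
     = - (2 * (real n - 2) * (exp (- 2 * ln (sin r / sin R)) / (sin R)\<^sup>2 - b))" unfolding e .
  show "0 < - 2 * ln (sin r / sin R)" using sin_less_sin_R[OF r rR] sin_pos[of r] S r rR by simp
  \<comment> \<open>Stability against the Hardy potential: equivalent to n - 2 \<ge> 8 for n >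
    2.\<close>
  have "2 * (real n - 2) \<le> ((real n - 2) / 2)\<^sup>2"
  proof -
    have "8 * (real n - 2) \<le> (real n - 2) * (real n - 2)" using n by (intro mult_right_mono) auto
    then show ?thesis by (simp add: power2_eq_square)
  qed
  then show "2 * (real n - 2) * (exp (- 2 * ln (sin r / sin R)) / (sin R)\<^sup>2) \<le> ((real n - 2) / 2)\<^sup>2 / (sin r)\<^sup>2"
    unfolding e using divide_right_mono[of "2 * (real n - 2)" _ "(sin r)\<^sup>2"] by simp
next
  define S where "S = sin R"
  have S: "0 < S" using sin_pos R0 by (simp add: S_def)
  show "- 2 * ln (sin R / sin R) = 0" using S by (simp add: S_def)
  show "filterlim (\<lambda>r. - 2 * ln (sin r / sin R)) at_top (at_right 0)"
    unfolding S_def[symmetric] using S by real_asymp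
  define p where "p = real n / 2 - 1"
  have p: "0 < p" "real n / 2 = p + 1" using n by (auto simp: p_def)
  show "((\<lambda>r. sin r powr (real n / 2 - 1) * (- 2 * ln (sin r / sin R))) \<longlongrightarrow> 0) (at_right 0)"
    unfolding S_def[symmetric] p_def[symmetric] using S p(1) by real_asymp
  have "((\<lambda>r. sin r powr p * (- 2 * cos r)) \<longlongrightarrow> 0 * (- 2 * cos 0)) (at_right 0)"
    by (intro tendsto_intros sin_powr_tendsto_0 p)
  then have "((\<lambda>r. sin r powr p * (- 2 * cos r)) \<longlongrightarrow> 0) (at_right 0)" by simp
  then show "((\<lambda>r. sin r powr (real n / 2) * (- 2 * (cos r / sin r))) \<longlongrightarrow> 0) (at_right 0)"
  proof (rule Lim_transform_eventually)
    show "\<forall>\<^sub>F r in at_right 0. sin r powr p * (- 2 * cos r) = sin r powr (real n / 2) * (- 2 * (cos r / sin r))"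
    proof (rule eventually_at_rightI[of 0 R])
      fix r assume "r \<in> {0<..<R}"
      then have "0 < sin r" using sin_pos by simp
      then show "sin r powr p * (- 2 * cos r) = sin r powr (real n / 2) * (- 2 * (cos r / sin r))"
        unfolding p(2) by (simp add: powr_add)
    qed (rule R0)
  qed
  show "real n * (real n - 2) < (1 + cos R) / (1 - cos R)"
    by (rule less_R0_bound[OF n2 R0 Rpi R(1)])
qed

text \<open>In the shifted unknown w = u + c the solution is w = sin(r)^(-\<alpha>), and the choice
  of \<alpha> makes w^(m-1) = 1/sin(r)^2. \<open>K\<close> is the constant in the nonlinearity,
  rewritten with \<alpha>. \<open>H\<close> integrates 1/(w (w^(m-1) - K)); its logarithm has an
  argument below 1, hence the bound 0.\<close>

lemma singular_solution_powr:
  fixes m :: real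
  assumes m: "1 < m" and n: "Nm m \<le> real n" and R: "R < Defs.R0 n" "(sin R)\<^sup>2 < (real n - 2) / real n"
  defines "\<alpha> \<equiv> 2 / (m - 1)"
  defines "K \<equiv> (real n - 1 - \<alpha>) / (real n - 2 - \<alpha>)" and "c \<equiv> sin R powr (- \<alpha>)"
  shows "singular_solution n R (\<lambda>u. (u + c) * ((u + c) powr (m - 1) - K)) (\<lambda>u. m * (u + c) powr (m - 1) - K)
    (\<lambda>u. ln (1 - K * (u + c) powr (1 - m)) / (K * (m - 1)))
    (\<lambda>r. sin r powr (- \<alpha>) - c) (\<lambda>r. - \<alpha> * (sin r powr (- \<alpha>) * (cos r / sin r)))
    hardy (\<lambda>r. hardy r * hardy_log' r) hardy'' (\<alpha> * (real n - 2 - \<alpha>)) 0"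
proof (rule singular_solutionI[where U''="\<lambda>r. \<alpha> * sin r powr (- \<alpha>) * (\<alpha> * (cos r / sin r)\<^sup>2 + 1 / (sin r)\<^sup>2)"])
  have S: "0 < sin R" using sin_pos R0 by simp
  have a: "0 < \<alpha>" "\<alpha> * (m - 1) = 2" "m * \<alpha> = 2 + \<alpha>" "m / (m - 1) = (2 + \<alpha>) / 2"
    using m by (auto simp: \<alpha>_def field_simps)
  have N: "2 * (2 + \<alpha>) + 4 * sqrt ((2 + \<alpha>) / 2) \<le> real n - 2"
  proof -
    have "Nm m = 2 + 4 * (m / (m - 1)) + 4 * sqrt (m / (m - 1))" by (simp add: Nm_def)
    then show ?thesis using n unfolding a(4) by (simp add: add_divide_distrib)
  qed
  moreover have "0 \<le> sqrt ((2 + \<alpha>) / 2)" using a by simp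
  ultimately have N': "2 * (2 + \<alpha>) \<le> real n - 2" by linarith
  have K: "1 < K" using N' a by (simp add: K_def)
  have K_less: "K < 1 / (sin R)\<^sup>2"
  proof -
    \<comment> \<open>Equivalent to n \<ge> 2 + 2 \<alpha>, which \<open>N'\<close> provides; thus
      the bound on \<open>R\<close> implies 1/sin(R)^2 > K, that is f(0) > 0.\<close>
    have "(real n - 2) / real n \<le> (real n - 2 - \<alpha>) / (real n - 1 - \<alpha>)"
      using N' a by (simp add: divide_simps) (simp add: algebra_simps)
    then have "(sin R)\<^sup>2 < 1 / K" using R(2) by (simp add: K_def)
    then show ?thesis using S K by (simp add: field_simps)
  qed
  have c: "0 < c" using S by (simp add: c_def)
  have cm: "c powr (m - 1) = 1 / (sin R)\<^sup>2"
  proof -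
    have "c powr (m - 1) = sin R powr (- (\<alpha> * (m - 1)))" by (simp add: c_def powr_powr)
    then show ?thesis using S by (simp add: a(2) powr_minus_divide)
  qed
  have wm: "1 / (sin R)\<^sup>2 \<le> (u + c) powr (m - 1)" if "0 \<le> u" for u
    unfolding cm[symmetric] using that c m by (intro powr_mono2) auto
  have wp: "K < (u + c) powr (m - 1)" if "0 \<le> u" for u using wm[OF that] K_less by simp
  have Us: "(sin r powr (- \<alpha>)) powr (m - 1) = 1 / (sin r)\<^sup>2" if "0 < r" "r \<le> R" for r
  proof -
    have "(sin r powr (- \<alpha>)) powr (m - 1) = sin r powr (- (\<alpha> * (m - 1)))" by (simp add: powr_powr)
    then show ?thesis using sin_pos[OF that] by (simp add: a(2) powr_minus_divide)
  qed
  show "((\<lambda>u. (u + c) * ((u + c) powr (m - 1) - K)) has_real_derivative m * (u + c) powr (m - 1) - K) (at u)"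
    if "0 \<le> u" for u
  proof -
    have p: "0 < u + c" using that c by simp
    have "((\<lambda>u. (u + c) * ((u + c) powr (m - 1) - K)) has_real_derivative
       (u + c) powr (m - 1) - K + (u + c) * ((m - 1) * (u + c) powr (m - 1 - 1))) (at u)"
      using p by (auto intro!: derivative_eq_intros)
    moreover have "(u + c) * ((m - 1) * (u + c) powr (m - 1 - 1)) = (m - 1) * (u + c) powr (m - 1)"
      using p powr_mult_base[of "u + c" "m - 1 - 1"] by (simp add: mult.left_commute)
    ultimately show ?thesis by (simp add: algebra_simps)
  qed
  show "m * (u + c) powr (m - 1) - K \<le> m * (v + c) powr (m - 1) - K" if "0 \<le> u" "u \<le> v" for u v
    using that c m by (auto intro!: mult_left_mono powr_mono2)
  have "K < 1 * (0 + c) powr (m - 1)" using wp[of 0] by simp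
  also have "\<dots> \<le> m * (0 + c) powr (m - 1)" using m by (intro mult_right_mono) auto
  finally show "0 \<le> m * (0 + c) powr (m - 1) - K" by simp
  show "0 < (0 + c) * ((0 + c) powr (m - 1) - K)" using c wp[of 0] by simp
  show "0 < \<alpha> * (real n - 2 - \<alpha>)" using N' a by simp
  have arg: "0 < 1 - K * (u + c) powr (1 - m)" if "0 \<le> u" for u
  proof -
    have "(u + c) powr (1 - m) = 1 / (u + c) powr (m - 1)" using powr_minus_divide[of "u + c" "m - 1"] by simp
    moreover have "K / (u + c) powr (m - 1) < 1"
      using wp[OF that] K by (subst pos_divide_less_eq) auto
    ultimately show ?thesis by simp
  qed
  show "((\<lambda>u. ln (1 - K * (u + c) powr (1 - m)) / (K * (m - 1))) has_real_derivative
     1 / ((u + c) * ((u + c) powr (m - 1) - K))) (at u)" if u: "0 \<le> u" for u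
  proof -
    let ?w = "u + c"
    have p: "0 < ?w" using u c by simp
    have "((\<lambda>u. ln (1 - K * (u + c) powr (1 - m)) / (K * (m - 1))) has_real_derivative
       (- (K * ((1 - m) * ?w powr (1 - m - 1))) / (1 - K * ?w powr (1 - m))) / (K * (m - 1))) (at u)"
      using p arg[OF u] K m by (auto intro!: derivative_eq_intros)
    moreover have "(- (K * ((1 - m) * ?w powr (1 - m - 1))) / (1 - K * ?w powr (1 - m))) / (K * (m - 1))
       = ?w powr (- m) / (1 - K * ?w powr (1 - m))"
    proof -
      have "- (K * ((1 - m) * ?w powr (1 - m - 1))) = (K * (m - 1)) * ?w powr (- m)" by (simp add: algebra_simps)
      then show ?thesis using K m by simp
    qed
    moreover have "\<dots> = 1 / (?w * (?w powr (m - 1) - K))"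
    proof -
      have 1: "?w * ?w powr (m - 1) = ?w powr m" using p by (simp add: powr_diff)
      have 2: "?w powr m * ?w powr (1 - m) = ?w" using p by (simp flip: powr_add)
      have "?w * (?w powr (m - 1) - K) = ?w powr m * (1 - K * ?w powr (1 - m))"
        using 1 2 by (simp add: right_diff_distrib mult.left_commute mult.commute)
      moreover have "?w powr (- m) = 1 / ?w powr m" by (simp add: powr_minus_divide)
      ultimately show ?thesis by simp
    qed
    ultimately show ?thesis by simp
  qed
  show "ln (1 - K * (u + c) powr (1 - m)) / (K * (m - 1)) \<le> 0" if "0 \<le> u" for u
  proof -
    have "ln (1 - K * (u + c) powr (1 - m)) \<le> 0" using arg[OF that] K by (simp add: ln_le_zero_iff)
    then show ?thesis using K m by (simp add: divide_nonpos_pos)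
  qed
  fix r :: real assume r: "0 < r"
  have w': "((\<lambda>r. sin r powr (- \<alpha>)) has_real_derivative - \<alpha> * (sin r powr (- \<alpha>) * (cos r / sin r))) (at r)"
    if "r \<le> R"
    using sin_pos[OF r that] by (auto intro!: derivative_eq_intros simp: powr_diff)
  show "((\<lambda>r. sin r powr (- \<alpha>) - c) has_real_derivative - \<alpha> * (sin r powr (- \<alpha>) * (cos r / sin r))) (at r)"
    if "r \<le> R" using DERIV_diff[OF w'[OF that] DERIV_const[of c]] by simp
  show "((\<lambda>r. - \<alpha> * (sin r powr (- \<alpha>) * (cos r / sin r))) has_real_derivative
     \<alpha> * sin r powr (- \<alpha>) * (\<alpha> * (cos r / sin r)\<^sup>2 + 1 / (sin r)\<^sup>2)) (at r)" if "r \<le> R"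
    by (rule DERIV_cong[OF DERIV_cmult[OF DERIV_mult[OF w'[OF that] cot_deriv[OF r that]]]])
      (simp add: power2_eq_square algebra_simps)
  assume rR: "r < R"
  define w where "w = sin r powr (- \<alpha>)"
  define i where "i = 1 / (sin r)\<^sup>2"
  have wi: "w powr (m - 1) = i" using Us[of r] r rR by (simp add: w_def i_def)
  have KL: "(real n - 2 - \<alpha>) * K = real n - 1 - \<alpha>" using N' a by (simp add: K_def)
  have "\<alpha> * w * (\<alpha> * (i - 1) + i) - (real n - 1) * \<alpha> * w * (i - 1)
     = - (\<alpha> * (w * ((real n - 2 - \<alpha>) * i - (real n - 1 - \<alpha>))))" by (simp add: algebra_simps)
  also have "\<dots> = - (\<alpha> * (real n - 2 - \<alpha>) * (w * (i - K)))" unfolding KL[symmetric] by (simp add: algebra_simps)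
  finally have ode: "\<alpha> * w * (\<alpha> * (i - 1) + i) - (real n - 1) * \<alpha> * w * (i - 1)
     = - (\<alpha> * (real n - 2 - \<alpha>) * (w * (i - K)))" .
  define k where "k = cos r / sin r"
  have k: "k\<^sup>2 = i - 1" using cot_sq[of r] r rR by (simp add: k_def i_def)
  have "\<alpha> * w * (\<alpha> * k\<^sup>2 + i) + (real n - 1) * k * (- \<alpha> * (w * k))
     = \<alpha> * w * (\<alpha> * (i - 1) + i) - (real n - 1) * \<alpha> * w * (i - 1)"
    unfolding k[symmetric] by (simp add: power2_eq_square algebra_simps)
  then show "\<alpha> * sin r powr (- \<alpha>) * (\<alpha> * (cos r / sin r)\<^sup>2 + 1 / (sin r)\<^sup>2)
      + (real n - 1) * (cos r / sin r) * (- \<alpha> * (sin r powr (- \<alpha>) * (cos r / sin r)))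
    = - (\<alpha> * (real n - 2 - \<alpha>) * ((sin r powr (- \<alpha>) - c + c) * ((sin r powr (- \<alpha>) - c + c) powr (m - 1) - K)))"
    unfolding w_def[symmetric] i_def[symmetric] k_def[symmetric] ode diff_add_cancel wi .
  show "0 < sin r powr (- \<alpha>) - c"
    using sin_less_sin_R[OF r rR] sin_pos[of r] r rR a powr_less_mono2_neg[of "- \<alpha>" "sin r" "sin R"]
    by (simp add: c_def)
  \<comment> \<open>Completing the square in (2 + \<alpha>)(n - 2 - \<alpha>) \<le> ((n - 2)/2)^2
    shows that \<open>Nm m\<close> is the larger root of the corresponding quadratic in n.\<close>
  have "2 * sqrt ((2 + \<alpha>) / 2) \<le> (real n - 2) / 2 - (2 + \<alpha>)" using N by (simp add: field_simps)
  then have "(2 * sqrt ((2 + \<alpha>) / 2))\<^sup>2 \<le> ((real n - 2) / 2 - (2 + \<alpha>))\<^sup>2"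
    using a by (intro power_mono) auto
  moreover have "(2 * sqrt ((2 + \<alpha>) / 2))\<^sup>2 = 2 * (2 + \<alpha>)" using a by (simp add: power_mult_distrib)
  moreover have "((real n - 2) / 2)\<^sup>2 - (2 + \<alpha>) * (real n - 2 - \<alpha>) = ((real n - 2) / 2 - (2 + \<alpha>))\<^sup>2 - 2 * (2 + \<alpha>)"
    by (simp add: power2_eq_square field_simps)
  ultimately have "(m * \<alpha>) * (real n - 2 - \<alpha>) \<le> ((real n - 2) / 2)\<^sup>2" unfolding a(3) by linarith
  then have "(m * \<alpha>) * (real n - 2 - \<alpha>) * i \<le> ((real n - 2) / 2)\<^sup>2 * i"
    by (rule mult_right_mono) (simp add: i_def)
  moreover have "0 \<le> \<alpha> * (real n - 2 - \<alpha>) * K" using N' a K by simp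
  ultimately have "\<alpha> * (real n - 2 - \<alpha>) * (m * i - K) \<le> ((real n - 2) / 2)\<^sup>2 * i"
    by (simp add: algebra_simps)
  then show "\<alpha> * (real n - 2 - \<alpha>) * (m * (sin r powr (- \<alpha>) - c + c) powr (m - 1) - K)
     \<le> ((real n - 2) / 2)\<^sup>2 / (sin r)\<^sup>2"
    using wi by (simp add: w_def[symmetric] i_def)
next
  have a: "0 < \<alpha>" "4 * m / (m - 1) = 4 + 2 * \<alpha>" using m by (auto simp: \<alpha>_def field_simps)
  have "0 \<le> sqrt (m / (m - 1))" using m by simp
  \<comment> \<open>The dimension bound also makes sin(r)^(n/2 - 1 - \<alpha>) tend to 0, the rate
    at which the boundary terms vanish.\<close>
  then have "6 + 2 * \<alpha> \<le> real n" using n unfolding Nm_def a(2) by linarith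
  then have d: "0 < real n / 2 - 1 - \<alpha>" by simp
  show "sin R powr (- \<alpha>) - c = 0" by (simp add: c_def)
  show "filterlim (\<lambda>r. sin r powr (- \<alpha>) - c) at_top (at_right 0)" using a(1) by real_asymp
  define p where "p = real n / 2 - 1"
  have p: "0 < p" "0 < p - \<alpha>" "real n / 2 = p + 1" using d a by (auto simp: p_def)
  have "((\<lambda>r. sin r powr (p - \<alpha>) - c * sin r powr p) \<longlongrightarrow> 0 - c * 0) (at_right 0)"
    by (intro tendsto_intros sin_powr_tendsto_0 p)
  then have "((\<lambda>r. sin r powr (p - \<alpha>) - c * sin r powr p) \<longlongrightarrow> 0) (at_right 0)" by simp
  then show "((\<lambda>r. sin r powr (real n / 2 - 1) * (sin r powr (- \<alpha>) - c)) \<longlongrightarrow> 0) (at_right 0)"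
  proof (rule Lim_transform_eventually)
    show "\<forall>\<^sub>F r in at_right 0. sin r powr (p - \<alpha>) - c * sin r powr p
        = sin r powr (real n / 2 - 1) * (sin r powr (- \<alpha>) - c)"
      by (intro eventuallyI) (simp add: p_def[symmetric] right_diff_distrib mult.commute flip: powr_add)
  qed
  have "((\<lambda>r. sin r powr (p - \<alpha>) * (- \<alpha> * cos r)) \<longlongrightarrow> 0 * (- \<alpha> * cos 0)) (at_right 0)"
    by (intro tendsto_intros sin_powr_tendsto_0 p)
  then have "((\<lambda>r. sin r powr (p - \<alpha>) * (- \<alpha> * cos r)) \<longlongrightarrow> 0) (at_right 0)" by simp
  then show "((\<lambda>r. sin r powr (real n / 2) * (- \<alpha> * (sin r powr (- \<alpha>) * (cos r / sin r)))) \<longlongrightarrow> 0) (at_right 0)"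
  proof (rule Lim_transform_eventually)
    show "\<forall>\<^sub>F r in at_right 0. sin r powr (p - \<alpha>) * (- \<alpha> * cos r)
       = sin r powr (real n / 2) * (- \<alpha> * (sin r powr (- \<alpha>) * (cos r / sin r)))"
    proof (rule eventually_at_rightI[of 0 R])
      fix r assume "r \<in> {0<..<R}"
      then have s: "0 < sin r" using sin_pos by simp
      have "sin r powr (p - \<alpha>) = sin r powr p * sin r powr (- \<alpha>)" by (simp flip: powr_add)
      then show "sin r powr (p - \<alpha>) * (- \<alpha> * cos r)
         = sin r powr (real n / 2) * (- \<alpha> * (sin r powr (- \<alpha>) * (cos r / sin r)))"
        using s unfolding p(3) by (simp add: powr_add)
    qed (rule R0)
  qed
  show "real n * (real n - 2) < (1 + cos R) / (1 - cos R)"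
    by (rule less_R0_bound[OF n2 R0 Rpi R(1)])
qed

end

theorem theorem1p6:
  fixes R :: real
  assumes n3: "CARD('n::finite) \<ge> 3"
    and R: "0 < R" "R < pi/2"
  shows
  "(let n = real CARD('n);
        f = (\<lambda>u. exp u / (sin R)^2 - (n-1)/(n-2));
        Re = arcsin (sqrt ((n-2)/(n-1)))
    in CARD('n) \<ge> 10 \<and> R < min (R0 CARD('n)) Re \<longrightarrow>
       lam_star TYPE('n) f R = 2*(n-2) \<and>
       (\<forall>x::real^'n. 0 < norm x \<and> norm x < R \<longrightarrow>
          ((\<lambda>lam. u_min lam f R x) \<longlongrightarrow> - 2 * ln (sin (norm x) / sin R))
            (at_left (lam_star TYPE('n) f R))))
   \<and>
   (\<forall>m::real. m > 1 \<longrightarrow>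
     (let n = real CARD('n);
          c = sin R powr (-2/(m-1));
          f = (\<lambda>u. (u + c) * ((u + c) powr (m-1) - ((m-1)*n-(m+1))/((m-1)*n-2*m)));
          Rp = arcsin (sqrt ((n-2)/n))
      in n \<ge> Nm m \<and> R < min (R0 CARD('n)) Rp \<longrightarrow>
         lam_star TYPE('n) f R = 2/(m-1) * (n - 2*m/(m-1)) \<and>
         (\<forall>x::real^'n. 0 < norm x \<and> norm x < R \<longrightarrow>
            ((\<lambda>lam. u_min lam f R x) \<longlongrightarrow> sin (norm x) powr (-2/(m-1)) - c)
              (at_left (lam_star TYPE('n) f R)))))"
proof (intro conjI allI impI)
  interpret sphere_cap "CARD('n)" R by unfold_locales (use n3 R in auto)
  let ?n = "real CARD('n)"
  show "let n = real CARD('n);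
        f = (\<lambda>u. exp u / (sin R)^2 - (n-1)/(n-2));
        Re = arcsin (sqrt ((n-2)/(n-1)))
    in CARD('n) \<ge> 10 \<and> R < min (R0 CARD('n)) Re \<longrightarrow>
       lam_star TYPE('n) f R = 2*(n-2) \<and>
       (\<forall>x::real^'n. 0 < norm x \<and> norm x < R \<longrightarrow>
          ((\<lambda>lam. u_min lam f R x) \<longlongrightarrow> - 2 * ln (sin (norm x) / sin R))
            (at_left (lam_star TYPE('n) f R)))"
    unfolding Let_def
  proof (intro impI conjI allI; elim conjE)
    assume n: "10 \<le> CARD('n)" and Rm: "R < min (R0 CARD('n)) (arcsin (sqrt ((?n - 2) / (?n - 1))))"
    have "(sin R)\<^sup>2 < (?n - 2) / (?n - 1)"
      by (rule sin_sq_less_of_less_arcsin) (use R Rm n3 in auto)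
    note s = singular_solution_exp[OF n _ this]
    show "lam_star TYPE('n) (\<lambda>u. exp u / (sin R)\<^sup>2 - (?n - 1) / (?n - 2)) R = 2 * (?n - 2)"
      by (rule singular_solution.extremal_parameter[OF s refl]) (use Rm in simp)
    fix x :: "real^'n" assume "0 < norm x" "norm x < R"
    then show "((\<lambda>lam. u_min lam (\<lambda>u. exp u / (sin R)\<^sup>2 - (?n - 1) / (?n - 2)) R x)
        \<longlongrightarrow> - 2 * ln (sin (norm x) / sin R))
        (at_left (lam_star TYPE('n) (\<lambda>u. exp u / (sin R)\<^sup>2 - (?n - 1) / (?n - 2)) R))"
      using Rm by (intro singular_solution.extremal_solution[OF s refl]) auto
  qed
  fix m :: real assume m: "1 < m"
  show "let n = real CARD('n);
          c = sin R powr (-2/(m-1));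
          f = (\<lambda>u. (u + c) * ((u + c) powr (m-1) - ((m-1)*n-(m+1))/((m-1)*n-2*m)));
          Rp = arcsin (sqrt ((n-2)/n))
      in n \<ge> Nm m \<and> R < min (R0 CARD('n)) Rp \<longrightarrow>
         lam_star TYPE('n) f R = 2/(m-1) * (n - 2*m/(m-1)) \<and>
         (\<forall>x::real^'n. 0 < norm x \<and> norm x < R \<longrightarrow>
            ((\<lambda>lam. u_min lam f R x) \<longlongrightarrow> sin (norm x) powr (-2/(m-1)) - c)
              (at_left (lam_star TYPE('n) f R)))"
    unfolding Let_def
  proof (intro impI; elim conjE)
    assume n: "Nm m \<le> ?n" and Rm: "R < min (R0 CARD('n)) (arcsin (sqrt ((?n - 2) / ?n)))"
    have sq: "(sin R)\<^sup>2 < (?n - 2) / ?n"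
      by (rule sin_sq_less_of_less_arcsin) (use R Rm n3 in auto)
    have "R < R0 CARD('n)" using Rm by simp
    note s = singular_solution_powr[OF m n this sq]
    \<comment> \<open>Since 2m/(m-1) = 2 + a, cancelling m - 1 brings the quotient and the parameter
      of the statement into the form of \<open>singular_solution_powr\<close>.\<close>
    define a where "a = 2 / (m - 1)"
    have "(m - 1) * ?n - (m + 1) = (m - 1) * (?n - 1 - a)" "(m - 1) * ?n - 2 * m = (m - 1) * (?n - 2 - a)"
      using m by (auto simp: a_def field_simps)
    then have K: "((m - 1) * ?n - (m + 1)) / ((m - 1) * ?n - 2 * m) = (?n - 1 - a) / (?n - 2 - a)"
      using m by simp
    have lam: "2 / (m - 1) * (?n - 2 * m / (m - 1)) = a * (?n - 2 - a)"
      using m by (simp add: a_def field_simps)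
    have e: "- 2 / (m - 1) = - a" by (simp add: a_def)
    note s' = s[folded a_def]
    show "lam_star TYPE('n) (\<lambda>u. (u + sin R powr (- 2 / (m - 1))) * ((u + sin R powr (- 2 / (m - 1))) powr (m - 1)
          - ((m - 1) * ?n - (m + 1)) / ((m - 1) * ?n - 2 * m))) R = 2 / (m - 1) * (?n - 2 * m / (m - 1)) \<and>
      (\<forall>x::real^'n. 0 < norm x \<and> norm x < R \<longrightarrow>
        ((\<lambda>lam. u_min lam (\<lambda>u. (u + sin R powr (- 2 / (m - 1))) * ((u + sin R powr (- 2 / (m - 1))) powr (m - 1)
          - ((m - 1) * ?n - (m + 1)) / ((m - 1) * ?n - 2 * m))) R x)
          \<longlongrightarrow> sin (norm x) powr (- 2 / (m - 1)) - sin R powr (- 2 / (m - 1)))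
        (at_left (lam_star TYPE('n) (\<lambda>u. (u + sin R powr (- 2 / (m - 1))) * ((u + sin R powr (- 2 / (m - 1))) powr (m - 1)
          - ((m - 1) * ?n - (m + 1)) / ((m - 1) * ?n - 2 * m))) R)))"
      unfolding K lam e
      using singular_solution.extremal_parameter[OF s' refl] singular_solution.extremal_solution[OF s' refl]
      by blast
  qed
qed

end
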